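(* Let $s$ and $d$ be coprime positive integers. (a) For odd $s$ and even $d$, \[ |\mathcal{BC}_{(s,s+d,s+2d)}|=|\mathcal{CS}_{(s,s+d,s+2d)}|=|\mathcal{DD}_{(s,s+d,s+2d)}|=\sum_{i=0}^{(s-1)/2}\binom{(s+d-3)/2}{\lfloor i/2 \rfloor}\binom{(s+d-1)/2-\lfloor i/2 \rfloor}{(s-1)/2-i}. \] (b) For odd numbers $s$ and $d$, \[ |\mathcal{BC}_{(s,s+d,s+2d)}|=|\mathcal{CS}_{(s,s+d,s+2d)}|=\sum_{i=0}^{(s-1)/2}\binom{(d-1)/2+i}{\lfloor i/2 \rfloor}\left( \binom{(s+d-2)/2}{(d-1)/2+i} + \binom{(s+d-4)/2}{(d-1)/2+i}\right). \] (c) For even $s$ and odd $d$, \[ |\mathcal{BC}_{(s,s+d,s+2d)}|=\sum_{i=0}^{s/2} \binom{(s+d-1)/2}{\lfloor i/2 \rfloor,\ \lfloor (d+i)/2\rfloor,\ s/2 -i}, \] \[ |\mathcal{CS}_{(s,s+d,s+2d)}|=\sum_{i=0}^{(s-2)/2}\binom{(s+d-3)/2}{\lfloor i/2 \rfloor}\binom{(s+d-3)/2-\lfloor i/2 \rfloor}{(s-2)/2-i}+\sum_{i=0}^{(s-2)/2}\binom{(s+d-5)/2}{\lfloor i/2 \rfloor}\binom{(s+d-1)/2-\lfloor i/2 \rfloor}{(s-2)/2-i}. \] (d) For odd $d$ (and $s$ of any parity), \[ |\mathcal{DD}_{(s,s+d,s+2d)}|=\sum_{i=0}^{ \lfloor(s-1)/2\rfloor}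 \binom{\lfloor (s+d-2)/2\rfloor }{\lfloor i/2 \rfloor,\ \lfloor (d+i)/2\rfloor,\ \lfloor(s-1)/2\rfloor -i}. \]
   Context: A strict partition $\lambda=(\lambda_1>\lambda_2>\cdots>\lambda_\ell)$ is a finite (possibly empty) strictly decreasing sequence of positive integers. $\binom{n}{a,b,c}$ denotes the multinomial coefficient $\frac{n!}{a!\,b!\,c!}$, $a+b+c=n$. Bar-cores: the bar lengths in the $i$th row of $\lambda$ are the elements of $\{\lambda_i+\lambda_{i+1},\dots,\lambda_i+\lambda_\ell\}\cup\big(\{1,2,\dots,\lambda_i\}\setminus\{\lambda_i-\lambda_{i+1},\dots,\lambda_i-\lambda_\ell\}\big)$. $\lambda$ is an $\overline{s}$-core if $s$ is not a bar length in any row of $\lambda$. Shifted diagrams: the shifted Young diagram $S(\lambda)$ has boxes $(i,j)$ (row $i$, column $j$) with $1\le i\le\ell$ and $i\le j\le i+\lambda_i-1$. The shifted hook length of a box $(i,j)$ is the number of boxes consisting of the box itself, the boxes to its right in row $i$, the boxes below it in column $j$, and all boxes of row $j+1$ of $S(\lambda)$ (if that row exists). $\lambda$ is an $s$-CSYD ($s$-core shifted Young diagram) if no shifted hook length of $S(\lambda)$ is divisible by $s$. Doubled distinct partitions: for a strict partition $\lambda$, $\lambda\lambda$ is the ordinary partition with Frobenius symbol $\begin{pmatrix}\lambda_1&\cdots&\lambda_\ell\\ \lambda_1-1&\cdots&\lambda_\ell-1\end{pmatrix}$ (the $i$th diagonal box has arm length $\lambda_i$ and leg length $\lambda_i-1$).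 It is a doubled distinct $s$-core if no hook length of its Young diagram is divisible by $s$. $\mathcal{BC}_{(s_1,s_2,s_3)}$ is the set of strict partitions that are $\overline{s_k}$-cores for all $k=1,2,3$; $\mathcal{CS}_{(s_1,s_2,s_3)}$ is the set of strict partitions that are $s_k$-CSYDs for all $k$; $\mathcal{DD}_{(s_1,s_2,s_3)}$ is the set of doubled distinct partitions $\lambda\lambda$ that are doubled distinct $s_k$-cores for all $k$. The empty partition is included in each set.
   Formalization: The coefficient binom(-1,0), for which no single convention makes both formulas true, is read as 0 in (b) when s=d=1 (second binomial in the bracket) and as 1 in the second sum for |CS| in (c) when s=2, d=1. *)

theory Defs
  imports Main
begin

text \<open>
  Partitions are lists of positive parts in decreasing order. Rows, columns and part indices
  start at 1, so the \<open>i\<close>-th part \<open>\<lambda>\<^sub>i\<close> is the list entry at position \<open>i - 1\<close>.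
\<close>

definition part :: "nat list \<Rightarrow> nat \<Rightarrow> nat" where
  "part p i = p ! (i - 1)"

definition is_partition :: "nat list \<Rightarrow> bool" where
  "is_partition p \<longleftrightarrow> sorted_wrt (\<ge>) p \<and> (\<forall>x\<in>set p. 0 < x)"

definition strict_partition :: "nat list \<Rightarrow> bool" where
  "strict_partition p \<longleftrightarrow> sorted_wrt (>) p \<and> (\<forall>x\<in>set p. 0 < x)"

definition bar_lengths :: "nat list \<Rightarrow> nat \<Rightarrow> nat set" where
  "bar_lengths p i =
     {part p i + part p j | j. i < j \<and> j \<le> length p} \<union>
     ({1..part p i} - {part p i - part p j | j. i < j \<and> j \<le> length p})"

definition bar_core :: "nat \<Rightarrow> nat list \<Rightarrow> bool" where
  "bar_core s p \<longleftrightarrow> (\<forall>i\<in>{1..length p}. s \<notin> bar_lengths p i)"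

definition shifted_diagram :: "nat list \<Rightarrow> (nat \<times> nat) set" where
  "shifted_diagram p = {(i, j). 1 \<le> i \<and> i \<le> length p \<and> i \<le> j \<and> j \<le> i + part p i - 1}"

definition shifted_hook_length :: "nat list \<Rightarrow> nat \<times> nat \<Rightarrow> nat" where
  "shifted_hook_length p = (\<lambda>(i, j). card
     {(a, b) \<in> shifted_diagram p. (a = i \<and> j \<le> b) \<or> (b = j \<and> i < a) \<or> a = j + 1})"

definition csyd :: "nat \<Rightarrow> nat list \<Rightarrow> bool" where
  "csyd s p \<longleftrightarrow> (\<forall>x\<in>shifted_diagram p. \<not> s dvd shifted_hook_length p x)"

definition young_diagram :: "nat list \<Rightarrow> (nat \<times> nat) set" where
  "young_diagram p = {(i, j). 1 \<le> i \<and> i \<le> length p \<and> 1 \<le> j \<and> j \<le> part p i}"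

definition arm :: "nat list \<Rightarrow> nat \<times> nat \<Rightarrow> nat" where
  "arm p = (\<lambda>(i, j). card {b. j < b \<and> (i, b) \<in> young_diagram p})"

definition leg :: "nat list \<Rightarrow> nat \<times> nat \<Rightarrow> nat" where
  "leg p = (\<lambda>(i, j). card {a. i < a \<and> (a, j) \<in> young_diagram p})"

definition hook_length :: "nat list \<Rightarrow> nat \<times> nat \<Rightarrow> nat" where
  "hook_length p x = arm p x + leg p x + 1"

text \<open>The arm lengths and the leg lengths of the diagonal boxes, from top left to bottom right.\<close>

definition frobenius_symbol :: "nat list \<Rightarrow> nat list \<times> nat list" where
  "frobenius_symbol p =
     (let r = card {i. (i, i) \<in> young_diagram p}
      in (map (\<lambda>i. arm p (i, i)) [1..<r + 1], map (\<lambda>i. leg p (i, i)) [1..<r + 1]))"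

text \<open>
  \<open>doubled_distinct p q\<close> says that the ordinary partition \<open>q\<close> is \<open>\<lambda>\<lambda>\<close> for the
  strict partition \<open>\<lambda> = p\<close>.
\<close>

definition doubled_distinct :: "nat list \<Rightarrow> nat list \<Rightarrow> bool" where
  "doubled_distinct p q \<longleftrightarrow>
     strict_partition p \<and> is_partition q \<and> frobenius_symbol q = (p, map (\<lambda>x. x - 1) p)"

definition core :: "nat \<Rightarrow> nat list \<Rightarrow> bool" where
  "core s q \<longleftrightarrow> (\<forall>x\<in>young_diagram q. \<not> s dvd hook_length q x)"

definition BC :: "nat \<Rightarrow> nat \<Rightarrow> nat \<Rightarrow> nat list set" where
  "BC s1 s2 s3 = {p. strict_partition p \<and> bar_core s1 p \<and> bar_core s2 p \<and> bar_core s3 p}"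

definition CS :: "nat \<Rightarrow> nat \<Rightarrow> nat \<Rightarrow> nat list set" where
  "CS s1 s2 s3 = {p. strict_partition p \<and> csyd s1 p \<and> csyd s2 p \<and> csyd s3 p}"

definition DD :: "nat \<Rightarrow> nat \<Rightarrow> nat \<Rightarrow> nat list set" where
  "DD s1 s2 s3 = {q. (\<exists>p. doubled_distinct p q) \<and> core s1 q \<and> core s2 q \<and> core s3 q}"

text \<open>The multinomial coefficient; only used when \<open>a + b + c = n\<close>, where the division is exact.\<close>

definition trinomial :: "nat \<Rightarrow> nat \<Rightarrow> nat \<Rightarrow> nat \<Rightarrow> nat" where
  "trinomial n a b c = fact n div (fact a * fact b * fact c)"

text \<open>
  The counting formulas contain two binomial coefficients whose upper index can be negative, in
  both cases equal to \<open>-1\<close> over \<open>0\<close>. In the formula for \<open>s\<close> and \<open>d\<close> odd the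
  coefficient with upper index \<open>(s + d - 4) / 2\<close> is taken to be \<open>0\<close> when
  \<open>s = d = 1\<close>, since \<open>BC 1 2 3\<close> and \<open>CS 1 2 3\<close> contain only the empty partition.
  In the formula for the \<open>s\<close>-CSYDs with \<open>s\<close> even, the coefficient with upper index
  \<open>(s + d - 5) / 2\<close> is \<open>1\<close> when \<open>s = 2\<close> and \<open>d = 1\<close> (the usual value, and also
  that of truncated subtraction), since \<open>CS 2 3 4\<close> consists of the partitions \<open>[]\<close> and
  \<open>[1]\<close>.
\<close>

end

theory Submission
  imports Defs
begin

text \<open>
  A strict partition with set of parts \<open>X\<close> is encoded by the set \<open>M\<close> of integers consisting of \<open>X\<close>
  and of all \<open>- x\<close> with \<open>x > 0\<close>, \<open>x \<notin> X\<close>; it is also the Maya diagram of the doubled distinct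
  partition. All three core conditions become closure of \<open>M\<close> under subtracting \<open>s\<close>: completely for
  doubled distinct cores, with the exception of \<open>s / 2\<close> for bar-cores, and with this exception but
  without \<open>3 s / 2\<close> for CSYDs. Writing the integers as \<open>d j + (s + d) u\<close>, the heights of the columns
  \<open>j\<close> of a set closed under subtracting \<open>s\<close>, \<open>s + d\<close> and \<open>s + 2 d\<close> form a Motzkin path, which is
  determined by its first \<open>(s + d) div 2\<close> steps because of symmetry. The exceptions only concern the
  middle of the path, and counting paths by their numbers of up and level steps gives the formulas.
\<close>

section \<open>Beta numbers and hook lengths\<close>

text \<open>Columns need full closure under subtracting \<open>t = s + d\<close>, but bar-cores
  exempt \<open>t / 2\<close>. This matters only for \<open>s\<close> and \<open>d\<close> both odd:
  there the sets containing \<open>t / 2\<close> are moved onto the abacus by exchanging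
  \<open>t / 2\<close> and \<open>- t / 2\<close>, and they correspond to paths whose last step is
  level. They are counted by the second binomial in (b). For odd \<open>t\<close> the exempt points
  \<open>s / 2\<close> and \<open>s / 2 + d\<close> sit at the edge joining the columns
  \<open>m\<close> and \<open>m + 1\<close>, which the symmetry maps to itself. This edge limits the
  height \<open>h\<close> of column \<open>m\<close> by \<open>|h + d| \<le> 2\<close>. As
  \<open>h\<close> is odd, there are two possible ends for even \<open>d\<close> and three for odd
  \<open>d\<close>, of which doubled distinct cores keep the middle one. Summing over three
  consecutive ends equals one further step, summing over two equals one step restricted to 0 and 1;
  hence the different upper indices in the formulas. The points \<open>3 s / 2\<close> and
  \<open>3 s / 2 + 3 d\<close> restrict the column before the last when \<open>s\<close> is even and
  split the CSYD count into two sums.\<close>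

lemma initial_segment:
  fixes c :: "nat \<Rightarrow> nat"
  assumes anti: "\<And>a a'. i < a \<Longrightarrow> a \<le> a' \<Longrightarrow> a' \<le> l \<Longrightarrow> P a' \<Longrightarrow> P a"
  shows "{a. i < a \<and> a \<le> l \<and> P a} = {i<..i + card {a. i < a \<and> a \<le> l \<and> P a}}"
proof -
  define D where "D = {a. i < a \<and> a \<le> l \<and> P a}"
  have fin: "finite D"
    by (simp add: D_def)
  have "D = {i<..i + card D}"
  proof (cases "D = {}")
    case False
    obtain m where m: "m \<in> D" "\<And>a. a \<in> D \<Longrightarrow> a \<le> m"
      using Max_in[OF fin False] Max_ge[OF fin] by blast
    have "a \<in> D \<longleftrightarrow> i < a \<and> a \<le> m" for a
      using m anti[of a m] unfolding D_def by (metis (mono_tags, lifting) le_trans mem_Collect_eq)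
    then have "D = {i<..m}"
      by (intro set_eqI) simp
    moreover have "i < m"
      using m(1) by (simp add: D_def)
    ultimately show ?thesis
      by simp
  qed auto
  then show ?thesis
    unfolding D_def .
qed

text \<open>
  Hook lengths of both kinds of diagrams have the shape \<open>b\<^sub>i - y\<close>, where the beta numbers
  \<open>b\<^sub>1 > \<dots> > b\<^sub>l\<close> are the parts themselves for shifted diagrams and the first column hook
  lengths for ordinary ones. The column \<open>j\<close> determines the gap \<open>y\<close> of the beta set.
\<close>

locale beta_numbers =
  fixes b :: "nat \<Rightarrow> nat" and l :: nat
  assumes decr: "\<And>a a'. 1 \<le> a \<Longrightarrow> a < a' \<Longrightarrow> a' \<le> l \<Longrightarrow> b a' < b a"
begin

lemma decr_shift: "1 \<le> a \<Longrightarrow> a \<le> a' \<Longrightarrow> a' \<le> l \<Longrightarrow> a' + b a' \<le> a + b a"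
proof (induction "a' - a" arbitrary: a')
  case (Suc k)
  then have "(a' - 1) + b (a' - 1) \<le> a + b a" "b a' < b (a' - 1)"
    using Suc.hyps(1)[of "a' - 1"] Suc.hyps(2) Suc.prems decr[of "a' - 1" a'] by auto
  then show ?case
    by linarith
qed auto

lemma inj: "inj_on b {1..l}"
  by (rule linorder_inj_onI) (metis atLeastAtMost_iff decr less_irrefl, rule linear)

text \<open>For columns \<open>j \<ge> l\<close> this is a leg length: \<open>a + b a\<close> is the
  first column to the right of row \<open>a\<close>, directly in a shifted diagram and after a shift
  by \<open>l - 1\<close> columns in an ordinary one.\<close>

definition depth :: "nat \<Rightarrow> nat \<Rightarrow> nat" where
  "depth i j = card {a. i < a \<and> a \<le> l \<and> j < a + b a}"

lemma depth_set: "{a. i < a \<and> a \<le> l \<and> j < a + b a} = {i<..i + depth i j}"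
  unfolding depth_def
proof (rule initial_segment)
  fix a a' assume "i < a" "a \<le> a'" "a' \<le> l" "j < a' + b a'"
  then show "j < a + b a"
    using decr_shift[of a a'] by simp
qed

lemma depth_iff: "i < a \<Longrightarrow> a \<le> l \<Longrightarrow> j < a + b a \<longleftrightarrow> a \<le> i + depth i j"
proof -
  assume "i < a" "a \<le> l"
  then have "j < a + b a \<longleftrightarrow> a \<in> {a. i < a \<and> a \<le> l \<and> j < a + b a}"
    by simp
  then show ?thesis
    unfolding depth_set using \<open>i < a\<close> by simp
qed

lemma depth_le: "i \<le> l \<Longrightarrow> i + depth i j \<le> l"
proof -
  assume "i \<le> l"
  have "{i<..i + depth i j} \<subseteq> {i<..l}"
    unfolding depth_set[symmetric] by auto
  then show ?thesis
    using \<open>i \<le> l\<close> by (cases "depth i j = 0") (auto simp: subset_eq)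
qed

text \<open>The ends \<open>a + b a\<close> cross \<open>j\<close> right after row
  \<open>i + depth i j\<close>. Rows up to there have beta numbers above the value on the right,
  later rows have beta numbers below it, so it is skipped.\<close>

lemma column_gap:
  assumes "i \<le> l" "l \<le> j" "i < a" "a \<le> l"
  shows "b a \<noteq> j - i - depth i j"
proof (cases "j < a + b a")
  case True
  then have "a \<le> i + depth i j"
    using depth_iff[of i a j] assms by simp
  then show ?thesis
    using True depth_le[OF assms(1), of j] assms by linarith
next
  case False
  then have "i + depth i j < a"
    using depth_iff[of i a j] assms by simp
  then show ?thesis
    using False assms by linarith
qed

text \<open>Converse of \<open>column_gap\<close>: a gap \<open>y\<close> with \<open>r\<close>
  larger beta numbers below row \<open>i\<close> must have depth \<open>r\<close>, which leaves only
  the column \<open>i + y + r\<close>.\<close>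

lemma gap_column:
  assumes i: "i \<le> l" and gap: "\<And>a. i < a \<Longrightarrow> a \<le> l \<Longrightarrow> b a \<noteq> y"
  defines "j \<equiv> i + y + card {a. i < a \<and> a \<le> l \<and> y < b a}"
  shows "l \<le> j" "y = j - i - depth i j"
proof -
  define r where "r = card {a. i < a \<and> a \<le> l \<and> y < b a}"
  have r: "{a. i < a \<and> a \<le> l \<and> y < b a} = {i<..i + r}"
    unfolding r_def
  proof (rule initial_segment)
    fix a a' assume "i < a" "a \<le> a'" "a' \<le> l" "y < b a'"
    then show "y < b a"
      using decr[of a a'] by (cases "a = a'") auto
  qed
  have "{i<..i + r} \<subseteq> {i<..l}"
    unfolding r[symmetric] by auto
  then have rl: "i + r \<le> l"
    using i by (cases "r = 0") (auto simp: subset_eq)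
  have small: "b a < y" if "i + r < a" "a \<le> l" for a
  proof -
    have "a \<notin> {a. i < a \<and> a \<le> l \<and> y < b a}"
      unfolding r using that by simp
    then show ?thesis
      using gap[of a] that by auto
  qed
  \<comment> \<open>The remaining \<open>l - i - r\<close> beta numbers are distinct and smaller
    than \<open>y\<close>, so \<open>l - i - r \<le> y\<close>.\<close>
  have "inj_on b {i + r<..l}"
    by (rule inj_on_subset[OF inj]) auto
  moreover have "b ` {i + r<..l} \<subseteq> {..<y}"
    using small by auto
  ultimately have "card {i + r<..l} \<le> card {..<y}"
    by (metis card_inj_on_le finite_lessThan)
  then show "l \<le> j"
    unfolding j_def r_def[symmetric] by simp
  have "{a. i < a \<and> a \<le> l \<and> j < a + b a} = {i<..i + r}"
  proof (intro equalityI subsetI)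
    fix a assume a: "a \<in> {i<..i + r}"
    then have "i + r \<in> {a. i < a \<and> a \<le> l \<and> y < b a}"
      unfolding r by auto
    then have "j < i + r + b (i + r)"
      by (simp add: j_def r_def)
    also have "\<dots> \<le> a + b a"
      using a rl by (intro decr_shift) auto
    finally show "a \<in> {a. i < a \<and> a \<le> l \<and> j < a + b a}"
      using a rl by auto
  next
    fix a assume a: "a \<in> {a. i < a \<and> a \<le> l \<and> j < a + b a}"
    have "\<not> i + r < a"
    proof
      assume "i + r < a"
      then have "a + b a \<le> Suc (i + r) + b (Suc (i + r))"
        using a by (intro decr_shift) auto
      moreover have "b (Suc (i + r)) < y"
        using small \<open>i + r < a\<close> a by auto
      ultimately show False
        using a by (simp add: j_def r_def)
    qed
    then show "a \<in> {i<..i + r}"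
      using a by auto
  qed
  then have "depth i j = r"
    by (simp add: depth_def)
  then show "y = j - i - depth i j"
    by (simp add: j_def r_def)
qed

text \<open>Arm plus one is \<open>i + b i - j\<close> and the leg is
  \<open>depth i j = j - i - y\<close> for the gap \<open>y\<close> of column \<open>j\<close>; the
  sum is \<open>b i - y\<close>.\<close>

lemma row_hooks:
  assumes "1 \<le> i" "i \<le> l"
  shows "(\<lambda>j. i + b i - j + depth i j) ` {l..<i + b i} =
    {b i - y | y. y < b i \<and> (\<forall>a. i < a \<and> a \<le> l \<longrightarrow> b a \<noteq> y)}"
proof (intro equalityI subsetI)
  fix h assume "h \<in> (\<lambda>j. i + b i - j + depth i j) ` {l..<i + b i}"
  then obtain j where j: "l \<le> j" "j < i + b i" "h = i + b i - j + depth i j"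
    by auto
  have "i + depth i j \<le> j"
    using depth_le[of i j] assms j by simp
  then have "h = b i - (j - i - depth i j)" "j - i - depth i j < b i"
    using j by linarith+
  then show "h \<in> {b i - y | y. y < b i \<and> (\<forall>a. i < a \<and> a \<le> l \<longrightarrow> b a \<noteq> y)}"
    using column_gap[of i j] assms j(1) by blast
next
  fix h assume "h \<in> {b i - y | y. y < b i \<and> (\<forall>a. i < a \<and> a \<le> l \<longrightarrow> b a \<noteq> y)}"
  then obtain y where y: "h = b i - y" "y < b i" "\<And>a. i < a \<Longrightarrow> a \<le> l \<Longrightarrow> b a \<noteq> y"
    by auto
  define R where "R = {a. i < a \<and> a \<le> l \<and> y < b a}"
  define j where "j = i + y + card R"
  have j: "l \<le> j" "y = j - i - depth i j"
    using gap_column[OF assms(2) y(3)] by (auto simp: j_def R_def)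
  \<comment> \<open>The later beta numbers above \<open>y\<close> fit strictly between
    \<open>y\<close> and \<open>b i\<close>, so the column of \<open>y\<close> still meets row
    \<open>i\<close>.\<close>
  have "inj_on b R"
    by (rule inj_on_subset[OF inj]) (auto simp: R_def)
  moreover have "b ` R \<subseteq> {y<..<b i}"
    using decr[of i] assms by (auto simp: R_def)
  ultimately have "card R \<le> card {y<..<b i}"
    by (metis card_inj_on_le finite_greaterThanLessThan)
  then have "j < i + b i"
    using y(2) by (simp add: j_def)
  moreover have "i + depth i j \<le> j"
    using depth_le[of i j] assms j by simp
  then have "h = i + b i - j + depth i j"
    using y j(2) \<open>j < i + b i\<close> by simp
  ultimately show "h \<in> (\<lambda>j. i + b i - j + depth i j) ` {l..<i + b i}"
    using j by auto
qed

end

section \<open>Strict partitions as symmetric sets of integers\<close>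

definition bead_set :: "nat list \<Rightarrow> int set" where
  "bead_set p = {z. (0 < z \<and> nat z \<in> set p) \<or> (z < 0 \<and> nat (- z) \<notin> set p)}"

text \<open>The point 0 is its own negative. Declaring it a gap agrees with Maya diagrams, where a
  bead at 0 would be a diagonal box with arm 0.\<close>

definition symmetric_beads :: "int set \<Rightarrow> bool" where
  "symmetric_beads M \<longleftrightarrow>
     finite {z \<in> M. 0 < z} \<and> 0 \<notin> M \<and> (\<forall>z. z \<noteq> 0 \<longrightarrow> (- z \<in> M \<longleftrightarrow> z \<notin> M))"

definition bar_closed :: "int \<Rightarrow> int set \<Rightarrow> bool" where
  "bar_closed k M \<longleftrightarrow> (\<forall>z\<in>M. 2 * z \<noteq> k \<longrightarrow> z - k \<in> M)"

definition shift_closed :: "int \<Rightarrow> int set \<Rightarrow> bool" where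
  "shift_closed k M \<longleftrightarrow> (\<forall>z\<in>M. z - k \<in> M)"

lemma strict_partition_eqI:
  assumes "sorted_wrt (>) p" "sorted_wrt (>) q" "set p = set (q :: nat list)"
  shows "p = q"
proof -
  have "rev p = rev q"
    using assms by (intro strict_sorted_equal) (simp_all add: sorted_wrt_rev)
  then show ?thesis
    by simp
qed

lemma sorted_wrt_greater_rev_sorted_list_of_set:
  "sorted_wrt (>) (rev (sorted_list_of_set (A :: nat set)))"
  by (simp add: sorted_wrt_rev)

lemma bead_set_pos: "0 < x \<Longrightarrow> int x \<in> bead_set p \<longleftrightarrow> x \<in> set p"
  by (simp add: bead_set_def)

lemma bead_set_neg: "0 < x \<Longrightarrow> - int x \<in> bead_set p \<longleftrightarrow> x \<notin> set p"
  by (simp add: bead_set_def)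

lemma symmetric_bead_set: "symmetric_beads (bead_set p)"
proof -
  have "{z \<in> bead_set p. 0 < z} \<subseteq> int ` set p"
  proof
    fix z assume "z \<in> {z \<in> bead_set p. 0 < z}"
    then show "z \<in> int ` set p"
      by (intro image_eqI[of _ _ "nat z"]) (auto simp: bead_set_def)
  qed
  then have "finite {z \<in> bead_set p. 0 < z}"
    by (rule finite_subset) simp
  then show ?thesis
    by (auto simp: symmetric_beads_def bead_set_def)
qed

lemma bij_betw_bead_set: "bij_betw bead_set {p. strict_partition p} {M. symmetric_beads M}"
  unfolding bij_betw_def
proof
  show "inj_on bead_set {p. strict_partition p}"
  proof (rule inj_onI)
    fix p q assume *: "p \<in> {p. strict_partition p}" "q \<in> {p. strict_partition p}"
      "bead_set p = bead_set q"
    have "x \<in> set p \<longleftrightarrow> x \<in> set q" for x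
    proof (cases "0 < x")
      case True
      then show ?thesis
        using bead_set_pos[of x p] bead_set_pos[of x q] *(3) by simp
    qed (use * in \<open>auto simp: strict_partition_def\<close>)
    then show "p = q"
      using * by (intro strict_partition_eqI) (auto simp: strict_partition_def)
  qed
  show "bead_set ` {p. strict_partition p} = {M. symmetric_beads M}"
  proof (intro equalityI subsetI)
    fix M assume M: "M \<in> {M. symmetric_beads M}"
    define X where "X = {x. 0 < x \<and> int x \<in> M}"
    define p where "p = rev (sorted_list_of_set X)"
    have "int ` X \<subseteq> {z \<in> M. 0 < z}"
      by (auto simp: X_def)
    then have "finite X"
      using M finite_subset finite_imageD[of int X] by (auto simp: symmetric_beads_def)
    then have p: "set p = X"
      by (simp add: p_def)
    have "strict_partition p"
      unfolding strict_partition_def p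
      using sorted_wrt_greater_rev_sorted_list_of_set[of X] by (auto simp: p_def X_def)
    moreover have "bead_set p = M"
      using M by (auto simp: bead_set_def p X_def symmetric_beads_def not_less le_less)
    ultimately show "M \<in> bead_set ` {p. strict_partition p}"
      by blast
  qed (auto simp: symmetric_bead_set)
qed

lemma card_strict_partitions:
  assumes "\<And>p. strict_partition p \<Longrightarrow> P p \<longleftrightarrow> Q (bead_set p)"
  shows "card {p. strict_partition p \<and> P p} = card {M. symmetric_beads M \<and> Q M}"
proof -
  have "bead_set ` {p. strict_partition p \<and> P p} = {M \<in> bead_set ` {p. strict_partition p}. Q M}"
    using assms by auto
  then have "bead_set ` {p. strict_partition p \<and> P p} = {M. symmetric_beads M \<and> Q M}"
    unfolding bij_betw_imp_surj_on[OF bij_betw_bead_set] by simp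
  moreover have "inj_on bead_set {p. strict_partition p \<and> P p}"
    by (rule inj_on_subset[OF bij_betw_imp_inj_on[OF bij_betw_bead_set]]) auto
  ultimately show ?thesis
    by (metis card_image)
qed

lemma part_in_set: "1 \<le> i \<Longrightarrow> i \<le> length p \<Longrightarrow> part p i \<in> set p"
  by (simp add: part_def)

lemma set_conv_part: "set p = {part p i | i. 1 \<le> i \<and> i \<le> length p}"
proof (intro equalityI subsetI)
  fix x assume "x \<in> set p"
  then obtain k where "k < length p" "x = p ! k"
    by (metis in_set_conv_nth)
  then show "x \<in> {part p i | i. 1 \<le> i \<and> i \<le> length p}"
    by (auto simp: part_def intro!: exI[of _ "Suc k"])
qed (auto simp: part_in_set)

lemma part_strict:
  assumes "sorted_wrt (>) p" "1 \<le> i" "i < j" "j \<le> length p"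
  shows "part p j < part p i"
  using assms sorted_wrt_nth_less[of "(>)" p "i - 1" "j - 1"] by (auto simp: part_def)

lemma later_parts:
  assumes p: "sorted_wrt (>) p" and i: "1 \<le> i" "i \<le> length p"
  shows "{part p j | j. i < j \<and> j \<le> length p} = {y \<in> set p. y < part p i}"
proof (intro equalityI subsetI)
  fix y assume "y \<in> {y \<in> set p. y < part p i}"
  then obtain j where j: "1 \<le> j" "j \<le> length p" "y = part p j" "part p j < part p i"
    by (auto simp: set_conv_part)
  then have "i < j"
    using part_strict[OF p j(1), of i] i by (metis less_asym linorder_neqE_nat)
  then show "y \<in> {part p j | j. i < j \<and> j \<le> length p}"
    using j by auto
next
  fix y assume "y \<in> {part p j | j. i < j \<and> j \<le> length p}"
  then show "y \<in> {y \<in> set p. y < part p i}"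
    using part_strict[OF p i(1)] i part_in_set by fastforce
qed

lemma bar_lengths_iff:
  assumes p: "strict_partition p" and i: "1 \<le> i" "i \<le> length p" and s: "0 < s"
  defines "x \<equiv> part p i"
  shows "s \<in> bar_lengths p i \<longleftrightarrow>
    (\<exists>y\<in>set p. y < x \<and> s = x + y) \<or> (s \<le> x \<and> x - s \<notin> set p)"
proof -
  have L: "{y \<in> set p. y < x} = {part p j | j. i < j \<and> j \<le> length p}"
    using later_parts[of p i] p i by (simp add: strict_partition_def x_def)
  have "{x + part p j | j. i < j \<and> j \<le> length p} = (+) x ` {part p j | j. i < j \<and> j \<le> length p}"
    by auto
  moreover have "{x - part p j | j. i < j \<and> j \<le> length p} =
      (-) x ` {part p j | j. i < j \<and> j \<le> length p}"
    by auto
  ultimately have "bar_lengths p i =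
      (+) x ` {y \<in> set p. y < x} \<union> ({1..x} - (-) x ` {y \<in> set p. y < x})"
    unfolding L by (simp only: bar_lengths_def x_def)
  moreover have "s \<in> (-) x ` {y \<in> set p. y < x} \<longleftrightarrow> x - s \<in> set p" if "s \<le> x"
    using that s by (force simp: image_iff)
  ultimately show ?thesis
    using s by auto
qed

lemma bar_core_iff:
  assumes p: "strict_partition p" and s: "0 < s"
  shows "bar_core s p \<longleftrightarrow> (\<forall>x\<in>set p. (\<forall>y\<in>set p. y < x \<longrightarrow> x + y \<noteq> s) \<and> (s \<le> x \<longrightarrow> x - s \<in> set p))"
proof -
  have "bar_core s p \<longleftrightarrow> (\<forall>i. 1 \<le> i \<and> i \<le> length p \<longrightarrow> s \<notin> bar_lengths p i)"
    by (auto simp: bar_core_def)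
  also have "\<dots> \<longleftrightarrow> (\<forall>i. 1 \<le> i \<and> i \<le> length p \<longrightarrow>
      (\<forall>y\<in>set p. y < part p i \<longrightarrow> part p i + y \<noteq> s) \<and> (s \<le> part p i \<longrightarrow> part p i - s \<in> set p))"
    using bar_lengths_iff[OF p _ _ s] by auto
  also have "\<dots> \<longleftrightarrow> (\<forall>x\<in>set p. (\<forall>y\<in>set p. y < x \<longrightarrow> x + y \<noteq> s) \<and> (s \<le> x \<longrightarrow> x - s \<in> set p))"
    using part_in_set[of _ p] set_conv_part[of p] by (smt (verit, best) mem_Collect_eq)
  finally show ?thesis .
qed

text \<open>For a part \<open>x > s\<close> closure says that \<open>x - s\<close> is a part, for
  \<open>x < s\<close> that \<open>s - x\<close> is not. The latter is a bar condition only for two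
  different parts, hence the exemption of \<open>x = s / 2\<close>. For a negative bead
  \<open>- x\<close> closure is the contrapositive of the first condition.\<close>

lemma bar_core_iff_bar_closed:
  assumes p: "strict_partition p" and s: "0 < s"
  shows "bar_core s p \<longleftrightarrow> bar_closed (int s) (bead_set p)"
  unfolding bar_core_iff[OF assms]
proof
  have pos: "0 \<notin> set p"
    using p by (auto simp: strict_partition_def)
  assume *: "\<forall>x\<in>set p. (\<forall>y\<in>set p. y < x \<longrightarrow> x + y \<noteq> s) \<and> (s \<le> x \<longrightarrow> x - s \<in> set p)"
  show "bar_closed (int s) (bead_set p)"
    unfolding bar_closed_def
  proof (intro ballI impI)
    fix z assume z: "z \<in> bead_set p" "2 * z \<noteq> int s"
    show "z - int s \<in> bead_set p"
    proof (cases "0 < z")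
      case True
      then have x: "nat z \<in> set p"
        using z by (simp add: bead_set_def)
      show ?thesis
      proof (cases "s \<le> nat z")
        case True
        then have "nat z - s \<in> set p"
          using * x by blast
        moreover from this have "nat z - s \<noteq> 0"
          using pos by metis
        ultimately have "int (nat z - s) \<in> bead_set p"
          using bead_set_pos by blast
        moreover have "int (nat z - s) = z - int s"
          using True \<open>0 < z\<close> by linarith
        ultimately show ?thesis
          by metis
      next
        case False
        have "s - nat z \<notin> set p"
        proof
          assume y: "s - nat z \<in> set p"
          have "nat z \<noteq> s - nat z"
            using z(2) False True by auto
          then show False
            using * x y False by (metis add.commute le_add_diff_inverse linorder_neqE_nat nat_le_linear)
        qed
        then show ?thesis
          using False True by (auto simp: bead_set_def nat_diff_distrib')
      qed
    next
      case False
      then have x: "z < 0" "nat (- z) \<notin> set p"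
        using z by (auto simp: bead_set_def)
      have "nat (- z) + s \<notin> set p"
        using * x by (metis add_diff_cancel_right' le_add2)
      moreover have "nat (- z) + s = nat (- (z - int s))"
        using x(1) by linarith
      ultimately show ?thesis
        using x(1) by (simp add: bead_set_def)
    qed
  qed
next
  have pos: "0 \<notin> set p"
    using p by (auto simp: strict_partition_def)
  assume *: "bar_closed (int s) (bead_set p)"
  show "\<forall>x\<in>set p. (\<forall>y\<in>set p. y < x \<longrightarrow> x + y \<noteq> s) \<and> (s \<le> x \<longrightarrow> x - s \<in> set p)"
  proof (intro ballI conjI impI)
    fix x y assume x: "x \<in> set p" and y: "y \<in> set p" "y < x"
    have "0 < x" "0 < y"
      using x y pos by (auto intro: gr0I)
    show "x + y \<noteq> s"
    proof
      assume "x + y = s"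
      then have "int x - int s = - int y" "2 * int x \<noteq> int s"
        using y by auto
      moreover have "int x \<in> bead_set p" "- int y \<notin> bead_set p"
        using x y \<open>0 < x\<close> \<open>0 < y\<close> by (auto simp: bead_set_pos bead_set_neg)
      ultimately show False
        using * by (metis bar_closed_def)
    qed
  next
    fix x assume x: "x \<in> set p" "s \<le> x"
    then have "int x \<in> bead_set p" "2 * int x \<noteq> int s"
      using s by (auto simp: bead_set_pos)
    then have "int x - int s \<in> bead_set p"
      using * by (auto simp: bar_closed_def)
    then show "x - s \<in> set p"
      using x by (simp add: bead_set_def nat_diff_distrib')
  qed
qed

lemma symmetric_beads_uminus: "symmetric_beads M \<Longrightarrow> z \<noteq> 0 \<Longrightarrow> - z \<in> M \<longleftrightarrow> z \<notin> M"
  by (simp add: symmetric_beads_def)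

text \<open>
  A sequence \<open>z, z - s, z - 2 s, \<dots>\<close> can leave the set only after meeting \<open>s / 2\<close>.
\<close>

lemma bar_closed_multiples_iff:
  assumes M: "symmetric_beads M" and s: "0 < s"
  shows "(\<forall>n\<ge>1. bar_closed (int n * s) M) \<longleftrightarrow> bar_closed s M \<and> (\<forall>z\<in>M. 2 * z \<noteq> 3 * s)"
proof (intro iffI conjI)
  assume *: "\<forall>n\<ge>1. bar_closed (int n * s) M"
  from *[rule_format, of 1] show s1: "bar_closed s M"
    by simp
  have s2: "bar_closed (2 * s) M"
    using *[rule_format, of 2] by simp
  show "\<forall>z\<in>M. 2 * z \<noteq> 3 * s"
  proof (intro ballI notI)
    fix z assume z: "z \<in> M" "2 * z = 3 * s"
    then have "z - s \<in> M" "z - 2 * s \<in> M"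
      using s1 s2 s by (auto simp: bar_closed_def)
    moreover have "z - 2 * s = - (z - s)" "z - s \<noteq> 0"
      using z(2) s by auto
    ultimately show False
      using symmetric_beads_uminus[OF M, of "z - s"] by simp
  qed
next
  assume "bar_closed s M \<and> (\<forall>z\<in>M. 2 * z \<noteq> 3 * s)"
  then have s1: "\<And>z. z \<in> M \<Longrightarrow> 2 * z \<noteq> s \<Longrightarrow> z - s \<in> M" and s3: "\<And>z. z \<in> M \<Longrightarrow> 2 * z \<noteq> 3 * s"
    by (auto simp: bar_closed_def)
  have chain: "z - int n * s \<in> M \<and> 2 * (z - int n * s) \<noteq> s" if z: "z \<in> M" "2 * z \<noteq> s" for z n
  proof (induction n)
    case (Suc n)
    then have "z - int n * s - s \<in> M"
      using s1 by blast
    moreover have "2 * (z - int n * s - s) \<noteq> s"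
      using Suc s3[of "z - int n * s"] by (auto simp: algebra_simps)
    ultimately show ?case
      by (simp add: algebra_simps)
  qed (use z in auto)
  show "\<forall>n\<ge>1. bar_closed (int n * s) M"
    unfolding bar_closed_def
  proof (intro allI impI ballI)
    fix n :: nat and z assume n: "1 \<le> n" and z: "z \<in> M" "2 * z \<noteq> int n * s"
    show "z - int n * s \<in> M"
    proof (cases "2 * z = s")
      case True
      then have "n \<noteq> 1"
        using z by auto
      then have "2 \<le> n"
        using n by simp
      \<comment> \<open>Descending from \<open>s / 2\<close> may fail at once. If
        \<open>z - n s\<close> is a gap, its mirror image \<open>n s - s / 2\<close> is a bead, and
        \<open>n - 2\<close> steps down from there lead to \<open>3 s / 2\<close>.\<close>
      then obtain k where k: "n = k + 2"
        by (metis add.commute le_Suc_ex)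
      show ?thesis
      proof (rule ccontr)
        assume notin: "z - int n * s \<notin> M"
        have "2 * s \<le> int n * s"
          using \<open>2 \<le> n\<close> s by (intro mult_right_mono) auto
        then have nz: "z - int n * s \<noteq> 0"
          using True s by linarith
        then have "int n * s - z \<in> M"
          using symmetric_beads_uminus[OF M nz] notin by (simp add: algebra_simps)
        moreover have "2 * (int n * s - z) \<noteq> s"
          using True s \<open>2 * s \<le> int n * s\<close> by auto
        ultimately have "int n * s - z - int k * s \<in> M"
          using chain by blast
        moreover have "2 * (int n * s - z - int k * s) = 3 * s"
          using True k by (simp add: algebra_simps)
        ultimately show False
          using s3 by blast
      qed
    qed (use chain z in auto)
  qed
qed

section \<open>Shifted hook lengths\<close>

lemma part_beta_numbers: "strict_partition p \<Longrightarrow> beta_numbers (part p) (length p)"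
  by unfold_locales (auto simp: strict_partition_def intro: part_strict)

lemma part_pos: "strict_partition p \<Longrightarrow> 1 \<le> i \<Longrightarrow> i \<le> length p \<Longrightarrow> 0 < part p i"
  using part_in_set by (auto simp: strict_partition_def)

lemma shifted_diagram_iff:
  assumes "strict_partition p"
  shows "(i, j) \<in> shifted_diagram p \<longleftrightarrow> 1 \<le> i \<and> i \<le> length p \<and> i \<le> j \<and> j < i + part p i"
  using part_pos[OF assms, of i] by (auto simp: shifted_diagram_def)

text \<open>For \<open>j < length p\<close> the column below the box consists of the rows
  \<open>i + 1\<close> to \<open>j\<close>; its \<open>j - i\<close> boxes make up for the columns
  missing from the arm, and row \<open>j + 1\<close> adds its whole length. For larger
  \<open>j\<close> that row does not exist.\<close>

lemma shifted_hook_length_eq: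
  assumes p: "strict_partition p" and box: "(i, j) \<in> shifted_diagram p"
  shows "shifted_hook_length p (i, j) =
    (if j < length p then part p i + part p (Suc j)
     else i + part p i - j + beta_numbers.depth (part p) (length p) i j)"
proof -
  interpret beta_numbers "part p" "length p"
    using p by (rule part_beta_numbers)
  define A where "A = Pair i ` {j..<i + part p i}"
  define B where "B = (\<lambda>a. (a, j)) ` {a. i < a \<and> a \<le> length p \<and> a \<le> j \<and> j < a + part p a}"
  define C where "C = {(a, b). a = Suc j \<and> (a, b) \<in> shifted_diagram p}"
  note bx = box[unfolded shifted_diagram_iff[OF p]]
  have "{(a, b) \<in> shifted_diagram p. (a = i \<and> j \<le> b) \<or> (b = j \<and> i < a) \<or> a = j + 1} =
      A \<union> B \<union> C"
    using bx by (auto simp: A_def B_def C_def shifted_diagram_iff[OF p])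
  then have "shifted_hook_length p (i, j) = card (A \<union> B \<union> C)"
    by (simp add: shifted_hook_length_def)
  also have "\<dots> = card A + card B + card C"
  proof -
    have "C \<subseteq> {Suc j} \<times> {..<Suc j + part p (Suc j)}"
      by (auto simp: C_def shifted_diagram_iff[OF p])
    then have "finite C"
      by (rule finite_subset) simp
    moreover have "A \<inter> B = {}" "(A \<union> B) \<inter> C = {}"
      using bx by (auto simp: A_def B_def C_def)
    ultimately show ?thesis
      by (simp add: card_Un_disjoint A_def B_def)
  qed
  also have "card A = i + part p i - j"
    by (simp add: A_def card_image inj_on_def)
  also have "card B = card {a. i < a \<and> a \<le> length p \<and> a \<le> j \<and> j < a + part p a}"
    by (simp add: B_def card_image inj_on_def)
  finally have h: "shifted_hook_length p (i, j) = i + part p i - j +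
      card {a. i < a \<and> a \<le> length p \<and> a \<le> j \<and> j < a + part p a} + card C" .
  show ?thesis
  proof (cases "j < length p")
    case True
    \<comment> \<open>Row ends decrease weakly, and already the nonempty row \<open>j + 1\<close>
      ends beyond column \<open>j\<close>.\<close>
    have "j < a + part p a" if "i < a" "a \<le> j" for a
      using decr_shift[of a "Suc j"] that True bx by auto
    then have "{a. i < a \<and> a \<le> length p \<and> a \<le> j \<and> j < a + part p a} = {i<..j}"
      using True by auto
    moreover have "C = Pair (Suc j) ` {Suc j..<Suc j + part p (Suc j)}"
      using True by (auto simp: C_def shifted_diagram_iff[OF p])
    then have "card C = part p (Suc j)"
      by (simp add: card_image inj_on_def)
    ultimately show ?thesis
      using h bx True by simp
  next
    case False
    then have "C = {}"
      by (auto simp: C_def shifted_diagram_iff[OF p])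
    moreover have "{a. i < a \<and> a \<le> length p \<and> a \<le> j \<and> j < a + part p a} =
        {a. i < a \<and> a \<le> length p \<and> j < a + part p a}"
      using False by auto
    ultimately show ?thesis
      using h False by (simp add: depth_def)
  qed
qed

text \<open>Columns before \<open>length p\<close> yield the sums of parts, the others the
  complement of the differences. This reduces CSYDs to bar-cores for all multiples of
  \<open>s\<close>.\<close>

lemma shifted_row_hooks:
  assumes p: "strict_partition p" and i: "1 \<le> i" "i \<le> length p"
  shows "(\<lambda>j. shifted_hook_length p (i, j)) ` {i..<i + part p i} = bar_lengths p i"
proof -
  interpret beta_numbers "part p" "length p"
    using p by (rule part_beta_numbers)
  have "length p + part p (length p) \<le> i + part p i"
    using i by (intro decr_shift) auto
  then have "length p < i + part p i"
    using part_pos[OF p, of "length p"] i by linarith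
  then have "{i..<i + part p i} = {i..<length p} \<union> {length p..<i + part p i}"
    using i by auto
  moreover have "(\<lambda>j. shifted_hook_length p (i, j)) ` {i..<length p} =
      {part p i + part p j | j. i < j \<and> j \<le> length p}"
  proof -
    have "(\<lambda>j. shifted_hook_length p (i, j)) ` {i..<length p} =
        (\<lambda>j. part p i + part p (Suc j)) ` {i..<length p}"
      using i \<open>length p < i + part p i\<close>
      by (intro image_cong refl)
        (simp add: shifted_hook_length_eq[OF p] shifted_diagram_iff[OF p])
    also have "\<dots> = (\<lambda>j. part p i + part p j) ` Suc ` {i..<length p}"
      by (simp only: image_image)
    also have "Suc ` {i..<length p} = {j. i < j \<and> j \<le> length p}"
      by (auto simp: image_Suc_atLeastLessThan)
    finally show ?thesis
      by blast
  qed
  moreover have "(\<lambda>j. shifted_hook_length p (i, j)) ` {length p..<i + part p i} =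
      {1..part p i} - {part p i - part p j | j. i < j \<and> j \<le> length p}"
  proof -
    have "(\<lambda>j. shifted_hook_length p (i, j)) ` {length p..<i + part p i} =
        (\<lambda>j. i + part p i - j + depth i j) ` {length p..<i + part p i}"
      using i by (intro image_cong refl)
        (simp add: shifted_hook_length_eq[OF p] shifted_diagram_iff[OF p])
    also have "\<dots> = {part p i - y | y. y < part p i \<and>
        (\<forall>a. i < a \<and> a \<le> length p \<longrightarrow> part p a \<noteq> y)}"
      using i by (rule row_hooks)
    also have "\<dots> = {1..part p i} - {part p i - part p j | j. i < j \<and> j \<le> length p}"
    proof (intro equalityI subsetI)
      fix h assume "h \<in> {1..part p i} - {part p i - part p j | j. i < j \<and> j \<le> length p}"
      then have h: "1 \<le> h" "h \<le> part p i" "\<And>j. i < j \<Longrightarrow> j \<le> length p \<Longrightarrow> h \<noteq> part p i - part p j"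
        by auto
      have "h = part p i - (part p i - h)" "part p i - h < part p i"
        using h by auto
      moreover have "part p a \<noteq> part p i - h" if "i < a" "a \<le> length p" for a
        using h that by fastforce
      ultimately show "h \<in> {part p i - y | y. y < part p i \<and>
          (\<forall>a. i < a \<and> a \<le> length p \<longrightarrow> part p a \<noteq> y)}"
        by blast
    next
      fix h assume "h \<in> {part p i - y | y. y < part p i \<and>
          (\<forall>a. i < a \<and> a \<le> length p \<longrightarrow> part p a \<noteq> y)}"
      then obtain y where y: "h = part p i - y" "y < part p i"
        "\<And>a. i < a \<Longrightarrow> a \<le> length p \<Longrightarrow> part p a \<noteq> y"
        by blast
      have "h \<noteq> part p i - part p j" if "i < j" "j \<le> length p" for j
        using y(3)[OF that] decr[of i j] that i y(1,2) by simp
      then show "h \<in> {1..part p i} - {part p i - part p j | j. i < j \<and> j \<le> length p}"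
        using y by auto
    qed
    finally show ?thesis .
  qed
  ultimately show ?thesis
    by (simp add: image_Un bar_lengths_def)
qed

lemma csyd_iff_bar_cores:
  assumes p: "strict_partition p" and s: "0 < s"
  shows "csyd s p \<longleftrightarrow> (\<forall>n\<ge>1. bar_core (n * s) p)"
proof -
  have "csyd s p \<longleftrightarrow> (\<forall>i\<in>{1..length p}. \<forall>j\<in>{i..<i + part p i}. \<not> s dvd shifted_hook_length p (i, j))"
    by (auto simp: csyd_def shifted_diagram_iff[OF p])
  also have "\<dots> \<longleftrightarrow> (\<forall>i\<in>{1..length p}. \<forall>h\<in>bar_lengths p i. \<not> s dvd h)"
    using shifted_row_hooks[OF p, symmetric] by simp
  also have "\<dots> \<longleftrightarrow> (\<forall>i\<in>{1..length p}. \<forall>n\<ge>1. n * s \<notin> bar_lengths p i)"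
  proof -
    have "0 \<notin> bar_lengths p i" if "i \<in> {1..length p}" for i
      using part_pos[OF p, of i] that by (auto simp: bar_lengths_def)
    then have "(\<forall>h\<in>bar_lengths p i. \<not> s dvd h) \<longleftrightarrow> (\<forall>n\<ge>1. n * s \<notin> bar_lengths p i)"
      if "i \<in> {1..length p}" for i
      using that by (metis One_nat_def Suc_leI dvd_def dvd_triv_right gr0I mult.commute mult_0)
    then show ?thesis
      by blast
  qed
  also have "\<dots> \<longleftrightarrow> (\<forall>n\<ge>1. bar_core (n * s) p)"
    by (auto simp: bar_core_def)
  finally show ?thesis .
qed

lemma csyd_iff_bar_closed:
  assumes p: "strict_partition p" and s: "0 < s"
  shows "csyd s p \<longleftrightarrow> bar_closed (int s) (bead_set p) \<and> (\<forall>z\<in>bead_set p. 2 * z \<noteq> 3 * int s)"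
proof -
  have "csyd s p \<longleftrightarrow> (\<forall>n\<ge>1. bar_closed (int n * int s) (bead_set p))"
    using s by (simp add: csyd_iff_bar_cores[OF assms] bar_core_iff_bar_closed[OF p])
  also have "\<dots> \<longleftrightarrow> bar_closed (int s) (bead_set p) \<and> (\<forall>z\<in>bead_set p. 2 * z \<noteq> 3 * int s)"
    using bar_closed_multiples_iff[OF symmetric_bead_set, of "int s" p] s by simp
  finally show ?thesis .
qed

section \<open>Doubled distinct partitions\<close>

definition beta :: "nat list \<Rightarrow> nat \<Rightarrow> nat" where
  "beta q a = part q a + length q - a"

text \<open>With infinitely many zero parts appended this is the set of all
  \<open>part q a - a\<close> with \<open>a \<ge> 1\<close>. Unlike the beta numbers it does not
  depend on the number of rows used.\<close>

definition maya :: "nat list \<Rightarrow> int set" where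
  "maya q = {z. z + int (length q) < 0 \<or> (\<exists>a\<in>{1..length q}. z + int (length q) = int (beta q a))}"

lemma young_diagram_iff:
  "(i, j) \<in> young_diagram q \<longleftrightarrow> 1 \<le> i \<and> i \<le> length q \<and> 1 \<le> j \<and> j \<le> part q i"
  by (auto simp: young_diagram_def)

lemma part_antimono:
  assumes "is_partition q" "1 \<le> a" "a \<le> a'" "a' \<le> length q"
  shows "part q a' \<le> part q a"
  using assms sorted_wrt_nth_less[of "(\<ge>)" q "a - 1" "a' - 1"]
  by (cases "a = a'") (auto simp: part_def is_partition_def)

lemma is_partition_part_pos: "is_partition q \<Longrightarrow> 1 \<le> a \<Longrightarrow> a \<le> length q \<Longrightarrow> 0 < part q a"
  using part_in_set by (auto simp: is_partition_def)

lemma beta_beta_numbers: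
  assumes "is_partition q"
  shows "beta_numbers (beta q) (length q)"
proof
  fix a a' assume "1 \<le> a" "a < a'" "a' \<le> length q"
  then show "beta q a' < beta q a"
    using part_antimono[OF assms, of a a'] by (auto simp: beta_def)
qed

lemma beta_pos: "is_partition q \<Longrightarrow> 1 \<le> a \<Longrightarrow> a \<le> length q \<Longrightarrow> 0 < beta q a"
  using is_partition_part_pos[of q a] by (simp add: beta_def)

lemma arm_eq: "1 \<le> i \<Longrightarrow> i \<le> length q \<Longrightarrow> 1 \<le> j \<Longrightarrow> arm q (i, j) = part q i - j"
proof -
  assume "1 \<le> i" "i \<le> length q" "1 \<le> j"
  then have "{b. j < b \<and> (i, b) \<in> young_diagram q} = {j<..part q i}"
    by (auto simp: young_diagram_iff)
  then show ?thesis
    by (simp add: arm_def)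
qed

text \<open>The column offset comes from \<open>a + beta q a = part q a + length q\<close>.\<close>

lemma leg_eq:
  assumes "is_partition q" "1 \<le> j"
  shows "leg q (i, j) = beta_numbers.depth (beta q) (length q) i (j + length q - 1)"
proof -
  interpret beta_numbers "beta q" "length q"
    using assms(1) by (rule beta_beta_numbers)
  have "{a. i < a \<and> (a, j) \<in> young_diagram q} =
      {a. i < a \<and> a \<le> length q \<and> j + length q - 1 < a + beta q a}"
    using assms(2) by (auto simp: young_diagram_iff beta_def)
  then show ?thesis
    by (simp add: leg_def depth_def)
qed

lemma row_hook_lengths:
  assumes q: "is_partition q" and i: "1 \<le> i" "i \<le> length q"
  shows "(\<lambda>j. hook_length q (i, j)) ` {1..part q i} =
    {beta q i - y | y. y < beta q i \<and> (\<forall>a. i < a \<and> a \<le> length q \<longrightarrow> beta q a \<noteq> y)}"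
proof -
  interpret beta_numbers "beta q" "length q"
    using q by (rule beta_beta_numbers)
  have ib: "i + beta q i = part q i + length q"
    using i by (simp add: beta_def)
  have "(\<lambda>j. hook_length q (i, j)) ` {1..part q i} =
      (\<lambda>j. i + beta q i - j + depth i j) ` (\<lambda>j. j + length q - 1) ` {1..part q i}"
    unfolding image_image using i
    by (intro image_cong refl) (auto simp: hook_length_def arm_eq leg_eq[OF q] ib)
  also have "(\<lambda>j. j + length q - 1) ` {1..part q i} = {length q..<i + beta q i}"
  proof (intro equalityI subsetI)
    fix k assume "k \<in> {length q..<i + beta q i}"
    then show "k \<in> (\<lambda>j. j + length q - 1) ` {1..part q i}"
      by (intro image_eqI[of _ _ "Suc k - length q"]) (auto simp: ib)
  qed (auto simp: ib)
  finally show ?thesis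
    using row_hooks[OF i] by simp
qed

text \<open>A hook of length \<open>h\<close> is a bead together with a gap \<open>h\<close> places
  below it. Closure under subtracting \<open>s\<close> iterates, so it also excludes hooks whose
  length is a proper multiple of \<open>s\<close>.\<close>

lemma core_iff_shift_closed:
  assumes q: "is_partition q" and s: "0 < s"
  shows "core s q \<longleftrightarrow> shift_closed (int s) (maya q)"
proof -
  interpret beta_numbers "beta q" "length q"
    using q by (rule beta_beta_numbers)
  have hooks: "core s q \<longleftrightarrow> (\<forall>i\<in>{1..length q}. \<forall>h\<in>(\<lambda>j. hook_length q (i, j)) ` {1..part q i}. \<not> s dvd h)"
    by (auto simp: core_def young_diagram_iff)
  show ?thesis
  proof
    assume core: "core s q"
    show "shift_closed (int s) (maya q)"
      unfolding shift_closed_def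
    proof
      fix z assume "z \<in> maya q"
      then consider "z + int (length q) < 0"
        | i where "i \<in> {1..length q}" "z + int (length q) = int (beta q i)"
        by (auto simp: maya_def)
      then show "z - int s \<in> maya q"
      proof cases
        case 1
        then show ?thesis
          by (simp add: maya_def)
      next
        case 2
        show ?thesis
        proof (rule ccontr)
          assume notin: "z - int s \<notin> maya q"
          then have "\<not> z - int s + int (length q) < 0"
            by (simp add: maya_def)
          then have le: "s \<le> beta q i"
            using 2(2) by linarith
          have "beta q a \<noteq> beta q i - s" if "i < a" "a \<le> length q" for a
          proof
            assume "beta q a = beta q i - s"
            then have "z - int s + int (length q) = int (beta q a)"
              using 2(2) le by linarith
            then show False
              using notin that by (auto simp: maya_def)
          qed
          moreover have "s = beta q i - (beta q i - s)" "beta q i - s < beta q i"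
            using le s by auto
          ultimately have "s \<in> (\<lambda>j. hook_length q (i, j)) ` {1..part q i}"
            using row_hook_lengths[OF q, of i] 2(1) by auto
          then show False
            using core 2(1) dvd_refl[of s] unfolding hooks by blast
        qed
      qed
    qed
  next
    assume closed: "shift_closed (int s) (maya q)"
    have chain: "z - int n * int s \<in> maya q" if "z \<in> maya q" for z n
    proof (induction n)
      case (Suc n)
      then have "z - int n * int s - int s \<in> maya q"
        using closed by (simp add: shift_closed_def)
      then show ?case
        by (simp add: algebra_simps)
    qed (use that in auto)
    show "core s q"
      unfolding hooks
    proof (intro ballI notI)
      fix i h assume i: "i \<in> {1..length q}"
        and "h \<in> (\<lambda>j. hook_length q (i, j)) ` {1..part q i}" and "s dvd h"
      then obtain y where y: "h = beta q i - y" "y < beta q i"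
        "\<And>a. i < a \<Longrightarrow> a \<le> length q \<Longrightarrow> beta q a \<noteq> y"
        using row_hook_lengths[OF q, of i] by auto
      obtain n where n: "h = n * s"
        using \<open>s dvd h\<close> by (metis dvd_def mult.commute)
      have "int (beta q i) - int (length q) \<in> maya q"
        using i by (auto simp: maya_def)
      from chain[OF this, of n] have "int (beta q i) - int (length q) - int h \<in> maya q"
        by (simp add: n)
      moreover have "int (beta q i) - int (length q) - int h = int y - int (length q)"
        using y by simp
      ultimately obtain a where a: "1 \<le> a" "a \<le> length q" "beta q a = y"
        by (auto simp: maya_def)
      then have "\<not> a < i" "a \<noteq> i"
        using decr[of a i] i y(2) by auto
      then show False
        using y(3)[of a] a by simp
    qed
  qed
qed

text \<open>The smallest gap reveals the number of parts, which is what injectivity of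
  \<open>maya\<close> needs first.\<close>

lemma maya_length:
  assumes "is_partition q"
  shows "- int (length q) \<notin> maya q" "z < - int (length q) \<Longrightarrow> z \<in> maya q"
  using beta_pos[OF assms] by (fastforce simp: maya_def)+

lemma sorted_map_beta:
  assumes "is_partition q"
  shows "sorted_wrt (>) (map (beta q) [1..<length q + 1])"
proof -
  interpret beta_numbers "beta q" "length q"
    using assms by (rule beta_beta_numbers)
  show ?thesis
    unfolding sorted_wrt_map
    by (rule sorted_wrt_mono_rel[OF _ sorted_wrt_upt]) (auto intro: decr)
qed

lemma inj_on_maya: "inj_on maya {q. is_partition q}"
proof (rule inj_onI)
  fix q q' assume q: "q \<in> {q. is_partition q}" and q': "q' \<in> {q. is_partition q}"
    and eq: "maya q = maya q'"
  have "\<not> length q < length q'" "\<not> length q' < length q"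
    using maya_length[of q] maya_length[of q'] q q' eq by auto
  then have len: "length q = length q'"
    by simp
  have "y \<in> beta q ` {1..length q} \<longleftrightarrow> int y - int (length q) \<in> maya q" for y
    by (auto simp: maya_def)
  moreover have "y \<in> beta q' ` {1..length q} \<longleftrightarrow> int y - int (length q) \<in> maya q" for y
    unfolding eq len by (auto simp: maya_def)
  ultimately have "beta q ` {1..length q} = beta q' ` {1..length q}"
    by blast
  then have "map (beta q) [1..<length q + 1] = map (beta q') [1..<length q + 1]"
    using sorted_map_beta[of q] sorted_map_beta[of q'] q q' len
    by (intro strict_partition_eqI) (simp_all add: atLeastLessThanSuc_atLeastAtMost del: upt_Suc)
  then have "beta q a = beta q' a" if "1 \<le> a" "a \<le> length q" for a
    using that by auto
  then have "part q a = part q' a" if "1 \<le> a" "a \<le> length q" for a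
    using that len by (fastforce simp: beta_def)
  then have "q ! i = q' ! i" if "i < length q" for i
    using that by (metis Suc_leI diff_Suc_1 le_add1 part_def plus_1_eq_Suc)
  then show "q = q'"
    using len by (intro nth_equalityI)
qed

section \<open>Frobenius coordinates as beads and gaps\<close>

lemma diagonal_eq:
  assumes "is_partition q"
  obtains r where "{i. (i, i) \<in> young_diagram q} = {0<..r}" "r \<le> length q"
proof -
  define r where "r = card {a. 0 < a \<and> a \<le> length q \<and> a \<le> part q a}"
  have "{i. (i, i) \<in> young_diagram q} = {a. 0 < a \<and> a \<le> length q \<and> a \<le> part q a}"
    by (auto simp: young_diagram_iff)
  also have "\<dots> = {0<..0 + r}"
    unfolding r_def
  proof (rule initial_segment)
    fix a a' assume "0 < a" "a \<le> a'" "a' \<le> length q" "a' \<le> part q a'"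
    then show "a \<le> part q a"
      using part_antimono[OF assms, of a a'] by simp
  qed
  finally have D: "{i. (i, i) \<in> young_diagram q} = {0<..r}"
    by simp
  moreover have "r \<le> length q"
  proof (cases "r = 0")
    case False
    then have "r \<in> {i. (i, i) \<in> young_diagram q}"
      unfolding D by simp
    then show ?thesis
      by (simp add: young_diagram_iff)
  qed simp
  ultimately show ?thesis
    by (rule that)
qed

text \<open>The arm of the diagonal box in row \<open>i\<close> is \<open>part q i - i\<close>,
  already a Maya coordinate, and this is nonnegative exactly on the diagonal. The gap belonging to
  column \<open>j\<close> is \<open>j - 1\<close> minus the column length, that is, minus the leg
  minus 1.\<close>

lemma frobenius_symbol_properties:
  assumes q: "is_partition q"
  obtains arms legs where
    "frobenius_symbol q = (arms, legs)" "sorted_wrt (>) arms" "sorted_wrt (>) legs"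
    "\<And>x. x \<in> set arms \<longleftrightarrow> int x \<in> maya q" "\<And>x. x \<in> set legs \<longleftrightarrow> - int x - 1 \<notin> maya q"
proof -
  interpret beta_numbers "beta q" "length q"
    using q by (rule beta_beta_numbers)
  obtain r where diag: "{i. (i, i) \<in> young_diagram q} = {0<..r}" and r: "r \<le> length q"
    using diagonal_eq[OF q] .
  have diag_iff: "1 \<le> i \<and> i \<le> r \<longleftrightarrow> 1 \<le> i \<and> i \<le> length q \<and> i \<le> part q i" for i
    using diag by (auto simp: set_eq_iff young_diagram_iff Suc_le_eq)
  \<comment> \<open>Length of column \<open>j\<close>, the \<open>j\<close>-th part of the conjugate
    partition.\<close>
  define D where "D j = depth 0 (j + length q - 1)" for j
  have D_iff: "a \<le> D j \<longleftrightarrow> j \<le> part q a" if "1 \<le> j" "1 \<le> a" "a \<le> length q" for a j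
    using depth_iff[of 0 a "j + length q - 1"] that by (auto simp: D_def beta_def)
  have D_le: "D j \<le> length q" for j
    using depth_le[of 0] by (simp add: D_def)
  have D_ge: "i \<le> D i" if "1 \<le> i" "i \<le> r" for i
    using D_iff[of i i] diag_iff that by blast
  have D_mono: "D k \<le> D j" if "1 \<le> j" "j \<le> k" for j k
    unfolding D_def depth_def using that by (intro card_mono) auto
  define arms where "arms = map (\<lambda>i. arm q (i, i)) [1..<r + 1]"
  define legs where "legs = map (\<lambda>i. leg q (i, i)) [1..<r + 1]"
  have arm_i: "arm q (i, i) = part q i - i" if "1 \<le> i" "i \<le> r" for i
    using that r by (simp add: arm_eq)
  have leg_i: "leg q (i, i) = D i - i" if i: "1 \<le> i" "i \<le> r" for i
  proof -
    have "i < a \<and> a \<le> length q \<and> i + length q - 1 < a + beta q a \<longleftrightarrow> i < a \<and> a \<le> D i" for a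
      using D_iff[of i a] i D_le[of i] by (cases "a \<le> length q") (auto simp: beta_def)
    then have "{a. i < a \<and> a \<le> length q \<and> i + length q - 1 < a + beta q a} = {i<..D i}"
      by (intro set_eqI) simp
    then show ?thesis
      unfolding leg_eq[OF q i(1)] depth_def by simp
  qed
  have "frobenius_symbol q = (arms, legs)"
    by (simp add: frobenius_symbol_def diag Let_def arms_def legs_def)
  moreover have "sorted_wrt (>) arms"
    unfolding arms_def sorted_wrt_map
  proof (rule sorted_wrt_mono_rel[OF _ sorted_wrt_upt])
    fix i k assume "i \<in> set [1..<r + 1]" "k \<in> set [1..<r + 1]" "i < k"
    then show "arm q (k, k) < arm q (i, i)"
      using part_antimono[OF q, of i k] diag_iff[of k] r
      by (simp add: arm_i del: upt_Suc)
  qed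
  moreover have "sorted_wrt (>) legs"
    unfolding legs_def sorted_wrt_map
  proof (rule sorted_wrt_mono_rel[OF _ sorted_wrt_upt])
    fix i k assume "i \<in> set [1..<r + 1]" "k \<in> set [1..<r + 1]" "i < k"
    then show "leg q (k, k) < leg q (i, i)"
      using D_mono[of i k] D_ge[of k] by (simp add: leg_i del: upt_Suc)
  qed
  moreover have "x \<in> set arms \<longleftrightarrow> int x \<in> maya q" for x
  proof -
    have "x \<in> set arms \<longleftrightarrow> (\<exists>i. 1 \<le> i \<and> i \<le> r \<and> x = arm q (i, i))"
      by (auto simp: arms_def simp del: upt_Suc)
    also have "\<dots> \<longleftrightarrow> (\<exists>i. 1 \<le> i \<and> i \<le> r \<and> x = part q i - i)"
      using arm_i by metis
    also have "\<dots> \<longleftrightarrow> (\<exists>i. 1 \<le> i \<and> i \<le> length q \<and> x + length q = beta q i)"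
    proof -
      have "(1 \<le> i \<and> i \<le> r \<and> x = part q i - i) \<longleftrightarrow>
          (1 \<le> i \<and> i \<le> length q \<and> x + length q = beta q i)" for i
        using diag_iff[of i] by (auto simp: beta_def)
      then show ?thesis
        by simp
    qed
    also have "\<dots> \<longleftrightarrow> int x \<in> maya q"
      by (auto simp: maya_def simp flip: of_nat_add)
    finally show ?thesis .
  qed
  moreover have "x \<in> set legs \<longleftrightarrow> - int x - 1 \<notin> maya q" for x
  proof
    assume "x \<in> set legs"
    then obtain j where j: "1 \<le> j" "j \<le> r" "x = D j - j"
      by (auto simp: legs_def leg_i simp del: upt_Suc)
    have "beta q a \<noteq> j + length q - 1 - D j" if "1 \<le> a" "a \<le> length q" for a
      using column_gap[of 0 "j + length q - 1" a] that j(1) by (simp add: D_def)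
    then have "- int x - 1 + int (length q) \<noteq> int (beta q a)" if "1 \<le> a" "a \<le> length q" for a
      using that j D_ge[of j] D_le[of j] by fastforce
    moreover have "0 \<le> - int x - 1 + int (length q)"
      using j D_ge[of j] D_le[of j] by linarith
    ultimately show "- int x - 1 \<notin> maya q"
      by (auto simp: maya_def)
  next
    assume notin: "- int x - 1 \<notin> maya q"
    then have x: "x + 1 \<le> length q"
      by (auto simp: maya_def)
    define y where "y = length q - 1 - x"
    have "int y = - int x - 1 + int (length q)"
      using x by (simp add: y_def)
    moreover have "- int x - 1 + int (length q) \<noteq> int (beta q a)" if "a \<in> {1..length q}" for a
      using notin that unfolding maya_def by blast
    ultimately have gap: "beta q a \<noteq> y" if "0 < a" "a \<le> length q" for a
      using that by (metis One_nat_def Suc_leI atLeastAtMost_iff)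
    obtain k where k: "length q \<le> k" "y = k - 0 - depth 0 k"
      using gap_column[of 0 y] gap by blast
    define j where "j = k + 1 - length q"
    have j: "1 \<le> j" "k = j + length q - 1"
      using k(1) by (auto simp: j_def)
    have Dj: "D j = depth 0 k"
      by (simp add: D_def j)
    \<comment> \<open>The column is at least as long as its index, so it meets the diagonal, and
      \<open>x\<close> is its leg there.\<close>
    have "D j = j + x"
      using k j x D_le[of j] unfolding Dj[symmetric] y_def by linarith
    then have "j \<le> r"
      using D_iff[of j j] D_le[of j] j(1) diag_iff[of j] by auto
    then show "x \<in> set legs"
      using \<open>D j = j + x\<close> j(1) leg_i[of j] by (force simp: legs_def image_iff simp del: upt_Suc)
  qed
  ultimately show ?thesis
    by (rule that)
qed

text \<open>A leg \<open>x - 1\<close> is a gap at \<open>- x\<close>, an arm \<open>x\<close> is a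
  bead at \<open>x\<close>. So legs equal to arms minus one mean that exactly one of
  \<open>x\<close> and \<open>- x\<close> is a bead, and positive arms mean that 0 is a gap.\<close>

lemma doubled_distinct_iff_symmetric:
  assumes q: "is_partition q"
  shows "(\<exists>p. doubled_distinct p q) \<longleftrightarrow> symmetric_beads (maya q)"
proof -
  obtain arms legs where f: "frobenius_symbol q = (arms, legs)"
    and sorted: "sorted_wrt (>) arms" "sorted_wrt (>) legs"
    and arms: "\<And>x. x \<in> set arms \<longleftrightarrow> int x \<in> maya q"
    and legs: "\<And>x. x \<in> set legs \<longleftrightarrow> - int x - 1 \<notin> maya q"
    using frobenius_symbol_properties[OF q] by metis
  show ?thesis
  proof
    assume "\<exists>p. doubled_distinct p q"
    then have strict: "strict_partition arms" and l: "legs = map (\<lambda>x. x - 1) arms"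
      by (auto simp: doubled_distinct_def f)
    have pos: "\<And>x. x \<in> set arms \<Longrightarrow> 0 < x"
      using strict by (auto simp: strict_partition_def)
    have sym: "- int x \<in> maya q \<longleftrightarrow> int x \<notin> maya q" if "0 < x" for x
    proof -
      have "- int x \<in> maya q \<longleftrightarrow> x - 1 \<notin> set legs"
        using that legs[of "x - 1"] by (simp add: of_nat_diff)
      also have "\<dots> \<longleftrightarrow> x \<notin> set arms"
      proof -
        \<comment> \<open>Truncated subtraction of 1 is injective here because arms are
          positive.\<close>
        have "x' = x" if "x' \<in> set arms" "x - 1 = x' - 1" for x'
          using pos[OF that(1)] that(2) \<open>0 < x\<close> by simp
        moreover have "set legs = (\<lambda>x. x - 1) ` set arms"
          by (simp add: l)
        ultimately show ?thesis
          by blast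
      qed
      finally show ?thesis
        using arms by simp
    qed
    have "- z \<in> maya q \<longleftrightarrow> z \<notin> maya q" if "z \<noteq> 0" for z
      using sym[of "nat z"] sym[of "nat (- z)"] that by (cases "0 < z") auto
    moreover have "{z \<in> maya q. 0 < z} \<subseteq> int ` set arms"
    proof
      fix z assume "z \<in> {z \<in> maya q. 0 < z}"
      then show "z \<in> int ` set arms"
        using arms[of "nat z"] by (intro image_eqI[of _ _ "nat z"]) auto
    qed
    then have "finite {z \<in> maya q. 0 < z}"
      by (rule finite_subset) simp
    moreover have "0 \<notin> maya q"
      using arms[of 0] pos[of 0] by auto
    ultimately show "symmetric_beads (maya q)"
      by (simp add: symmetric_beads_def)
  next
    assume sym: "symmetric_beads (maya q)"
    have pos: "0 < x" if "x \<in> set arms" for x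
      using that arms[of x] sym by (cases x) (auto simp: symmetric_beads_def)
    have strict: "strict_partition arms"
      using sorted pos by (simp add: strict_partition_def)
    have "legs = map (\<lambda>x. x - 1) arms"
    proof (rule strict_partition_eqI)
      show "sorted_wrt (>) (map (\<lambda>x. x - 1) arms)"
        unfolding sorted_wrt_map
        by (rule sorted_wrt_mono_rel[OF _ sorted(1)]) (use pos in fastforce)
      have "x \<in> set legs \<longleftrightarrow> Suc x \<in> set arms" for x
      proof -
        have "- int x - 1 = - int (Suc x)"
          by simp
        then show ?thesis
          unfolding arms legs by (metis symmetric_beads_uminus[OF sym] nat.distinct(1) of_nat_eq_0_iff)
      qed
      moreover have "x \<in> (\<lambda>x. x - 1) ` set arms \<longleftrightarrow> Suc x \<in> set arms" for x
      proof
        assume "x \<in> (\<lambda>x. x - 1) ` set arms"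
        then obtain y where "x = y - 1" "y \<in> set arms"
          by (rule imageE)
        then show "Suc x \<in> set arms"
          using pos[of y] by simp
      next
        assume "Suc x \<in> set arms"
        then show "x \<in> (\<lambda>x. x - 1) ` set arms"
          by (rule image_eqI[rotated]) simp
      qed
      ultimately show "set legs = set (map (\<lambda>x. x - 1) arms)"
        by (intro set_eqI) simp
    qed (rule sorted)
    then have "doubled_distinct arms q"
      using strict q f by (simp add: doubled_distinct_def)
    then show "\<exists>p. doubled_distinct p q" ..
  qed
qed

text \<open>Symmetry makes the charge zero: the window from \<open>- N\<close> to \<open>N\<close>
  holds one bead of each pair \<open>x\<close>, \<open>- x\<close>, thus \<open>N\<close> beads.
  Shifted by \<open>N\<close> they are the beta numbers of a partition with exactly \<open>N\<close>
  parts.\<close>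

lemma symmetric_beads_maya:
  assumes M: "symmetric_beads M"
  obtains q where "is_partition q" "maya q = M"
proof -
  define X where "X = {x. 0 < x \<and> int x \<in> M}"
  have "int ` X \<subseteq> {z \<in> M. 0 < z}"
    by (auto simp: X_def)
  then have finX: "finite X"
    using M finite_subset finite_imageD[of int X] by (auto simp: symmetric_beads_def)
  \<comment> \<open>The largest positive bead, or 0 if there is none. Everything below
    \<open>- N\<close> is a bead, while \<open>- N\<close> itself is a gap; the latter keeps all
    beta numbers, and so all parts, positive.\<close>
  obtain N where N: "\<And>x. x \<in> X \<Longrightarrow> x \<le> N" "N \<noteq> 0 \<Longrightarrow> N \<in> X"
    using Max_in[OF finX] Max_ge[OF finX] by (cases "X = {}") (auto intro: that[of 0])
  define B where "B = {y. int y - int N \<in> M}"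
  have neg: "- int x \<in> M \<longleftrightarrow> x \<notin> X" if "0 < x" for x
    using symmetric_beads_uminus[OF M, of "int x"] that by (simp add: X_def)
  have B: "B = (\<lambda>x. N + x) ` X \<union> (\<lambda>x. N - x) ` ({1..N} - X)"
  proof (intro equalityI subsetI)
    fix y assume y: "y \<in> B"
    then have "y \<noteq> N"
      using M by (auto simp: B_def symmetric_beads_def)
    show "y \<in> (\<lambda>x. N + x) ` X \<union> (\<lambda>x. N - x) ` ({1..N} - X)"
    proof (cases "y < N")
      case True
      then have "N - y \<notin> X" "y = N - (N - y)"
        using y neg[of "N - y"] by (auto simp: B_def of_nat_diff)
      then have "y \<in> (\<lambda>x. N - x) ` ({1..N} - X)"
        using True by (intro image_eqI[of _ _ "N - y"]) auto
      then show ?thesis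
        by simp
    next
      case False
      then have "y - N \<in> X" "y = N + (y - N)"
        using y \<open>y \<noteq> N\<close> by (auto simp: B_def X_def of_nat_diff)
      then show ?thesis
        by blast
    qed
  next
    fix y assume "y \<in> (\<lambda>x. N + x) ` X \<union> (\<lambda>x. N - x) ` ({1..N} - X)"
    then show "y \<in> B"
      using neg by (auto simp: B_def X_def of_nat_diff)
  qed
  have "finite B"
    unfolding B using finX by simp
  have "card B = card X + card ({1..N} - X)"
  proof -
    have "inj_on (\<lambda>x. N - x) ({1..N} - X)"
      by (rule inj_onI) auto
    moreover have "(\<lambda>x. N + x) ` X \<inter> (\<lambda>x. N - x) ` ({1..N} - X) = {}"
      by (auto simp: X_def)
    ultimately show ?thesis
      unfolding B using finX by (subst card_Un_disjoint) (auto simp: card_image)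
  qed
  also have "\<dots> = N"
  proof -
    have "X \<subseteq> {1..N}"
      using N by (auto simp: X_def)
    then show ?thesis
      using card_Diff_subset[OF finX, of "{1..N}"] card_mono[of "{1..N}" X] by simp
  qed
  finally have cardB: "card B = N" .
  define bs where "bs = rev (sorted_list_of_set B)"
  have bs: "set bs = B" "length bs = N" "sorted_wrt (>) bs"
    using \<open>finite B\<close> cardB sorted_wrt_greater_rev_sorted_list_of_set[of B] by (auto simp: bs_def)
  interpret beta_numbers "part bs" N
    by unfold_locales (use part_strict[OF bs(3)] bs(2) in auto)
  have posB: "0 < y" if "y \<in> B" for y
  proof (rule ccontr)
    assume "\<not> 0 < y"
    then have "- int N \<in> M"
      using that by (simp add: B_def)
    then show False
      using neg[of N] N(2) M by (cases "N = 0") (auto simp: symmetric_beads_def)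
  qed
  define q where "q = map (\<lambda>a. a + part bs a - N) [1..<N + 1]"
  have len: "length q = N"
    by (simp add: q_def)
  have big: "N < a + part bs a" if "1 \<le> a" "a \<le> N" for a
  proof -
    have "N + part bs N \<le> a + part bs a"
      using that by (intro decr_shift) auto
    moreover have "0 < part bs N"
      using posB part_in_set[of N bs] bs that by simp
    ultimately show ?thesis
      by linarith
  qed
  have part_q: "part q a = a + part bs a - N" if "1 \<le> a" "a \<le> N" for a
    using that nth_upt[of 1 "a - 1" "N + 1"] by (simp add: part_def q_def del: upt_Suc)
  have beta_q: "beta q a = part bs a" if "1 \<le> a" "a \<le> N" for a
    using that big[OF that] by (simp add: beta_def part_q len)
  have "is_partition q"
    unfolding is_partition_def
  proof
    show "sorted_wrt (\<ge>) q"
      unfolding q_def sorted_wrt_map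
      by (rule sorted_wrt_mono_rel[OF _ sorted_wrt_upt]) (use decr_shift in \<open>auto intro!: diff_le_mono\<close>)
    show "\<forall>x\<in>set q. 0 < x"
      using big by (auto simp: q_def)
  qed
  moreover have "maya q = M"
  proof (rule set_eqI)
    fix z
    show "z \<in> maya q \<longleftrightarrow> z \<in> M"
    proof (cases "z + int N < 0")
      case True
      then have "nat (- z) \<notin> X"
        using N(1)[of "nat (- z)"] by linarith
      then have "z \<in> M"
        using neg[of "nat (- z)"] True by simp
      then show ?thesis
        using True by (simp add: maya_def len)
    next
      case False
      then obtain y where y: "z = int y - int N"
        by (metis add_diff_cancel_right' int_nat_eq linorder_not_less)
      have "z \<in> maya q \<longleftrightarrow> (\<exists>a. 1 \<le> a \<and> a \<le> N \<and> y = part bs a)"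
        using beta_q by (auto simp: maya_def len y)
      also have "\<dots> \<longleftrightarrow> y \<in> B"
        unfolding bs(1)[symmetric] set_conv_part bs(2) by auto
      finally show ?thesis
        by (simp add: B_def y)
    qed
  qed
  ultimately show ?thesis
    by (rule that)
qed

lemma card_doubled_distinct:
  assumes "\<And>q. is_partition q \<Longrightarrow> P q \<longleftrightarrow> Q (maya q)"
  shows "card {q. (\<exists>p. doubled_distinct p q) \<and> P q} = card {M. symmetric_beads M \<and> Q M}"
proof -
  have eq: "{q. (\<exists>p. doubled_distinct p q) \<and> P q} =
      {q. is_partition q \<and> symmetric_beads (maya q) \<and> Q (maya q)}"
    using doubled_distinct_iff_symmetric assms by (auto simp: doubled_distinct_def)
  have "maya ` {q. is_partition q \<and> symmetric_beads (maya q) \<and> Q (maya q)} =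
      {M. symmetric_beads M \<and> Q M}"
  proof (intro equalityI subsetI)
    fix M assume "M \<in> {M. symmetric_beads M \<and> Q M}"
    then show "M \<in> maya ` {q. is_partition q \<and> symmetric_beads (maya q) \<and> Q (maya q)}"
      using symmetric_beads_maya[of M] by (metis (mono_tags, lifting) image_eqI mem_Collect_eq)
  qed auto
  moreover have "inj_on maya {q. is_partition q \<and> symmetric_beads (maya q) \<and> Q (maya q)}"
    by (rule inj_on_subset[OF inj_on_maya]) auto
  ultimately show ?thesis
    unfolding eq by (metis card_image)
qed

section \<open>Counting lattice paths\<close>

text \<open>The value 0 outside the path makes each path a single function. The start is 0 or 1
  because column 0 of the abacus has height 0, and the odd height of column 1 can then only be 1 or
  -1.\<close>

definition lattice_paths :: "nat \<Rightarrow> int \<Rightarrow> (nat \<Rightarrow> int) set" where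
  "lattice_paths n e = {E. E 1 \<in> {0, 1} \<and> (\<forall>j\<in>{1..n}. E (Suc j) - E j \<in> {0, 1, 2}) \<and>
     E (Suc n) = e \<and> (\<forall>j. j = 0 \<or> Suc n < j \<longrightarrow> E j = 0)}"

lemma lattice_paths_0:
  "lattice_paths 0 e = (if e \<in> {0, 1} then {(\<lambda>_. 0)(1 := e)} else {})"
proof -
  have "E = (\<lambda>_. 0)(1 := E 1)" if "\<forall>j. j = 0 \<or> Suc 0 < j \<longrightarrow> E j = (0::int)" for E
  proof
    fix j
    show "E j = ((\<lambda>_. 0)(1 := E 1)) j"
      using that by (cases "j = 0"; cases "j = 1") auto
  qed
  moreover have "E \<in> lattice_paths 0 e \<longleftrightarrow>
      E 1 \<in> {0, 1} \<and> E 1 = e \<and> (\<forall>j. j = 0 \<or> Suc 0 < j \<longrightarrow> E j = 0)" for E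
    by (simp add: lattice_paths_def)
  ultimately have "E \<in> lattice_paths 0 e \<longleftrightarrow> e \<in> {0, 1} \<and> E = (\<lambda>_. 0)(1 := e)" for E
    by (metis (no_types, lifting) One_nat_def fun_upd_apply less_irrefl zero_neq_one)
  then show ?thesis
    by (intro set_eqI) simp
qed

lemma lattice_paths_Suc:
  "lattice_paths (Suc n) e =
     (\<lambda>E. E(Suc (Suc n) := e)) `
       (lattice_paths n e \<union> lattice_paths n (e - 1) \<union> lattice_paths n (e - 2))"
proof (intro equalityI subsetI)
  fix E assume E: "E \<in> lattice_paths (Suc n) e"
  have step: "E (Suc (Suc n)) - E (Suc n) \<in> {0, 1, 2}" and e: "E (Suc (Suc n)) = e"
    using E by (auto simp: lattice_paths_def)
  define F where "F = E(Suc (Suc n) := 0)"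
  have F: "F \<in> lattice_paths n (E (Suc n))"
    using E by (auto simp: lattice_paths_def F_def)
  have "E (Suc n) = e \<or> E (Suc n) = e - 1 \<or> E (Suc n) = e - 2"
    using step e by auto
  then have "F \<in> lattice_paths n e \<union> lattice_paths n (e - 1) \<union> lattice_paths n (e - 2)"
    using F by auto
  then have "F(Suc (Suc n) := e) \<in> (\<lambda>E. E(Suc (Suc n) := e)) `
      (lattice_paths n e \<union> lattice_paths n (e - 1) \<union> lattice_paths n (e - 2))"
    by (rule imageI)
  moreover have "F(Suc (Suc n) := e) = E"
    using e by (auto simp: F_def)
  ultimately show "E \<in> (\<lambda>E. E(Suc (Suc n) := e)) `
      (lattice_paths n e \<union> lattice_paths n (e - 1) \<union> lattice_paths n (e - 2))"
    by simp
next
  fix E assume "E \<in> (\<lambda>E. E(Suc (Suc n) := e)) `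
      (lattice_paths n e \<union> lattice_paths n (e - 1) \<union> lattice_paths n (e - 2))"
  then obtain F where
    F': "F \<in> lattice_paths n e \<union> lattice_paths n (e - 1) \<union> lattice_paths n (e - 2)"
    and E: "E = F(Suc (Suc n) := e)"
    by (rule imageE)
  from F' have F: "F \<in> lattice_paths n (F (Suc n))" "F (Suc n) \<in> {e, e - 1, e - 2}"
    by (auto simp: lattice_paths_def)
  have "\<forall>j\<in>{1..Suc n}. E (Suc j) - E j \<in> {0, 1, 2}"
  proof
    fix j assume that: "j \<in> {1..Suc n}"
    show "E (Suc j) - E j \<in> {0, 1, 2}"
    proof (cases "j = Suc n")
      case True
      then show ?thesis
        using F(2) by (auto simp: E)
    next
      case False
      then have "j \<in> {1..n}"
        using that by auto
      then show ?thesis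
        using F(1) by (simp add: E lattice_paths_def)
    qed
  qed
  moreover have "E 1 \<in> {0, 1}" "E (Suc (Suc n)) = e"
    using F(1) by (auto simp: E lattice_paths_def)
  moreover have "\<forall>j. j = 0 \<or> Suc (Suc n) < j \<longrightarrow> E j = 0"
    using F(1) by (auto simp: E lattice_paths_def)
  ultimately show "E \<in> lattice_paths (Suc n) e"
    unfolding lattice_paths_def mem_Collect_eq by blast
qed

lemma finite_lattice_paths [simp]: "finite (lattice_paths n e)"
  by (induction n arbitrary: e) (auto simp: lattice_paths_0 lattice_paths_Suc)

lemma lattice_paths_disjoint: "e \<noteq> e' \<Longrightarrow> lattice_paths n e \<inter> lattice_paths n e' = {}"
  by (auto simp: lattice_paths_def)

lemma inj_on_lattice_paths_upd:
  "inj_on (\<lambda>E. E(Suc (Suc n) := e)) (\<Union>e'\<in>A. lattice_paths n e')"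
proof (rule inj_onI)
  fix E F assume *: "E \<in> (\<Union>e'\<in>A. lattice_paths n e')" "F \<in> (\<Union>e'\<in>A. lattice_paths n e')"
    "E(Suc (Suc n) := e) = F(Suc (Suc n) := e)"
  then have "E (Suc (Suc n)) = 0" "F (Suc (Suc n)) = 0"
    by (auto simp: lattice_paths_def)
  then show "E = F"
    using *(3) by (metis fun_upd_triv fun_upd_upd)
qed

lemma card_lattice_paths_Suc:
  "card (lattice_paths (Suc n) e) =
     card (lattice_paths n e) + card (lattice_paths n (e - 1)) + card (lattice_paths n (e - 2))"
proof -
  have U: "lattice_paths n e \<union> lattice_paths n (e - 1) \<union> lattice_paths n (e - 2) =
    (\<Union>e'\<in>{e, e - 1, e - 2}. lattice_paths n e')"
    by auto
  have "card (lattice_paths (Suc n) e) =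
    card (lattice_paths n e \<union> lattice_paths n (e - 1) \<union> lattice_paths n (e - 2))"
    unfolding lattice_paths_Suc U by (rule card_image[OF inj_on_lattice_paths_upd])
  also have "\<dots> = card (lattice_paths n e) + card (lattice_paths n (e - 1)) +
      card (lattice_paths n (e - 2))"
    by (simp add: card_Un_disjoint Int_Un_distrib2 lattice_paths_disjoint)
  finally show ?thesis .
qed

text \<open>
  The term with index \<open>i\<close> counts the paths with \<open>i div 2\<close> steps \<open>2\<close> and \<open>M - i\<close> steps \<open>1\<close>; the
  parity of \<open>i\<close> is the initial value \<open>E 1\<close>.
\<close>

definition path_number :: "nat \<Rightarrow> nat \<Rightarrow> nat" where
  "path_number n M = (\<Sum>i\<le>M. (n choose (i div 2)) * ((n - i div 2) choose (M - i)))"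

text \<open>Pascal rule for arrangements of \<open>Suc k\<close> steps 2 and \<open>Suc f\<close>
  steps 1, sorted by whether the last step is 0, 1 or 2.\<close>

lemma trinomial_pascal:
  "(Suc n choose Suc k) * ((Suc n - Suc k) choose Suc f) =
     (n choose Suc k) * ((n - Suc k) choose Suc f) + (n choose Suc k) * ((n - Suc k) choose f) +
     (n choose k) * ((n - k) choose Suc f)"
proof (cases "k < n")
  case True
  then obtain r where r: "n - k = Suc r" "n - Suc k = r"
    by (metis Suc_diff_Suc)
  show ?thesis
    by (simp add: r algebra_simps)
qed (simp add: binomial_eq_0)

lemma trinomial_pascal_0:
  "(Suc n choose Suc k) * ((Suc n - Suc k) choose 0) =
     (n choose Suc k) * ((n - Suc k) choose 0) + (n choose k) * ((n - k) choose 0)"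
  by simp

lemma path_number_0: "path_number 0 M = (if M \<le> 1 then 1 else 0)"
proof -
  have "path_number 0 M = (\<Sum>i\<le>M. if i = M \<and> M \<le> 1 then 1 else 0)"
    unfolding path_number_def
  proof (rule sum.cong)
    fix i assume "i \<in> {..M}"
    then show "(0 choose (i div 2)) * ((0 - i div 2) choose (M - i)) =
        (if i = M \<and> M \<le> 1 then 1 else 0)"
      by (cases "i div 2"; cases "M - i") auto
  qed simp
  then show ?thesis
    by (cases "M \<le> 1") auto
qed

lemma path_number_Suc_0: "path_number (Suc n) 0 = path_number n 0"
  by (simp add: path_number_def)

lemma path_number_Suc_1: "path_number (Suc n) (Suc 0) = path_number n (Suc 0) + path_number n 0"
  by (simp add: path_number_def)

lemma path_number_Suc:
  "path_number (Suc n) (Suc (Suc M)) =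
     path_number n (Suc (Suc M)) + path_number n (Suc M) + path_number n M"
proof -
  define A where "A n k f = (n choose k) * ((n - k) choose f)" for n k f :: nat
  have P: "path_number n M = (\<Sum>i\<le>M. A n (i div 2) (M - i))" for n M
    by (simp add: path_number_def A_def)
  \<comment> \<open>Deleting a step 2 lowers \<open>i\<close> by 2; the indices 0 and 1, where there
    is no such step, are treated separately.\<close>
  have split: "(\<Sum>i\<le>Suc (Suc M). f i) = f 0 + f 1 + (\<Sum>i\<le>M. f (Suc (Suc i)))"
    for f :: "nat \<Rightarrow> nat" and M
    by (simp add: sum.atMost_Suc_shift del: sum.atMost_Suc)
  have A0: "A (Suc n) 0 (Suc f) = A n 0 (Suc f) + A n 0 f" for f
    by (simp add: A_def)
  have AS: "A (Suc n) (Suc k) (Suc f) = A n (Suc k) (Suc f) + A n (Suc k) f + A n k (Suc f)" for k f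
    unfolding A_def by (rule trinomial_pascal)
  have AS0: "A (Suc n) (Suc k) 0 = A n (Suc k) 0 + A n k 0" for k
    unfolding A_def by (rule trinomial_pascal_0)
  \<comment> \<open>In the term \<open>i = M\<close> there is no step 1 to delete, so it follows the
    rule \<open>AS0\<close> with two summands.\<close>
  have main: "(\<Sum>i\<le>M. A (Suc n) (Suc (i div 2)) (M - i)) =
      (\<Sum>i\<le>M. A n (Suc (i div 2)) (M - i)) + (\<Sum>i<M. A n (Suc (i div 2)) (M - Suc i)) +
      (\<Sum>i\<le>M. A n (i div 2) (M - i))"
  proof -
    have "(\<Sum>i<M. A (Suc n) (Suc (i div 2)) (M - i)) =
      (\<Sum>i<M. A n (Suc (i div 2)) (M - i) + A n (Suc (i div 2)) (M - Suc i) + A n (i div 2) (M - i))"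
    proof (rule sum.cong)
      fix i assume "i \<in> {..<M}"
      then obtain f where "M - i = Suc f" "M - Suc i = f"
        by (metis Suc_diff_Suc lessThan_iff)
      then show "A (Suc n) (Suc (i div 2)) (M - i) =
          A n (Suc (i div 2)) (M - i) + A n (Suc (i div 2)) (M - Suc i) + A n (i div 2) (M - i)"
        by (simp add: AS)
    qed simp
    then show ?thesis
      by (simp add: lessThan_Suc_atMost[symmetric] sum.distrib AS0)
  qed
  have "path_number n (Suc M) = A n 0 (Suc M) + A n 0 M + (\<Sum>i<M. A n (Suc (i div 2)) (M - Suc i))"
  proof (cases M)
    case (Suc N)
    then show ?thesis
      unfolding P Suc split by (simp add: lessThan_Suc_atMost)
  qed (simp add: P A_def)
  then show ?thesis
    using main unfolding P split by (simp add: A0)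
qed

lemma card_lattice_paths:
  "card (lattice_paths n e) = (if e < 0 then 0 else path_number n (nat e))"
proof (induction n arbitrary: e)
  case 0
  then show ?case
    by (auto simp: lattice_paths_0 path_number_0)
next
  case (Suc n)
  consider "e < 0" | "e = 0" | "e = 1" | M where "e = int (Suc (Suc M))"
  proof (cases "0 \<le> e - 2")
    case True
    then have "e = int (Suc (Suc (nat (e - 2))))"
      by simp
    then show ?thesis
      by (rule that(4))
  qed (use that in force)
  then show ?case
  proof cases
    case 4
    then show ?thesis
      by (simp add: card_lattice_paths_Suc Suc path_number_Suc nat_add_distrib)
  qed (simp_all add: card_lattice_paths_Suc Suc path_number_Suc_0 path_number_Suc_1)
qed

text \<open>Needed for conditions on the column before the last: for CSYDs with even
  \<open>s\<close>, and for the sets containing \<open>t / 2\<close> when \<open>t\<close> is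
  even.\<close>

lemma card_lattice_paths_through:
  "card {E \<in> lattice_paths (Suc n) e. P (E (Suc n))} =
     (\<Sum>v\<in>{e, e - 1, e - 2}. if P v then card (lattice_paths n v) else 0)"
proof -
  define U where "U = (\<Union>v\<in>{e, e - 1, e - 2}. if P v then lattice_paths n v else {})"
  have last: "E (Suc n) = v" if "E \<in> lattice_paths n v" for E v
    using that by (simp add: lattice_paths_def)
  have "{E \<in> lattice_paths (Suc n) e. P (E (Suc n))} = (\<lambda>E. E(Suc (Suc n) := e)) `
      {F \<in> lattice_paths n e \<union> lattice_paths n (e - 1) \<union> lattice_paths n (e - 2). P (F (Suc n))}"
    unfolding lattice_paths_Suc by auto
  also have "{F \<in> lattice_paths n e \<union> lattice_paths n (e - 1) \<union> lattice_paths n (e - 2). P (F (Suc n))} = U"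
  proof -
    have "{F \<in> lattice_paths n v. P (F (Suc n))} = (if P v then lattice_paths n v else {})" for v
      using last by auto
    moreover have "{F \<in> A \<union> B \<union> C. Q F} = {F \<in> A. Q F} \<union> {F \<in> B. Q F} \<union> {F \<in> C. Q F}"
      for A B C :: "(nat \<Rightarrow> int) set" and Q
      by blast
    ultimately show ?thesis
      by (simp add: U_def Un_assoc)
  qed
  finally have image: "{E \<in> lattice_paths (Suc n) e. P (E (Suc n))} =
      (\<lambda>E. E(Suc (Suc n) := e)) ` U" .
  have "U \<subseteq> (\<Union>v\<in>{e, e - 1, e - 2}. lattice_paths n v)"
    by (auto simp: U_def split: if_splits)
  then have "card {E \<in> lattice_paths (Suc n) e. P (E (Suc n))} = card U"
    unfolding image by (intro card_image inj_on_subset[OF inj_on_lattice_paths_upd])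
  also have "\<dots> = (\<Sum>v\<in>{e, e - 1, e - 2}. card (if P v then lattice_paths n v else {}))"
    unfolding U_def by (rule card_UN_disjoint) (auto simp: lattice_paths_disjoint)
  also have "\<dots> = (\<Sum>v\<in>{e, e - 1, e - 2}. if P v then card (lattice_paths n v) else 0)"
    by (rule sum.cong) auto
  finally show ?thesis .
qed

text \<open>Coefficient of \<open>x^M\<close> in \<open>(1 + x)^(a + 1) (1 + x + x^2)^n\<close>:
  each unit of \<open>a\<close> stands for one further step limited to 0 and 1.\<close>

definition shifted_path_number :: "nat \<Rightarrow> nat \<Rightarrow> nat \<Rightarrow> nat" where
  "shifted_path_number n a M =
     (\<Sum>i = 0..M. (n choose (i div 2)) * ((n + a - i div 2) choose (M - i)))"

lemma shifted_path_number_0: "shifted_path_number n 0 M = path_number n M"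
  by (simp add: shifted_path_number_def path_number_def atMost_atLeast0)

lemma shifted_path_number_Suc_0:
  "shifted_path_number n (Suc a) 0 = shifted_path_number n a 0"
  by (simp add: shifted_path_number_def)

lemma shifted_path_number_Suc:
  "shifted_path_number n (Suc a) (Suc M) =
     shifted_path_number n a (Suc M) + shifted_path_number n a M"
proof -
  have "(n choose (i div 2)) * ((n + Suc a - i div 2) choose (Suc M - i)) =
      (n choose (i div 2)) * ((n + a - i div 2) choose (Suc M - i)) +
      (n choose (i div 2)) * ((n + a - i div 2) choose (M - i))" if "i \<le> M" for i
  proof (cases "i div 2 \<le> n")
    case True
    then have "n + Suc a - i div 2 = Suc (n + a - i div 2)" "Suc M - i = Suc (M - i)"
      using that by auto
    then show ?thesis
      by (simp add: algebra_simps)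
  qed (simp add: binomial_eq_0)
  then show ?thesis
    by (simp add: shifted_path_number_def sum.distrib)
qed

lemma card_lattice_paths_pos:
  "card (lattice_paths n (int M)) = path_number n M"
  by (simp add: card_lattice_paths)

lemma shifted_path_number_1:
  "shifted_path_number n 1 M = card (lattice_paths n (int M)) + card (lattice_paths n (int M - 1))"
  by (cases M) (simp_all add: card_lattice_paths shifted_path_number_Suc_0 shifted_path_number_Suc
      shifted_path_number_0 nat_add_distrib)

lemma shifted_path_number_2:
  "shifted_path_number n 2 M = card (lattice_paths n (int M)) +
     2 * card (lattice_paths n (int M - 1)) + card (lattice_paths n (int M - 2))"
proof (cases M)
  case (Suc k)
  have "shifted_path_number n (Suc 1) (Suc k) =
      shifted_path_number n 1 (Suc k) + shifted_path_number n 1 k"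
    by (rule shifted_path_number_Suc)
  then show ?thesis
    unfolding shifted_path_number_1 by (simp add: Suc numeral_2_eq_2)
qed (simp add: card_lattice_paths shifted_path_number_Suc_0 shifted_path_number_0 numeral_2_eq_2)

section \<open>The sums of the counting formulas as path numbers\<close>

lemma trinomial_eq_binomials:
  assumes "a + b + c = n"
  shows "trinomial n a b c = (n choose a) * ((n - a) choose c)"
proof -
  have "fact a * fact (n - a) * (n choose a) = (fact n :: nat)"
    using assms by (intro binomial_fact_lemma) auto
  moreover have "fact c * fact b * ((n - a) choose c) = (fact (n - a) :: nat)"
  proof -
    have "c \<le> n - a" "n - a - c = b"
      using assms by auto
    then show ?thesis
      using binomial_fact_lemma[of c "n - a"] by simp
  qed
  ultimately have "fact n = (n choose a) * ((n - a) choose c) * (fact a * fact b * fact c :: nat)"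
    by (metis (no_types, lifting) mult.assoc mult.commute)
  then show ?thesis
    unfolding trinomial_def by (metis fact_nonzero mult_eq_0_iff nonzero_mult_div_cancel_right)
qed

text \<open>For odd \<open>d\<close> the entry \<open>(d + i) div 2\<close> is the number of steps
  0, namely \<open>n - i div 2 - (M - i)\<close>.\<close>

lemma sum_trinomial:
  assumes "odd d" "n = M + (d - 1) div 2"
  shows "(\<Sum>i = 0..M. trinomial n (i div 2) ((d + i) div 2) (M - i)) = path_number n M"
  unfolding path_number_def atMost_atLeast0
proof (rule sum.cong)
  fix i assume "i \<in> {0..M}"
  then have "i div 2 + (d + i) div 2 + (M - i) = n"
    using assms by (auto elim!: oddE)
  then show "trinomial n (i div 2) ((d + i) div 2) (M - i) =
      (n choose (i div 2)) * ((n - i div 2) choose (M - i))"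
    by (rule trinomial_eq_binomials)
qed simp

text \<open>Since \<open>n - (M - i) = D + i\<close>, the product first chooses the steps different
  from 1 and then the steps 2 among them.\<close>

lemma sum_binomial_product:
  assumes "n = M + D"
  shows "(\<Sum>i = 0..M. ((D + i) choose (i div 2)) * (n choose (D + i))) = path_number n M"
  unfolding path_number_def atMost_atLeast0
proof (rule sum.cong)
  fix i assume i: "i \<in> {0..M}"
  have "(n choose (D + i)) * ((D + i) choose (i div 2)) =
      (n choose (i div 2)) * ((n - i div 2) choose (D + i - i div 2))"
    using i assms by (intro choose_mult) auto
  also have "(n - i div 2) choose (D + i - i div 2) = (n - i div 2) choose (M - i)"
  proof -
    have "n - i div 2 - (D + i - i div 2) = M - i" "D + i - i div 2 \<le> n - i div 2"
      using i assms by auto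
    then show ?thesis
      by (metis binomial_symmetric)
  qed
  finally show "((D + i) choose (i div 2)) * (n choose (D + i)) =
      (n choose (i div 2)) * ((n - i div 2) choose (M - i))"
    by (simp add: mult.commute)
qed simp

text \<open>The term \<open>i = M\<close> vanishes because \<open>D + M\<close> exceeds
  \<open>n\<close>; what remains is the previous sum for \<open>M - 1\<close>. For
  \<open>M = 0\<close> both sides are 0, the path having a negative end.\<close>

lemma sum_binomial_product_top:
  assumes "Suc n = M + D"
  shows "(\<Sum>i = 0..M. ((D + i) choose (i div 2)) * (n choose (D + i))) =
    card (lattice_paths n (int M - 1))"
proof (cases M)
  case (Suc k)
  then have "(\<Sum>i = 0..M. ((D + i) choose (i div 2)) * (n choose (D + i))) =
      (\<Sum>i = 0..k. ((D + i) choose (i div 2)) * (n choose (D + i)))"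
    using assms by (simp add: binomial_eq_0)
  also have "\<dots> = path_number n k"
    using assms Suc by (intro sum_binomial_product) simp
  finally show ?thesis
    by (simp add: Suc card_lattice_paths)
qed (use assms in \<open>simp add: card_lattice_paths binomial_eq_0\<close>)

section \<open>The abacus\<close>

text \<open>
  Every integer is \<open>d j + t u\<close> with \<open>t = s + d\<close>; subtracting \<open>s\<close>, \<open>s + d\<close>, \<open>s + 2 d\<close> lowers \<open>u\<close> by
  one and changes \<open>j\<close> by \<open>1\<close>, \<open>0\<close>, \<open>-1\<close>. The function \<open>height\<close> gives twice the height of the
  uppermost bead of each column plus one, which makes the symmetry \<open>height (- j) = - height j\<close> exact.
  In the columns \<open>1, \<dots>, m\<close> it equals \<open>2 E j - 2 j + 1\<close>, so that its steps \<open>-2, 0, 2\<close> become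
  steps \<open>0, 1, 2\<close> of \<open>E\<close>.
\<close>

locale abacus =
  fixes s d :: nat
  assumes s_pos: "0 < s" and d_pos: "0 < d" and coprime_s_d: "coprime s d"
begin

definition t :: int where "t = int s + int d"

definition m :: nat where "m = (s + d) div 2"

definition level :: "(nat \<Rightarrow> int) \<Rightarrow> int \<Rightarrow> int" where
  "level E j = 2 * E (nat j) - 2 * j + 1"

text \<open>The pairs \<open>(j + t, u)\<close> and \<open>(j, u + d)\<close> denote the same
  integer, so each period lowers the height by \<open>2 * int d\<close>; the columns past the middle
  are mirror images. Column 0 has its top bead at \<open>u = - 1\<close> but gets height 0 instead
  of -1: the point 0 is not subject to the symmetry, and only the value 0 is compatible with
  \<open>height E (- j) = - height E j\<close>.\<close>

definition height :: "(nat \<Rightarrow> int) \<Rightarrow> int \<Rightarrow> int" where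
  "height E j = (if j mod t = 0 then 0
     else if j mod t \<le> int m then level E (j mod t)
     else - 2 * int d - level E (t - j mod t)) - 2 * int d * (j div t)"

definition beads :: "(nat \<Rightarrow> int) \<Rightarrow> int set" where
  "beads E = {z. \<exists>j u. z = int d * j + t * u \<and> 2 * u < height E j}"

text \<open>For even \<open>t\<close> the column \<open>m\<close> is its own mirror image, which
  forces its height.\<close>

definition central :: "(nat \<Rightarrow> int) \<Rightarrow> bool" where
  "central E \<longleftrightarrow> (even t \<longrightarrow> level E (int m) = - int d)"

lemma t_gt: "int d < t" "1 < t"
  using s_pos d_pos by (auto simp: t_def)

lemma m_bounds: "1 \<le> int m" "2 * int m \<le> t" "t \<le> 2 * int m + 1"
  using s_pos d_pos by (auto simp: m_def t_def)

lemma even_t_iff: "even t \<longleftrightarrow> t = 2 * int m"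
  using m_bounds by presburger

lemma coprime_t_d: "coprime t (int d)"
proof -
  have "coprime (s + d) d"
    using coprime_s_d by (simp add: coprime_iff_gcd_eq_1)
  then show ?thesis
    by (metis coprime_int_iff of_nat_add t_def)
qed

lemma odd_level: "odd (level E j)"
  by (simp add: level_def)

lemma height_add: "height E (j + k * t) = height E j - 2 * int d * k"
  using t_gt by (simp add: height_def algebra_simps)

lemma height_0: "height E 0 = 0"
  by (simp add: height_def)

lemma height_lower: "0 < j \<Longrightarrow> j \<le> int m \<Longrightarrow> height E j = level E j"
  using m_bounds t_gt by (simp add: height_def)

lemma height_upper: "int m < j \<Longrightarrow> j < t \<Longrightarrow> height E j = - 2 * int d - level E (t - j)"
  using m_bounds by (simp add: height_def)

lemma height_uminus:
  assumes "central E"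
  shows "height E (- j) = - height E j"
proof (cases "j mod t = 0")
  case True
  then have "(- j) mod t = 0" "(- j) div t = - (j div t)"
    by (auto simp: mod_eq_0_iff_dvd dvd_neg_div)
  then show ?thesis
    using True by (simp add: height_def)
next
  case False
  define r where "r = j mod t"
  define q where "q = j div t"
  have j: "j = r + q * t"
    unfolding r_def q_def by (metis add.commute div_mult_mod_eq)
  have r: "0 < r" "r < t"
    using False t_gt pos_mod_bound[of t j] pos_mod_sign[of t j] unfolding r_def by linarith+
  have a: "height E j = height E r - 2 * int d * q"
    unfolding j by (rule height_add)
  have "- j = (t - r) + (- q - 1) * t"
    by (simp add: j algebra_simps)
  then have b: "height E (- j) = height E (t - r) - 2 * int d * (- q - 1)"
    by (metis height_add)
  have "height E (t - r) = - 2 * int d - height E r"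
  proof -
    consider "r \<le> int m" "t - r \<le> int m" | "r \<le> int m" "\<not> t - r \<le> int m" | "\<not> r \<le> int m"
      by blast
    then show ?thesis
    proof cases
      case 1
      then have "r = int m" "t - r = int m" "even t"
        using m_bounds by (auto simp: even_t_iff)
      then show ?thesis
        using assms r by (simp add: height_lower central_def)
    next
      case 2
      then show ?thesis
        using r height_upper[of "t - r" E] height_lower[of r E] by simp
    next
      case 3
      then have "t - r \<le> int m"
        using m_bounds by linarith
      then show ?thesis
        using 3 r height_upper[of r E] height_lower[of "t - r" E] by simp
    qed
  qed
  then show ?thesis
    using a b by (simp add: algebra_simps)
qed

lemma height_reflect: "central E \<Longrightarrow> height E (t - j) = - 2 * int d - height E j"
  using height_add[of E "- j" 1] height_uminus[of E j] by simp

lemma odd_height: "\<not> t dvd j \<Longrightarrow> odd (height E j)"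
proof -
  assume "\<not> t dvd j"
  then have "j mod t \<noteq> 0"
    by (simp add: dvd_eq_mod_eq_0)
  then show ?thesis
    using odd_level by (simp add: height_def)
qed

lemma height_multiple: "height E (k * t) = - 2 * int d * k"
  using height_add[of E 0 k] by (simp add: height_0)

lemma column_repr: obtains j u where "z = int d * j + t * u"
proof -
  obtain a b where "a * int d + b * t = 1"
    using coprime_t_d bezout_int[of "int d" t] by (metis coprime_commute coprime_iff_gcd_eq_1)
  moreover have "int d * (z * a) + t * (z * b) = z * (a * int d + b * t)"
    by (simp add: algebra_simps)
  ultimately have "z = int d * (z * a) + t * (z * b)"
    by simp
  then show ?thesis
    by (rule that)
qed

lemma t_dvd_cancel: "t dvd int d * j \<longleftrightarrow> t dvd j"
  using coprime_t_d by (rule coprime_dvd_mult_right_iff)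

text \<open>Coprimality of \<open>t\<close> and \<open>d\<close> makes \<open>(j, u)\<close> unique
  up to multiples of \<open>(t, - d)\<close>, and heights are compatible with this shift.\<close>

lemma mem_beads: "int d * j + t * u \<in> beads E \<longleftrightarrow> 2 * u < height E j"
proof
  assume "int d * j + t * u \<in> beads E"
  then obtain j' u' where *: "int d * j + t * u = int d * j' + t * u'" "2 * u' < height E j'"
    by (auto simp: beads_def)
  then have "int d * (j - j') = t * (u' - u)"
    by (simp add: algebra_simps)
  then have "t dvd j - j'"
    by (metis dvd_triv_left t_dvd_cancel)
  then obtain k where k: "j - j' = t * k" ..
  then have "j = j' + k * t"
    by (simp add: algebra_simps)
  moreover have "u' - u = int d * k"
  proof -
    have "t * (u' - u) = t * (int d * k)"
      using \<open>int d * (j - j') = t * (u' - u)\<close> unfolding k by (metis mult.left_commute)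
    then show ?thesis
      using t_gt(2) by (metis mult_left_cancel not_one_less_zero)
  qed
  ultimately show "2 * u < height E j"
    using *(2) by (simp add: height_add algebra_simps)
qed (auto simp: beads_def)

lemma symmetric_beads_beads:
  assumes "central E"
  shows "symmetric_beads (beads E)"
proof -
  have "- z \<in> beads E \<longleftrightarrow> z \<notin> beads E" if "z \<noteq> 0" for z
  proof -
    obtain j u where z: "z = int d * j + t * u"
      by (rule column_repr)
    \<comment> \<open>Heights are odd except in the columns divisible by \<open>t\<close>, where
      equality would mean \<open>z = 0\<close>.\<close>
    have "2 * u \<noteq> height E j"
    proof
      assume u: "2 * u = height E j"
      then have "t dvd j"
        using odd_height[of j E] by (metis dvd_triv_left)
      then obtain k where "j = k * t"
        by (metis dvd_def mult.commute)
      moreover from this have "u = - int d * k"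
        using u by (simp add: height_multiple)
      ultimately show False
        using that by (simp add: z)
    qed
    moreover have "- z = int d * (- j) + t * (- u)"
      by (simp add: z)
    then have "- z \<in> beads E \<longleftrightarrow> 2 * (- u) < height E (- j)"
      by (metis mem_beads)
    moreover have "z \<in> beads E \<longleftrightarrow> 2 * u < height E j"
      unfolding z by (rule mem_beads)
    ultimately show ?thesis
      by (auto simp: height_uminus[OF assms])
  qed
  moreover have "0 \<notin> beads E"
    using mem_beads[of 0 0 E] by (simp add: height_0)
  moreover have "finite {z \<in> beads E. 0 < z}"
  proof (rule finite_subset)
    \<comment> \<open>In a reduced column \<open>int d * j < int d * t\<close>, so a positive bead
      has \<open>u > - int d\<close>.\<close>
    show "{z \<in> beads E. 0 < z} \<subseteq>
        (\<Union>j\<in>{0..<t}. (\<lambda>u. int d * j + t * u) ` {- int d..height E j + 2 * int d})"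
    proof
      fix z assume z: "z \<in> {z \<in> beads E. 0 < z}"
      obtain j' u' where z': "z = int d * j' + t * u'"
        by (rule column_repr)
      define j where "j = j' mod t"
      define u where "u = u' + int d * (j' div t)"
      have "j' = j + (j' div t) * t"
        unfolding j_def by (metis add.commute div_mult_mod_eq)
      then have "int d * j' = int d * j + int d * ((j' div t) * t)"
        by (metis distrib_left)
      then have zu: "z = int d * j + t * u"
        by (simp add: z' u_def algebra_simps)
      have j: "j \<in> {0..<t}"
        using t_gt by (simp add: j_def)
      have "int d * j + t * u > 0"
        using z zu by simp
      moreover have "int d * j < int d * t"
        using j d_pos by simp
      ultimately have "0 < t * (u + int d)"
        by (simp add: algebra_simps)
      then have "- int d < u"
        using t_gt by (simp add: zero_less_mult_iff)
      moreover have "2 * u < height E j"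
        using z zu mem_beads by simp
      ultimately have "u \<in> {- int d..height E j + 2 * int d}"
        by auto
      then show "z \<in> (\<Union>j\<in>{0..<t}. (\<lambda>u. int d * j + t * u) ` {- int d..height E j + 2 * int d})"
        using j zu by blast
    qed
  qed simp
  ultimately show ?thesis
    by (simp add: symmetric_beads_def)
qed

lemma shift_closed_beads: "shift_closed t (beads E)"
  unfolding shift_closed_def
proof
  fix z assume "z \<in> beads E"
  then obtain j u where "z = int d * j + t * u" "2 * u < height E j"
    by (auto simp: beads_def)
  then have "z - t = int d * j + t * (u - 1)" "2 * (u - 1) < height E j"
    by (auto simp: algebra_simps)
  then show "z - t \<in> beads E"
    by (metis mem_beads)
qed

section \<open>Bar closure as a condition on neighbouring columns\<close>

lemma bar_closed_left_iff:
  "bar_closed (int s) (beads E) \<longleftrightarrow>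
    (\<forall>j u. 2 * u < height E j \<longrightarrow> 2 * (int d * j + t * u) \<noteq> int s \<longrightarrow> 2 * u - 2 < height E (j + 1))"
proof -
  have "int d * j + t * u - int s = int d * (j + 1) + t * (u - 1)" for j u
    by (simp add: t_def algebra_simps)
  then have *: "int d * j + t * u - int s \<in> beads E \<longleftrightarrow> 2 * u - 2 < height E (j + 1)" for j u
    using mem_beads[of "j + 1" "u - 1"] by simp
  have "bar_closed (int s) (beads E) \<longleftrightarrow> (\<forall>j u. int d * j + t * u \<in> beads E \<longrightarrow>
      2 * (int d * j + t * u) \<noteq> int s \<longrightarrow> int d * j + t * u - int s \<in> beads E)"
    unfolding bar_closed_def by (metis column_repr)
  then show ?thesis
    unfolding mem_beads * .
qed

lemma bar_closed_right_iff:
  "bar_closed (int (s + 2 * d)) (beads E) \<longleftrightarrow>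
    (\<forall>j u. 2 * u < height E j \<longrightarrow> 2 * (int d * j + t * u) \<noteq> int (s + 2 * d) \<longrightarrow>
      2 * u - 2 < height E (j - 1))"
proof -
  have "int d * j + t * u - int (s + 2 * d) = int d * (j - 1) + t * (u - 1)" for j u
    by (simp add: t_def algebra_simps)
  then have *: "int d * j + t * u - int (s + 2 * d) \<in> beads E \<longleftrightarrow> 2 * u - 2 < height E (j - 1)" for j u
    using mem_beads[of "j - 1" "u - 1"] by simp
  have "bar_closed (int (s + 2 * d)) (beads E) \<longleftrightarrow> (\<forall>j u. int d * j + t * u \<in> beads E \<longrightarrow>
      2 * (int d * j + t * u) \<noteq> int (s + 2 * d) \<longrightarrow> int d * j + t * u - int (s + 2 * d) \<in> beads E)"
    unfolding bar_closed_def by (metis column_repr)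
  then show ?thesis
    unfolding mem_beads * .
qed

text \<open>For odd \<open>t\<close> the columns \<open>m\<close> and \<open>m + 1\<close> have
  heights \<open>h\<close> and \<open>- 2 d - h\<close>. An ordinary step between them would require
  \<open>|h + d| \<le> 1\<close>; the exempt beads \<open>s / 2\<close> and \<open>s / 2 + d\<close>
  relax this to 2.\<close>

definition good :: "(nat \<Rightarrow> int) \<Rightarrow> bool" where
  "good E \<longleftrightarrow> E \<in> lattice_paths (m - 1) (E m) \<and> central E \<and>
     (odd t \<longrightarrow> \<bar>level E (int m) + int d\<bar> \<le> 2)"

lemma lattice_path_iff:
  "E \<in> lattice_paths (m - 1) (E m) \<longleftrightarrow>
    (\<forall>j. j = 0 \<or> m < j \<longrightarrow> E j = 0) \<and> (\<forall>j\<in>{0..<int m}. \<bar>height E (j + 1) - height E j\<bar> \<le> 2)"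
proof -
  have m: "Suc (m - 1) = m"
    using m_bounds by simp
  have first: "E 1 \<in> {0, 1} \<longleftrightarrow> \<bar>height E (0 + 1) - height E 0\<bar> \<le> 2"
    using height_lower[of 1 E] m_bounds by (auto simp: height_0 level_def)
  have step: "E (Suc j) - E j \<in> {0, 1, 2} \<longleftrightarrow> \<bar>height E (int j + 1) - height E (int j)\<bar> \<le> 2"
    if "j \<in> {1..m - 1}" for j
  proof -
    have "height E (int j + 1) = level E (int j + 1)" "height E (int j) = level E (int j)"
      using that by (intro height_lower; auto)+
    moreover have "nat (int j + 1) = Suc j"
      by simp
    ultimately show ?thesis
      by (auto simp: level_def)
  qed
  have "(\<forall>j\<in>{0..<int m}. \<bar>height E (j + 1) - height E j\<bar> \<le> 2) \<longleftrightarrow>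
      (\<forall>j\<in>{0..<m}. \<bar>height E (int j + 1) - height E (int j)\<bar> \<le> 2)"
  proof -
    have "{0..<int m} = int ` {0..<m}"
      by (simp add: image_int_atLeastLessThan)
    then show ?thesis
      by (simp only: ball_simps)
  qed
  also have "\<dots> \<longleftrightarrow> E 1 \<in> {0, 1} \<and> (\<forall>j\<in>{1..m - 1}. E (Suc j) - E j \<in> {0, 1, 2})"
  proof -
    have "{0..<m} = insert 0 {1..m - 1}"
      using m_bounds by auto
    then show ?thesis
      using step first by simp
  qed
  finally have steps: "(\<forall>j\<in>{0..<int m}. \<bar>height E (j + 1) - height E j\<bar> \<le> 2) \<longleftrightarrow>
      E 1 \<in> {0, 1} \<and> (\<forall>j\<in>{1..m - 1}. E (Suc j) - E j \<in> {0, 1, 2})" .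
  show ?thesis
    unfolding steps lattice_paths_def m mem_Collect_eq by (simp only: conj_ac simp_thms)
qed

text \<open>The reflection sends the edge from \<open>r\<close> to \<open>r + 1\<close> to the one
  from \<open>t - r - 1\<close> to \<open>t - r\<close>, so the path condition carries over to the
  upper half. Only for odd \<open>t\<close> is one edge its own image and not covered.\<close>

lemma good_edge:
  assumes E: "good E" and j: "\<not> (odd t \<and> j mod t = int m)"
  shows "\<bar>height E (j + 1) - height E j\<bar> \<le> 2"
proof -
  have lower: "\<bar>height E (j + 1) - height E j\<bar> \<le> 2" if "0 \<le> j" "j < int m" for j
    using E that unfolding good_def lattice_path_iff by auto
  have central: "central E"
    using E by (simp add: good_def)
  define r where "r = j mod t"
  have r: "0 \<le> r" "r < t"
    using t_gt by (auto simp: r_def)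
  have jr: "j = r + (j div t) * t" "j + 1 = (r + 1) + (j div t) * t"
    using div_mult_mod_eq[of j t] unfolding r_def by linarith+
  have "height E (j + 1) - height E j = height E (r + 1) - height E r"
  proof -
    have "height E j = height E r - 2 * int d * (j div t)"
      by (metis jr(1) height_add)
    moreover have "height E (j + 1) = height E (r + 1) - 2 * int d * (j div t)"
      by (metis jr(2) height_add)
    ultimately show ?thesis
      by simp
  qed
  moreover have "\<bar>height E (r + 1) - height E r\<bar> \<le> 2"
  proof (cases "r < int m")
    case False
    then have "t - r - 1 < int m"
      using j m_bounds by (auto simp: r_def even_t_iff)
    then have "\<bar>height E (t - r) - height E (t - (r + 1))\<bar> \<le> 2"
      using lower[of "t - r - 1"] r by (simp add: diff_diff_eq)
    then show ?thesis
      by (simp add: height_reflect[OF central])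
  qed (use lower r in auto)
  ultimately show ?thesis
    by simp
qed

lemma middle_columns:
  assumes "central E" "odd t" "j mod t = int m"
  obtains k where "j = int m + k * t" "height E j = level E (int m) - 2 * int d * k"
    "height E (j + 1) = - 2 * int d - level E (int m) - 2 * int d * k"
proof -
  define k where "k = j div t"
  have j: "j = int m + k * t"
    using div_mult_mod_eq[of j t] unfolding k_def assms(3) by linarith
  moreover have "t = 2 * int m + 1"
    using m_bounds assms(2) by (auto simp: even_t_iff)
  ultimately have j': "j + 1 = (t - int m) + k * t"
    by linarith
  have "height E (int m) = level E (int m)"
    using m_bounds by (intro height_lower) auto
  then have "height E j = level E (int m) - 2 * int d * k"
    "height E (j + 1) = - 2 * int d - level E (int m) - 2 * int d * k"
    unfolding j' unfolding j height_add height_reflect[OF assms(1)] by simp_all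
  with j show ?thesis
    by (rule that)
qed

lemma bar_closed_good:
  assumes E: "good E"
  shows "bar_closed (int s) (beads E)" "bar_closed (int (s + 2 * d)) (beads E)"
proof -
  have central: "central E"
    using E by (simp add: good_def)
  show "bar_closed (int s) (beads E)"
    unfolding bar_closed_left_iff
  proof (intro allI impI)
    fix j u assume u: "2 * u < height E j" "2 * (int d * j + t * u) \<noteq> int s"
    show "2 * u - 2 < height E (j + 1)"
    proof (cases "odd t \<and> j mod t = int m")
      case True
      then obtain k where k: "j = int m + k * t" "height E j = level E (int m) - 2 * int d * k"
        "height E (j + 1) = - 2 * int d - level E (int m) - 2 * int d * k"
        using middle_columns[OF central] by metis
      define v where "v = u + int d * k"
      have t: "t = 2 * int m + 1"
        using m_bounds True by (auto simp: even_t_iff)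
      have "2 * (int d * j + t * u) = int d * (2 * int m) + 2 * t * v"
        by (simp add: k(1) v_def algebra_simps)
      also have "\<dots> = int s + t * (2 * v - 1 + int d)"
      proof -
        have *: "int s = t - int d" "2 * int m = t - 1"
          using t by (simp_all add: t_def)
        show ?thesis
          unfolding * by (simp add: algebra_simps)
      qed
      \<comment> \<open>In the extreme case \<open>level E (int m) = 2 - int d\<close> the top bead
        has \<open>2 * v = 1 - int d\<close> and is the exempt point \<open>s / 2\<close>; all beads
        below it satisfy the claim.\<close>
      finally have "2 * v \<noteq> 1 - int d"
        using u(2) by auto
      moreover have "2 * v < level E (int m)"
        using u(1) k(2) by (simp add: v_def algebra_simps)
      moreover have "\<bar>level E (int m) + int d\<bar> \<le> 2"
        using E True by (simp add: good_def)
      ultimately have "2 * v - 2 < - 2 * int d - level E (int m)"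
        using odd_level[of E "int m"] by presburger
      then show ?thesis
        using k(3) by (simp add: v_def algebra_simps)
    next
      case False
      then show ?thesis
        using good_edge[OF E False] u(1) by linarith
    qed
  qed
  show "bar_closed (int (s + 2 * d)) (beads E)"
    unfolding bar_closed_right_iff
  proof (intro allI impI)
    fix i u assume u: "2 * u < height E i" "2 * (int d * i + t * u) \<noteq> int (s + 2 * d)"
    define j where "j = i - 1"
    have i: "i = j + 1"
      by (simp add: j_def)
    show "2 * u - 2 < height E (i - 1)"
    proof (cases "odd t \<and> j mod t = int m")
      case True
      then obtain k where k: "j = int m + k * t" "height E j = level E (int m) - 2 * int d * k"
        "height E (j + 1) = - 2 * int d - level E (int m) - 2 * int d * k"
        using middle_columns[OF central] by metis
      define v where "v = u + int d * k"
      have t: "t = 2 * int m + 1"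
        using m_bounds True by (auto simp: even_t_iff)
      have "2 * (int d * i + t * u) = int d * (2 * int m + 2) + 2 * t * v"
        by (simp add: i k(1) v_def algebra_simps)
      also have "\<dots> = int (s + 2 * d) + t * (2 * v - 1 + int d)"
      proof -
        have *: "int (s + 2 * d) = t + int d" "2 * int m = t - 1"
          using t by (simp_all add: t_def)
        show ?thesis
          unfolding * by (simp add: algebra_simps)
      qed
      finally have "2 * v \<noteq> 1 - int d"
        using u(2) by auto
      moreover have "2 * v < - 2 * int d - level E (int m)"
        using u(1) k(3) by (simp add: i v_def algebra_simps)
      moreover have "\<bar>level E (int m) + int d\<bar> \<le> 2"
        using E True by (simp add: good_def)
      ultimately have "2 * v - 2 < level E (int m)"
        using odd_level[of E "int m"] by presburger
      then show ?thesis
        using k(2) by (simp add: i v_def algebra_simps)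
    next
      case False
      then show ?thesis
        using good_edge[OF E False] u(1) by (simp add: i)
    qed
  qed
qed

text \<open>Exempt beads occur only at the middle edge: for odd \<open>t\<close> the condition says
  that \<open>j\<close> is congruent to \<open>m\<close>, for even \<open>t\<close> it cannot hold.
  All other edges obey the ordinary step condition.\<close>

lemma half_column_left:
  assumes "2 * (int d * j + t * u) = int s"
  shows "t dvd 2 * j + 1"
proof -
  have "int s = t - int d"
    by (simp add: t_def)
  then have "int d * (2 * j + 1) = t * (1 - 2 * u)"
    using assms by (simp add: algebra_simps)
  then show ?thesis
    by (metis dvd_triv_left t_dvd_cancel)
qed

lemma half_column_right:
  assumes "2 * (int d * j + t * u) = int (s + 2 * d)"
  shows "t dvd 2 * j - 1"
proof -
  have "int (s + 2 * d) = t + int d"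
    by (simp add: t_def)
  then have "int d * (2 * j - 1) = t * (1 - 2 * u)"
    using assms by (simp add: algebra_simps)
  then show ?thesis
    by (metis dvd_triv_left t_dvd_cancel)
qed

lemma left_edge:
  assumes "bar_closed (int s) (beads E)" "\<not> t dvd 2 * j + 1" "\<not> t dvd j"
  shows "height E j - 2 \<le> height E (j + 1)"
proof -
  define u where "u = (height E j - 1) div 2"
  have u: "2 * u = height E j - 1"
    using odd_height[OF assms(3), of E] by (simp add: u_def)
  then have "2 * u < height E j" "2 * (int d * j + t * u) \<noteq> int s"
    using half_column_left[of j u] assms(2) by auto
  then have "2 * u - 2 < height E (j + 1)"
    using assms(1) unfolding bar_closed_left_iff by blast
  then show ?thesis
    using u by linarith
qed

lemma right_edge:
  assumes "bar_closed (int (s + 2 * d)) (beads E)" "\<not> t dvd 2 * j + 1" "\<not> t dvd j + 1"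
  shows "height E (j + 1) - 2 \<le> height E j"
proof -
  define u where "u = (height E (j + 1) - 1) div 2"
  have u: "2 * u = height E (j + 1) - 1"
    using odd_height[OF assms(3), of E] by (simp add: u_def)
  moreover have "2 * (j + 1) - 1 = 2 * j + 1"
    by simp
  ultimately have "2 * u < height E (j + 1)" "2 * (int d * (j + 1) + t * u) \<noteq> int (s + 2 * d)"
    using half_column_right[of "j + 1" u] assms(2) by (linarith, metis)
  then have "2 * u - 2 < height E (j + 1 - 1)"
    using assms(1) unfolding bar_closed_right_iff by blast
  then show ?thesis
    using u by simp
qed

lemma goodI:
  assumes central: "central E" and supp: "\<forall>j. j = 0 \<or> m < j \<longrightarrow> E j = 0"
    and left: "bar_closed (int s) (beads E)" and right: "bar_closed (int (s + 2 * d)) (beads E)"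
  shows "good E"
proof -
  have ndvd: "\<not> t dvd k" if "0 < k" "k < t" for k
    using that zdvd_not_zless by blast
  have "\<bar>height E (j + 1) - height E j\<bar> \<le> 2" if j: "0 \<le> j" "j < int m" for j
  proof -
    have n: "\<not> t dvd 2 * j + 1" "\<not> t dvd j + 1"
      using j m_bounds by (intro ndvd; linarith)+
    have "height E (j + 1) - 2 \<le> height E j"
      using right n by (rule right_edge)
    moreover have "height E j - 2 \<le> height E (j + 1)"
    proof (cases "j = 0")
      case True
      \<comment> \<open>The top bead \<open>- t\<close> of column 0 would only give
        \<open>height E 1 > - 4\<close>. The edge from column -1 into column 0, together with the
        symmetry, gives the required bound -2.\<close>
      have "\<not> t dvd 2 * (- 1) + 1" "\<not> t dvd (- 1)"
        using n True by (auto simp flip: dvd_minus_iff[of t 1])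
      then have "height E (- 1) - 2 \<le> height E (- 1 + 1)"
        by (rule left_edge[OF left])
      then show ?thesis
        using height_uminus[OF central, of 1] by (simp add: True height_0)
    next
      case False
      have "\<not> t dvd j"
        using False j m_bounds by (intro ndvd; linarith)
      then show ?thesis
        using left_edge[OF left n(1)] by simp
    qed
    ultimately show ?thesis
      by linarith
  qed
  then have path: "E \<in> lattice_paths (m - 1) (E m)"
    using supp unfolding lattice_path_iff by simp
  have "\<bar>level E (int m) + int d\<bar> \<le> 2" if odd: "odd t"
  proof -
    have t: "t = 2 * int m + 1"
      using m_bounds odd by (auto simp: even_t_iff)
    have "int s = t - int d" "int (s + 2 * d) = t + int d"
      by (simp_all add: t_def)
    have hm: "height E (int m) = level E (int m)"
      using m_bounds by (intro height_lower) auto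
    have hm': "height E (int m + 1) = - 2 * int d - level E (int m)"
      using height_reflect[OF central, of "int m"] hm t by simp
    define u where "u = (level E (int m) - 1) div 2"
    have u: "2 * u = level E (int m) - 1"
      using odd_level[of E "int m"] by (simp add: u_def)
    define v where "v = (- 2 * int d - level E (int m) - 1) div 2"
    have v: "2 * v = - 2 * int d - level E (int m) - 1"
      using odd_level[of E "int m"] by (simp add: v_def)
    have tm: "t * x = int m * (x * 2) + x" for x
      by (simp add: t algebra_simps)
    \<comment> \<open>The top bead of column \<open>m\<close> is either the exempt point
      \<open>s / 2\<close>, and then the level is \<open>2 - int d\<close>, or it obeys the edge
      condition, which is stronger. The top bead \<open>v\<close> of column \<open>m + 1\<close>
      gives the lower bound in the same way.\<close>
    have "2 * u = 1 - int d" if "2 * (int d * int m + t * u) = int s"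
    proof -
      have "t * (2 * u) = t * (1 - int d)"
        using that \<open>int s = t - int d\<close> tm[of "int d"] by (simp add: algebra_simps)
      then show ?thesis
        using t_gt by simp
    qed
    moreover have "2 * u - 2 < - 2 * int d - level E (int m)"
      if "2 * (int d * int m + t * u) \<noteq> int s"
      using left that u unfolding bar_closed_left_iff by (metis hm hm' less_add_one diff_add_cancel)
    ultimately have "level E (int m) \<le> 2 - int d"
      using u odd_level[of E "int m"] by (smt (verit))
    moreover have "2 * v = 1 - int d" if "2 * (int d * (int m + 1) + t * v) = int (s + 2 * d)"
    proof -
      have "t * (2 * v) = t * (1 - int d)"
        using that \<open>int (s + 2 * d) = t + int d\<close> tm[of "int d"] by (simp add: algebra_simps)
      then show ?thesis
        using t_gt by simp
    qed
    moreover have "2 * v - 2 < level E (int m)"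
      if "2 * (int d * (int m + 1) + t * v) \<noteq> int (s + 2 * d)"
    proof -
      have "2 * v < height E (int m + 1)"
        using v by (simp add: hm')
      then have "2 * v - 2 < height E (int m + 1 - 1)"
        using right that unfolding bar_closed_right_iff by blast
      then show ?thesis
        by (simp add: hm)
    qed
    ultimately show ?thesis
      using v by (smt (verit))
  qed
  then show ?thesis
    using path central by (simp add: good_def)
qed

section \<open>The bijection between bead sets and paths\<close>

lemma column_top:
  assumes M: "symmetric_beads M" and closed: "shift_closed t M"
  obtains h where "\<And>u. int d * j + t * u \<in> M \<longleftrightarrow> u \<le> h"
proof -
  have fin: "finite {z \<in> M. 0 < z}"
    using M by (simp add: symmetric_beads_def)
  obtain b where b: "0 < b" "\<And>z. z \<in> M \<Longrightarrow> z < b"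
  proof (cases "{z \<in> M. 0 < z} = {}")
    case True
    then show ?thesis
      by (intro that[of 1]) force+
  next
    case False
    then show ?thesis
      using Max_in[OF fin] Max_ge[OF fin]
      by (intro that[of "Max {z \<in> M. 0 < z} + 1"]) force+
  qed
  have low: "z \<in> M" if "z \<le> - b" for z
    using symmetric_beads_uminus[OF M, of z] b(1) b(2)[of "- z"] that by fastforce
  \<comment> \<open>Since \<open>t * c \<ge> c\<close>, this bound outweighs the offset
    \<open>int d * j\<close>: a column has no bead from \<open>u = c\<close> upwards and has one at
    \<open>u = - c\<close>.\<close>
  define c where "c = \<bar>int d * j\<bar> + b"
  have c: "c \<le> t * c"
    using t_gt b(1) mult_right_mono[of 1 t c] by (simp add: c_def)
  have top: "u < c" if "int d * j + t * u \<in> M" for u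
  proof (rule ccontr)
    assume "\<not> u < c"
    then have "t * c \<le> t * u"
      using t_gt by simp
    then show False
      using b(2)[OF that] c by (simp add: c_def)
  qed
  have bottom: "int d * j + t * (- c) \<in> M"
  proof (rule low)
    show "int d * j + t * (- c) \<le> - b"
      using c by (simp add: c_def[symmetric]) (simp add: c_def)
  qed
  have down: "int d * j + t * v \<in> M" if "int d * j + t * u \<in> M" "v \<le> u" for u v
    using that(2,1)
  proof (induction rule: int_le_induct)
    case (step i)
    then have "int d * j + t * i - t \<in> M"
      using closed by (simp add: shift_closed_def)
    then show ?case
      by (simp add: algebra_simps)
  qed
  define U where "U = {u \<in> {- c..c}. int d * j + t * u \<in> M}"
  have "finite U"
    by (rule finite_subset[of _ "{- c..c}"]) (auto simp: U_def)
  moreover have "- c \<in> U"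
    using bottom b(1) by (simp add: U_def) (simp add: c_def)
  ultimately have U: "finite U" "- c \<in> U"
    by blast+
  show ?thesis
  proof (rule that)
    fix u
    show "int d * j + t * u \<in> M \<longleftrightarrow> u \<le> Max U"
    proof
      assume u: "int d * j + t * u \<in> M"
      show "u \<le> Max U"
      proof (cases "- c \<le> u")
        case True
        then have "u \<in> U"
          using u top[OF u] by (simp add: U_def)
        then show ?thesis
          using U by simp
      next
        case False
        then show ?thesis
          using Max_ge[OF U] by linarith
      qed
    next
      assume "u \<le> Max U"
      moreover have "Max U \<in> U"
        using U by (intro Max_in) auto
      ultimately show "int d * j + t * u \<in> M"
        using down by (auto simp: U_def)
    qed
  qed
qed

text \<open>For odd \<open>t\<close> these are the bar-cores. For even \<open>t\<close> closure
  under \<open>t\<close> without exemption is stronger, and these are the doubled distinct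
  cores.\<close>

definition bead_family :: "int set set" where
  "bead_family = {M. symmetric_beads M \<and> shift_closed t M \<and> bar_closed (int s) M \<and>
     bar_closed (int (s + 2 * d)) M}"

lemma beads_surj:
  assumes M: "symmetric_beads M" and closed: "shift_closed t M"
  obtains E where "central E" "\<forall>j. j = 0 \<or> m < j \<longrightarrow> E j = 0" "beads E = M"
proof -
  have "\<forall>j. \<exists>h. \<forall>u. int d * j + t * u \<in> M \<longleftrightarrow> u \<le> h"
    using column_top[OF M closed] by metis
  then obtain h where h: "\<And>j u. int d * j + t * u \<in> M \<longleftrightarrow> u \<le> h j"
    by metis
  define E where "E j = (if 1 \<le> j \<and> j \<le> m then h (int j) + int j else 0)" for j
  have level: "level E j = 2 * h j + 1" if "0 < j" "j \<le> int m" for j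
    using that by (auto simp: level_def E_def)
  have zero: "int d * j + t * u \<noteq> 0" if "0 < j" "j < t" for j u
  proof
    assume "int d * j + t * u = 0"
    then have "int d * j = t * (- u)"
      by simp
    then have "t dvd j"
      by (metis dvd_triv_left t_dvd_cancel)
    then show False
      using that zdvd_not_zless by blast
  qed
  have reflect: "h (t - j) = - int d - 1 - h j" if "0 < j" "j < t" for j
  proof -
    have "u \<le> h (t - j) \<longleftrightarrow> \<not> - u - int d \<le> h j" for u
    proof -
      have "int d * (t - j) + t * u = - (int d * j + t * (- u - int d))"
        by (simp add: algebra_simps)
      then show ?thesis
        using symmetric_beads_uminus[OF M zero[OF that, of "- u - int d"]] h by metis
    qed
    from this[of "h (t - j)"] this[of "h (t - j) + 1"] show ?thesis
      by linarith
  qed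
  have central: "central E"
    unfolding central_def
  proof
    assume "even t"
    then have "h (int m) = - int d - 1 - h (int m)"
      using reflect[of "int m"] m_bounds by (simp add: even_t_iff)
    then show "level E (int m) = - int d"
      using level[of "int m"] m_bounds by simp
  qed
  have "2 * u < height E r \<longleftrightarrow> int d * r + t * u \<in> M" if r: "0 \<le> r" "r < t" for r u
  proof -
    consider "r = 0" | "0 < r" "r \<le> int m" | "int m < r"
      using r by linarith
    then show ?thesis
    proof cases
      case 1
      \<comment> \<open>The point 0 is a gap, hence by closure also \<open>t\<close>, and so
        \<open>- t\<close> is a bead: column 0 always ends at \<open>u = - 1\<close>.\<close>
      have "t * u \<in> M \<longleftrightarrow> u < 0"
      proof -
        have "0 \<notin> M"
          using M by (simp add: symmetric_beads_def)
        then have "h 0 < 0"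
          using h[of 0 0] by simp
        moreover have "t * (- 1) \<in> M"
          using h[of 0 1] \<open>h 0 < 0\<close> symmetric_beads_uminus[OF M, of t] t_gt by auto
        then have "- 1 \<le> h 0"
          using h[of 0 "- 1"] by simp
        ultimately show ?thesis
          using h[of 0 u] by auto
      qed
      then show ?thesis
        by (simp add: 1 height_0)
    next
      case 2
      then show ?thesis
        using h[of r u] by (auto simp: height_lower level)
    next
      case 3
      then have "height E r = - 2 * int d - (2 * h (t - r) + 1)"
        using r m_bounds level[of "t - r"] by (simp add: height_upper)
      moreover have "h (t - (t - r)) = - int d - 1 - h (t - r)"
        using r 3 m_bounds by (intro reflect) auto
      ultimately show ?thesis
        using h[of r u] by auto
    qed
  qed
  note reduced = this
  have "z \<in> beads E \<longleftrightarrow> z \<in> M" for z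
  proof -
    obtain j u where z: "z = int d * j + t * u"
      by (rule column_repr)
    define v where "v = u + int d * (j div t)"
    have "int d * j = int d * (j mod t) + int d * ((j div t) * t)"
      by (metis add.commute div_mult_mod_eq distrib_left)
    moreover have "t * v = t * u + int d * ((j div t) * t)"
      by (simp add: v_def algebra_simps)
    ultimately have zv: "z = int d * (j mod t) + t * v"
      unfolding z by linarith
    show ?thesis
      unfolding zv mem_beads using t_gt by (intro reduced) auto
  qed
  then have "beads E = M"
    by blast
  moreover have "\<forall>j. j = 0 \<or> m < j \<longrightarrow> E j = 0"
    by (auto simp: E_def)
  ultimately show ?thesis
    using central by (intro that)
qed

lemma beads_inj:
  assumes "\<forall>j. j = 0 \<or> m < j \<longrightarrow> E j = 0" "\<forall>j. j = 0 \<or> m < j \<longrightarrow> F j = 0" "beads E = beads F"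
  shows "E = F"
proof
  fix j
  show "E j = F j"
  proof (cases "j = 0 \<or> m < j")
    case False
    then have j: "0 < int j" "int j \<le> int m"
      by auto
    have iff: "2 * u < level E (int j) \<longleftrightarrow> 2 * u < level F (int j)" for u
      using mem_beads[of "int j" u E] mem_beads[of "int j" u F] assms(3) height_lower[OF j] by simp
    have "level E (int j) = 2 * (E j - int j) + 1" "level F (int j) = 2 * (F j - int j) + 1"
      by (auto simp: level_def)
    then show ?thesis
      using iffD1[OF iff, of "E j - int j"] iffD2[OF iff, of "F j - int j"] by simp
  qed (use assms in auto)
qed

lemma good_support: "good E \<Longrightarrow> \<forall>j. j = 0 \<or> m < j \<longrightarrow> E j = 0"
  unfolding good_def lattice_path_iff by blast

lemma bij_betw_beads: "bij_betw beads {E. good E} bead_family"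
  unfolding bij_betw_def
proof
  show "inj_on beads {E. good E}"
    by (rule inj_onI) (metis beads_inj good_support mem_Collect_eq)
  show "beads ` {E. good E} = bead_family"
  proof (intro equalityI subsetI)
    fix M assume "M \<in> beads ` {E. good E}"
    then show "M \<in> bead_family"
      using symmetric_beads_beads shift_closed_beads bar_closed_good
      by (auto simp: bead_family_def good_def)
  next
    fix M assume M: "M \<in> bead_family"
    then obtain E where E: "central E" "\<forall>j. j = 0 \<or> m < j \<longrightarrow> E j = 0" "beads E = M"
      using beads_surj[of M] by (auto simp: bead_family_def)
    then have "good E"
      using M by (intro goodI) (auto simp: bead_family_def)
    then show "M \<in> beads ` {E. good E}"
      using E(3) by blast
  qed
qed

lemma card_bead_family:
  assumes "\<And>E. good E \<Longrightarrow> P (beads E) \<longleftrightarrow> Q E"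
  shows "card {M \<in> bead_family. P M} = card {E. good E \<and> Q E}"
proof -
  have "{M \<in> bead_family. P M} = beads ` {E. good E \<and> Q E}"
    unfolding bij_betw_imp_surj_on[OF bij_betw_beads, symmetric] using assms by auto
  moreover have "inj_on beads {E. good E \<and> Q E}"
    by (rule inj_on_subset[OF bij_betw_imp_inj_on[OF bij_betw_beads]]) auto
  ultimately show ?thesis
    by (simp add: card_image)
qed

end

section \<open>Counting cores\<close>

lemma bar_closed_odd: "odd k \<Longrightarrow> bar_closed k M \<longleftrightarrow> shift_closed k M"
  unfolding bar_closed_def shift_closed_def by (metis dvd_triv_left)

lemma shift_closed_iff:
  assumes "symmetric_beads M"
  shows "shift_closed k M \<longleftrightarrow> bar_closed k M \<and> (\<forall>z\<in>M. 2 * z \<noteq> k)"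
proof -
  have "z - k \<notin> M" if "z \<in> M" "2 * z = k" for z
  proof -
    have "z \<noteq> 0"
      using that(1) assms by (auto simp: symmetric_beads_def)
    moreover have "z - k = - z"
      using that(2) by simp
    ultimately show ?thesis
      using symmetric_beads_uminus[OF assms, of z] that(1) by metis
  qed
  then show ?thesis
    unfolding shift_closed_def bar_closed_def by blast
qed

lemma card_BC:
  assumes "0 < a" "0 < b" "0 < c"
  shows "card (BC a b c) = card {M. symmetric_beads M \<and>
    (bar_closed (int a) M \<and> bar_closed (int b) M \<and> bar_closed (int c) M)}"
  unfolding BC_def by (rule card_strict_partitions) (use assms in \<open>simp add: bar_core_iff_bar_closed\<close>)

lemma card_CS:
  assumes "0 < a" "0 < b" "0 < c"
  shows "card (CS a b c) = card {M. symmetric_beads M \<and>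
    ((bar_closed (int a) M \<and> bar_closed (int b) M \<and> bar_closed (int c) M) \<and>
     (\<forall>z\<in>M. 2 * z \<noteq> 3 * int a \<and> 2 * z \<noteq> 3 * int b \<and> 2 * z \<noteq> 3 * int c))}"
  unfolding CS_def by (rule card_strict_partitions) (use assms in \<open>auto simp: csyd_iff_bar_closed\<close>)

lemma card_DD:
  assumes "0 < a" "0 < b" "0 < c"
  shows "card (DD a b c) = card {M. symmetric_beads M \<and>
    (shift_closed (int a) M \<and> shift_closed (int b) M \<and> shift_closed (int c) M)}"
  unfolding DD_def by (rule card_doubled_distinct) (use assms in \<open>simp add: core_iff_shift_closed\<close>)

section \<open>The points s/2 and 3s/2 in terms of paths\<close>

context abacus
begin

lemma int_t: "int (s + d) = t"
  by (simp add: t_def)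

lemma pos: "0 < s" "0 < s + d" "0 < s + 2 * d"
  using s_pos by auto

lemma m_Suc: "Suc (m - 1) = m"
  using m_bounds by simp

lemma card_BC_odd: "odd t \<Longrightarrow> card (BC s (s + d) (s + 2 * d)) = card {E. good E}"
proof -
  assume "odd t"
  then have "card (BC s (s + d) (s + 2 * d)) = card bead_family"
    unfolding card_BC[OF pos] int_t bead_family_def
    by (intro arg_cong[where f = card]) (auto simp: bar_closed_odd)
  then show ?thesis
    using bij_betw_same_card[OF bij_betw_beads] by simp
qed

text \<open>Used with \<open>k = 1\<close> for \<open>s / 2\<close> and \<open>s / 2 + d\<close>,
  and with \<open>k = 3\<close> for the triples of these; the doubled equation avoids
  divisions.\<close>

lemma half_mem:
  assumes "2 * v = k - int d" "2 * z = int d * (2 * j) + t * (k - int d)"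
  shows "z \<in> beads E \<longleftrightarrow> k - int d < height E j"
proof -
  have "2 * z = 2 * (int d * j + t * v)"
    unfolding assms(2) assms(1)[symmetric] by (simp add: algebra_simps)
  then have "z = int d * j + t * v"
    by simp
  then show ?thesis
    using mem_beads[of j v E] assms(1) by simp
qed

lemma ball_half_iff:
  "even k \<Longrightarrow> (\<forall>z\<in>M. 2 * z \<noteq> k) \<longleftrightarrow> k div 2 \<notin> (M :: int set)"
  by (metis dvd_mult_div_cancel nonzero_mult_div_cancel_left zero_neq_numeral)

lemma odd_middle: "odd t \<Longrightarrow> t = 2 * int m + 1"
  using m_bounds by (auto simp: even_t_iff)

lemma good_odd_iff:
  "odd t \<Longrightarrow> good E \<longleftrightarrow> E \<in> lattice_paths (m - 1) (E m) \<and> \<bar>2 * E m - int s + 2\<bar> \<le> 2"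
proof -
  assume "odd t"
  then have "level E (int m) + int d = 2 * E m - int s + 2"
    using odd_middle by (simp add: level_def t_def)
  then show ?thesis
    using \<open>odd t\<close> by (simp add: good_def central_def)
qed

lemma good_even_iff:
  "even t \<Longrightarrow> good E \<longleftrightarrow> E \<in> lattice_paths (m - 1) (E m) \<and> 2 * E m = int s - 1"
proof -
  assume "even t"
  then have "int s = 2 * int m - int d"
    unfolding even_t_iff by (simp add: t_def)
  then have "level E (int m) = - int d \<longleftrightarrow> 2 * E m = int s - 1"
    by (auto simp: level_def)
  then show ?thesis
    using \<open>even t\<close> by (simp add: good_def central_def)
qed

lemma lattice_paths_end: "E \<in> lattice_paths (m - 1) e \<Longrightarrow> E m = e"
  using m_Suc by (auto simp: lattice_paths_def)

text \<open>The two forbidden points lie at \<open>u = (3 - d) / 2\<close> in the columns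
  \<open>m - 1\<close> and \<open>m + 2\<close>. These are mirror images, so the two conditions
  bound the height of column \<open>m - 1\<close> from above and from below.\<close>

lemma card_CS_even_s:
  assumes "even s" "odd d"
  shows "card (CS s (s + d) (s + 2 * d)) =
    card {E. good E \<and> (- int d - 3 \<le> height E (int m - 1) \<and> height E (int m - 1) \<le> 3 - int d)}"
proof -
  have odd: "odd t"
    using assms by (simp add: t_def)
  have "card (CS s (s + d) (s + 2 * d)) = card {M \<in> bead_family.
      3 * int s div 2 \<notin> M \<and> 3 * int (s + 2 * d) div 2 \<notin> M}"
  proof -
    have "(\<forall>z\<in>M. 2 * z \<noteq> 3 * int s \<and> 2 * z \<noteq> 3 * t \<and> 2 * z \<noteq> 3 * int (s + 2 * d)) \<longleftrightarrow>
        3 * int s div 2 \<notin> M \<and> 3 * int (s + 2 * d) div 2 \<notin> M" for M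
    proof -
      have "2 * z \<noteq> 3 * t" for z
        using odd by (metis dvd_triv_left even_mult_iff odd_numeral)
      moreover have "even (3 * int s)" "even (3 * int (s + 2 * d))"
        using assms by simp_all
      ultimately show ?thesis
        using ball_half_iff by blast
    qed
    then show ?thesis
      unfolding card_CS[OF pos] int_t bead_family_def bar_closed_odd[OF odd]
      by (intro arg_cong[where f = card]) auto
  qed
  also have "\<dots> = card {E. good E \<and>
      (- int d - 3 \<le> height E (int m - 1) \<and> height E (int m - 1) \<le> 3 - int d)}"
  proof (rule card_bead_family)
    fix E assume "good E"
    then have central: "central E"
      by (simp add: good_def)
    have S: "int s = t - int d" "int (s + 2 * d) = t + int d"
      by (simp_all add: t_def)
    have T: "t = 2 * int m + 1"
      using odd by (rule odd_middle)
    have tm: "t * x = int m * (x * 2) + x" for x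
      by (simp add: T algebra_simps)
    define v where "v = (3 - int d) div 2"
    have v: "2 * v = 3 - int d"
      using assms by (simp add: v_def)
    have "2 * (3 * int s div 2) = 3 * int s" "2 * (3 * int (s + 2 * d) div 2) = 3 * int (s + 2 * d)"
      using assms by simp_all
    then have "2 * (3 * int s div 2) = int d * (2 * (int m - 1)) + t * (3 - int d)"
      "2 * (3 * int (s + 2 * d) div 2) = int d * (2 * (int m + 2)) + t * (3 - int d)"
      unfolding S using tm[of "int d"] by (simp_all add: algebra_simps)
    then have "3 * int s div 2 \<in> beads E \<longleftrightarrow> 3 - int d < height E (int m - 1)"
      "3 * int (s + 2 * d) div 2 \<in> beads E \<longleftrightarrow> 3 - int d < height E (int m + 2)"
      using half_mem[OF v] by blast+
    moreover have "height E (int m + 2) = - 2 * int d - height E (int m - 1)"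
      using height_reflect[OF central, of "int m - 1"] T by simp
    ultimately show "3 * int s div 2 \<notin> beads E \<and> 3 * int (s + 2 * d) div 2 \<notin> beads E \<longleftrightarrow>
        - int d - 3 \<le> height E (int m - 1) \<and> height E (int m - 1) \<le> 3 - int d"
      by auto
  qed
  finally show ?thesis .
qed

text \<open>Without exemption the middle edge is an ordinary one, so the height \<open>h\<close> of
  column \<open>m\<close> satisfies \<open>|h + d| \<le> 1\<close>. Both numbers are odd, which
  leaves \<open>h = - d\<close>.\<close>

lemma card_DD_even_s:
  assumes "even s" "odd d"
  shows "card (DD s (s + d) (s + 2 * d)) = card {E. good E \<and> 2 * E m = int s - 2}"
proof -
  have odd: "odd t"
    using assms by (simp add: t_def)
  have "card (DD s (s + d) (s + 2 * d)) = card {M \<in> bead_family.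
      int s div 2 \<notin> M \<and> int (s + 2 * d) div 2 \<notin> M}"
  proof -
    have "even (int s)" "even (int (s + 2 * d))"
      using assms by simp_all
    then have "symmetric_beads M \<Longrightarrow> shift_closed (int s) M \<and> shift_closed (int (s + 2 * d)) M \<longleftrightarrow>
        bar_closed (int s) M \<and> bar_closed (int (s + 2 * d)) M \<and>
        int s div 2 \<notin> M \<and> int (s + 2 * d) div 2 \<notin> M" for M
      using shift_closed_iff ball_half_iff by blast
    then show ?thesis
      unfolding card_DD[OF pos] int_t bead_family_def
      by (intro arg_cong[where f = card]) auto
  qed
  also have "\<dots> = card {E. good E \<and> 2 * E m = int s - 2}"
  proof (rule card_bead_family)
    fix E assume "good E"
    then have central: "central E"
      by (simp add: good_def)
    have S: "int s = t - int d" "int (s + 2 * d) = t + int d"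
      by (simp_all add: t_def)
    have T: "t = 2 * int m + 1"
      using odd by (rule odd_middle)
    have tm: "t * x = int m * (x * 2) + x" for x
      by (simp add: T algebra_simps)
    define v where "v = (1 - int d) div 2"
    have v: "2 * v = 1 - int d"
      using assms by (simp add: v_def)
    have "2 * (int s div 2) = int s" "2 * (int (s + 2 * d) div 2) = int (s + 2 * d)"
      using assms by simp_all
    then have "2 * (int s div 2) = int d * (2 * int m) + t * (1 - int d)"
      "2 * (int (s + 2 * d) div 2) = int d * (2 * (int m + 1)) + t * (1 - int d)"
      unfolding S using tm[of "int d"] by (simp_all add: algebra_simps)
    then have "int s div 2 \<in> beads E \<longleftrightarrow> 1 - int d < height E (int m)"
      "int (s + 2 * d) div 2 \<in> beads E \<longleftrightarrow> 1 - int d < height E (int m + 1)"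
      using half_mem[OF v] by blast+
    moreover have "height E (int m + 1) = - 2 * int d - height E (int m)"
      using height_reflect[OF central, of "int m"] T by simp
    moreover have "height E (int m) = 2 * E m - 2 * int m + 1"
      using m_bounds by (simp add: height_lower level_def)
    moreover obtain k where k: "int d = 2 * k + 1"
      using assms by (metis even_of_nat oddE)
    ultimately have "int s div 2 \<in> beads E \<longleftrightarrow> int m - k \<le> E m"
      "int (s + 2 * d) div 2 \<in> beads E \<longleftrightarrow> E m < int m - k - 1"
      by auto
    moreover have "2 * E m = int s - 2 \<longleftrightarrow> E m = int m - k - 1"
      using T S(1) k by auto
    ultimately show "int s div 2 \<notin> beads E \<and> int (s + 2 * d) div 2 \<notin> beads E \<longleftrightarrow>
        2 * E m = int s - 2"
      by auto
  qed
  finally show ?thesis .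
qed

end

text \<open>
  For odd \<open>k\<close> and even \<open>t = 2 c\<close>, a set with \<open>c\<close> becomes closed under subtracting \<open>t\<close> when \<open>c\<close> is
  exchanged for \<open>- c\<close>.
\<close>

locale half_bead =
  fixes M :: "int set" and c :: int
  assumes sym: "symmetric_beads M" and c_pos: "0 < c"
    and bar_t: "bar_closed (2 * c) M" and c_mem: "c \<in> M"
begin

lemma uminus: "z \<noteq> 0 \<Longrightarrow> - z \<in> M \<longleftrightarrow> z \<notin> M"
  using sym by (rule symmetric_beads_uminus)

lemma zero: "0 \<notin> M"
  using sym by (simp add: symmetric_beads_def)

lemma bar_tD: "z \<in> M \<Longrightarrow> z \<noteq> c \<Longrightarrow> z - 2 * c \<in> M"
  using bar_t by (auto simp: bar_closed_def)

lemma below: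
  assumes "odd k" "bar_closed k M"
  shows "c - k \<in> M"
  using assms c_mem by (simp add: bar_closed_odd shift_closed_def)

text \<open>A bead \<open>c + k\<close> would descend by \<open>2 * c\<close> to the mirror image of
  the bead \<open>c - k\<close>.\<close>

lemma above:
  assumes k: "odd k" "bar_closed k M"
  shows "c + k \<notin> M"
proof
  assume "c + k \<in> M"
  moreover have "c + k \<noteq> c"
    using k(1) by auto
  ultimately have "- (c - k) \<in> M"
    using bar_tD[of "c + k"] by (simp add: algebra_simps)
  then show False
    using below[OF k] uminus[of "c - k"] zero by (cases "c - k = 0") auto
qed

text \<open>The mirror image of \<open>3 * c - k\<close> is \<open>c - l\<close>, a bead by
  \<open>below\<close>; so \<open>3 * c - k\<close>, and with it \<open>3 * c\<close>, is a
  gap.\<close>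

lemma triple:
  assumes k: "odd k" "bar_closed k M" and l: "odd l" "bar_closed l M" and kl: "k + l = 4 * c"
  shows "3 * c \<notin> M"
proof
  assume "3 * c \<in> M"
  then have "3 * c - k \<in> M"
    using k by (simp add: bar_closed_odd shift_closed_def)
  moreover have "c - l = - (3 * c - k)"
    using kl by simp
  ultimately show False
    using below[OF l] uminus[of "3 * c - k"] zero by (cases "3 * c - k = 0") auto
qed

end

lemma symmetric_beads_flip:
  assumes M: "symmetric_beads M" and c: "c \<in> M"
  shows "symmetric_beads (insert (- c) (M - {c}))"
proof -
  have "c \<noteq> 0"
    using assms by (auto simp: symmetric_beads_def)
  moreover from this have "- c \<notin> M"
    using symmetric_beads_uminus[OF M, of c] c by simp
  moreover have "finite {z \<in> insert (- c) (M - {c}). 0 < z}"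
    by (rule finite_subset[of _ "insert (- c) {z \<in> M. 0 < z}"])
      (use M in \<open>auto simp: symmetric_beads_def\<close>)
  ultimately show ?thesis
    using M by (auto simp: symmetric_beads_def)
qed

context abacus
begin

definition bar_family :: "int set set" where
  "bar_family = {M. symmetric_beads M \<and> bar_closed (int s) M \<and> bar_closed t M \<and>
     bar_closed (int (s + 2 * d)) M}"

text \<open>Reinserting \<open>c\<close> keeps closure under an odd \<open>k\<close> only if
  \<open>c - k\<close> is a bead, which explains the two conditions on the image. Conversely
  \<open>below\<close> and \<open>above\<close> ensure them and the closure at
  \<open>- c\<close>.\<close>

lemma bij_betw_flip:
  assumes t: "even t"
  defines "c \<equiv> int m"
  shows "bij_betw (\<lambda>M. insert (- c) (M - {c})) {M \<in> bar_family. c \<in> M}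
    {M \<in> bead_family. c - int s \<in> M \<and> c - int (s + 2 * d) \<in> M}"
proof (rule bij_betw_byWitness[where f' = "\<lambda>M. insert c (M - {- c})"])
  have tc: "t = 2 * c" and c: "0 < c"
    using t m_bounds by (auto simp: even_t_iff c_def)
  have "odd d"
    using t coprime_s_d by (auto simp: t_def)
  then have odd: "odd (int s)" "odd (int (s + 2 * d))"
    using t by (auto simp: t_def)
  have kl: "int s + int (s + 2 * d) = 4 * c"
    using tc by (simp add: t_def)
  have ne: "int s \<noteq> 2 * c" "int (s + 2 * d) \<noteq> 2 * c"
    using odd by (metis dvd_triv_left)+
  have half: "half_bead M c" if "M \<in> bar_family" "c \<in> M" for M
    using that c tc by unfold_locales (auto simp: bar_family_def)
  show "\<forall>M\<in>{M \<in> bar_family. c \<in> M}. insert c (insert (- c) (M - {c}) - {- c}) = M"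
  proof
    fix M assume "M \<in> {M \<in> bar_family. c \<in> M}"
    then have "c \<in> M" "- c \<notin> M"
      using half_bead.uminus[OF half, of M c] c by auto
    then show "insert c (insert (- c) (M - {c}) - {- c}) = M"
      using c by auto
  qed
  have not_c: "c \<notin> M" "- c \<in> M" if "M \<in> bead_family" for M
  proof -
    have sym: "symmetric_beads M" and closed: "shift_closed t M"
      using that by (auto simp: bead_family_def)
    have "\<forall>z\<in>M. 2 * z \<noteq> t"
      using closed shift_closed_iff[OF sym] by blast
    then show "c \<notin> M"
      using tc by auto
    then show "- c \<in> M"
      using symmetric_beads_uminus[OF sym, of c] c by simp
  qed
  show "\<forall>M\<in>{M \<in> bead_family. c - int s \<in> M \<and> c - int (s + 2 * d) \<in> M}.
      insert (- c) (insert c (M - {- c}) - {c}) = M"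
    using not_c c by auto
  show "(\<lambda>M. insert (- c) (M - {c})) ` {M \<in> bar_family. c \<in> M}
      \<subseteq> {M \<in> bead_family. c - int s \<in> M \<and> c - int (s + 2 * d) \<in> M}"
  proof
    fix N assume "N \<in> (\<lambda>M. insert (- c) (M - {c})) ` {M \<in> bar_family. c \<in> M}"
    then obtain M where M: "M \<in> bar_family" "c \<in> M" and N: "N = insert (- c) (M - {c})"
      by auto
    interpret half_bead M c
      using M by (rule half)
    have bars: "bar_closed (int s) M" "bar_closed (int (s + 2 * d)) M"
      using M by (auto simp: bar_family_def)
    \<comment> \<open>The new bead \<open>- c\<close> must descend to \<open>- 3 * c\<close>; here
      the relation between the two outer moduli, whose sum is \<open>2 * t\<close>, enters.\<close>
    note 3 = triple[OF odd(1) bars(1) odd(2) bars(2) kl]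
    have "shift_closed t N"
      unfolding shift_closed_def
    proof
      fix z assume "z \<in> N"
      then consider "z = - c" | "z \<in> M" "z \<noteq> c"
        by (auto simp: N)
      then show "z - t \<in> N"
      proof cases
        case 1
        have "- (3 * c) \<in> M"
          using uminus[of "3 * c"] 3 c by simp
        then show ?thesis
          using 1 c by (simp add: N tc)
      next
        case 2
        then have "z - t \<in> M"
          using bar_tD tc by simp
        moreover have "z - t \<noteq> c"
        proof
          assume "z - t = c"
          then have "z = 3 * c"
            using tc by simp
          then show False
            using 3 2 by simp
        qed
        ultimately show ?thesis
          by (simp add: N)
      qed
    qed
    moreover have "bar_closed k N \<and> c - k \<in> N" if k: "odd k" "bar_closed k M" for k
    proof
      have "k \<noteq> 0"
        using k(1) by auto
      show "c - k \<in> N"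
        using below[OF k] \<open>k \<noteq> 0\<close> by (simp add: N)
      show "bar_closed k N"
        unfolding bar_closed_odd[OF k(1)] shift_closed_def
      proof
        fix z assume "z \<in> N"
        then consider "z = - c" | "z \<in> M" "z \<noteq> c"
          by (auto simp: N)
        then show "z - k \<in> N"
        proof cases
          case 1
          have "- (c + k) \<in> M"
          proof (cases "c + k = 0")
            case True
            then have "c - k = 2 * c"
              by simp
            then have "2 * c \<in> M"
              using below[OF k] by metis
            then have "2 * c - 2 * c \<in> M"
              using bar_tD[of "2 * c"] c_pos by simp
            then show ?thesis
              using zero by simp
          qed (use above[OF k] uminus in blast)
          moreover have "- (c + k) \<noteq> c"
          proof
            assume "- (c + k) = c"
            then have "k = 2 * (- c)"
              by simp
            then show False
              using k(1) by simp
          qed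
          ultimately show ?thesis
            using 1 by (simp add: N)
        next
          case 2
          then have "z - k \<in> M"
            using k by (simp add: bar_closed_odd shift_closed_def)
          moreover have "z - k \<noteq> c"
          proof
            assume "z - k = c"
            then have "z = c + k"
              by simp
            then show False
              using above[OF k] 2 by simp
          qed
          ultimately show ?thesis
            by (simp add: N)
        qed
      qed
    qed
    ultimately show "N \<in> {M \<in> bead_family. c - int s \<in> M \<and> c - int (s + 2 * d) \<in> M}"
      using symmetric_beads_flip[OF sym c_mem] odd bars unfolding bead_family_def N by blast
  qed
  show "(\<lambda>M. insert c (M - {- c})) ` {M \<in> bead_family. c - int s \<in> M \<and> c - int (s + 2 * d) \<in> M}
      \<subseteq> {M \<in> bar_family. c \<in> M}"
  proof
    fix N assume "N \<in> (\<lambda>M. insert c (M - {- c})) `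
      {M \<in> bead_family. c - int s \<in> M \<and> c - int (s + 2 * d) \<in> M}"
    then obtain M where M: "M \<in> bead_family" "c - int s \<in> M" "c - int (s + 2 * d) \<in> M"
      and N: "N = insert c (M - {- c})"
      by auto
    have sym: "symmetric_beads M" and closed: "shift_closed t M"
      and bars: "bar_closed (int s) M" "bar_closed (int (s + 2 * d)) M"
      using M by (auto simp: bead_family_def)
    have "bar_closed t N"
      unfolding bar_closed_def
    proof (intro ballI impI)
      fix z assume "z \<in> N" "2 * z \<noteq> t"
      then have z: "z \<in> M" "z \<noteq> - c" "z \<noteq> c"
        by (auto simp: N tc)
      then have "z - t \<in> M" "z - t \<noteq> - c"
        using closed tc by (auto simp: shift_closed_def)
      then show "z - t \<in> N"
        by (simp add: N)
    qed
    moreover have "bar_closed k N" if k: "odd k" "bar_closed k M" "c - k \<in> M" for k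
      unfolding bar_closed_odd[OF k(1)] shift_closed_def
    proof
      fix z assume "z \<in> N"
      then consider "z = c" | "z \<in> M" "z \<noteq> - c"
        by (auto simp: N)
      then show "z - k \<in> N"
      proof cases
        case 1
        have "c - k \<noteq> - c"
          using k(1) by auto
        then show ?thesis
          using 1 k(3) by (simp add: N)
      next
        case 2
        then have "z - k \<in> M"
          using k by (simp add: bar_closed_odd shift_closed_def)
        moreover have "z - k \<noteq> - c"
        proof
          assume "z - k = - c"
          then have "z = - (c - k)"
            by simp
          then have "- (c - k) \<in> M"
            using 2 by metis
          moreover have "c - k \<noteq> 0"
            using k(3) sym by (metis symmetric_beads_def)
          ultimately show False
            using symmetric_beads_uminus[OF sym, of "c - k"] k(3) by simp
        qed
        ultimately show ?thesis
          by (simp add: N)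
      qed
    qed
    moreover have "symmetric_beads N"
      using symmetric_beads_flip[OF sym not_c(2)[OF M(1)]] by (simp add: N)
    ultimately show "N \<in> {M \<in> bar_family. c \<in> M}"
      using odd bars M unfolding bar_family_def N by blast
  qed
qed

text \<open>The outer moduli are odd, so only \<open>3 * t / 2\<close> could separate CSYDs from
  bar-cores. As a bead it would force \<open>t / 2\<close> to be one, and \<open>triple\<close>
  excludes that.\<close>

lemma card_BC_CS_even:
  assumes "even t"
  shows "card (BC s (s + d) (s + 2 * d)) = card bar_family"
    "card (CS s (s + d) (s + 2 * d)) = card bar_family"
    "card (DD s (s + d) (s + 2 * d)) = card bead_family"
proof -
  have "odd d"
    using assms coprime_s_d by (auto simp: t_def)
  then have odd: "odd (int s)" "odd (int (s + 2 * d))"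
    using assms by (auto simp: t_def)
  have tm: "t = 2 * int m"
    using assms by (simp add: even_t_iff)
  show "card (BC s (s + d) (s + 2 * d)) = card bar_family"
    unfolding card_BC[OF pos] int_t bar_family_def by (simp add: conj_ac)
  have "2 * z \<noteq> 3 * int s \<and> 2 * z \<noteq> 3 * t \<and> 2 * z \<noteq> 3 * int (s + 2 * d)"
    if M: "M \<in> bar_family" "z \<in> M" for z M
  proof -
    have "2 * z \<noteq> 3 * k" if "odd k" for k
      using that by (metis dvd_triv_left even_mult_iff odd_numeral)
    moreover have "2 * z \<noteq> 3 * t"
    proof
      assume "2 * z = 3 * t"
      then have z: "z = 3 * int m"
        using tm by simp
      have "z - t \<in> M"
        using M z tm m_bounds by (auto simp: bar_family_def bar_closed_def)
      then have "int m \<in> M"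
        by (simp add: z tm)
      then interpret half_bead M "int m"
        using M m_bounds tm by unfold_locales (auto simp: bar_family_def)
      have "3 * int m \<notin> M"
      proof (rule triple[OF odd(1) _ odd(2)])
        show "bar_closed (int s) M" "bar_closed (int (s + 2 * d)) M"
          using M by (auto simp: bar_family_def)
        show "int s + int (s + 2 * d) = 4 * int m"
          using tm by (simp add: t_def)
      qed
      then show False
        using M z by simp
    qed
    ultimately show ?thesis
      using odd by blast
  qed
  then have *: "bar_family = {M. symmetric_beads M \<and>
      ((bar_closed (int s) M \<and> bar_closed t M \<and> bar_closed (int (s + 2 * d)) M) \<and>
      (\<forall>z\<in>M. 2 * z \<noteq> 3 * int s \<and> 2 * z \<noteq> 3 * t \<and> 2 * z \<noteq> 3 * int (s + 2 * d)))}"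
    unfolding bar_family_def by blast
  show "card (CS s (s + d) (s + 2 * d)) = card bar_family"
    unfolding card_CS[OF pos] int_t * ..
  show "card (DD s (s + d) (s + 2 * d)) = card bead_family"
    unfolding card_DD[OF pos] int_t bead_family_def bar_closed_odd[OF odd(1)]
      bar_closed_odd[OF odd(2)] by (intro arg_cong[where f = card]) auto
qed

lemma finite_good: "finite {E. good E}"
proof (rule finite_subset)
  show "{E. good E} \<subseteq> (\<Union>e\<in>{- int s - t..int s + t}. lattice_paths (m - 1) e)"
  proof
    fix E assume "E \<in> {E. good E}"
    then have E: "E \<in> lattice_paths (m - 1) (E m)" "\<bar>2 * E m - int s + 2\<bar> \<le> 2"
      using good_odd_iff good_even_iff by fastforce+
    then show "E \<in> (\<Union>e\<in>{- int s - t..int s + t}. lattice_paths (m - 1) e)"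
      using t_gt by (intro UN_I[of "E m"]) auto
  qed
qed simp

text \<open>Sets without \<open>t / 2\<close> are fully closed under \<open>t\<close>; the others
  are flipped. The two beads required after the flip push the heights of both neighbours of column
  \<open>m\<close> above \<open>- 1 - int d\<close>; these heights add up to
  \<open>- 2 * int d\<close>, so both are \<open>- int d\<close>.\<close>

lemma card_bar_family_even:
  assumes t: "even t"
  shows "card bar_family = card {E. good E} + card {E. good E \<and> height E (int m - 1) = - int d}"
proof -
  have tm: "t = 2 * int m"
    using t by (simp add: even_t_iff)
  have "odd d"
    using t coprime_s_d by (auto simp: t_def)
  have "{M \<in> bar_family. int m \<notin> M} = bead_family"
  proof -
    have "symmetric_beads M \<Longrightarrow> shift_closed t M \<longleftrightarrow> bar_closed t M \<and> int m \<notin> M" for M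
      using shift_closed_iff[of M t] by (auto simp: tm)
    then show ?thesis
      unfolding bar_family_def bead_family_def by auto
  qed
  moreover have fin: "finite bead_family"
    using bij_betw_finite[OF bij_betw_beads] finite_good by simp
  moreover have "finite {M \<in> bar_family. int m \<in> M}"
    using bij_betw_finite[OF bij_betw_flip[OF t]] fin by simp
  moreover have "bar_family = {M \<in> bar_family. int m \<notin> M} \<union> {M \<in> bar_family. int m \<in> M}"
    by blast
  ultimately have "card bar_family = card bead_family + card {M \<in> bar_family. int m \<in> M}"
    by (metis (no_types, lifting) card_Un_disjoint disjoint_iff mem_Collect_eq)
  also have "card {M \<in> bar_family. int m \<in> M} =
      card {M \<in> bead_family. int m - int s \<in> M \<and> int m - int (s + 2 * d) \<in> M}"
    by (rule bij_betw_same_card[OF bij_betw_flip[OF t]])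
  also have "\<dots> = card {E. good E \<and> height E (int m - 1) = - int d}"
  proof (rule card_bead_family)
    fix E assume "good E"
    then have central: "central E"
      by (simp add: good_def)
    define v where "v = (- 1 - int d) div 2"
    have v: "2 * v = - 1 - int d"
      using \<open>odd d\<close> by (simp add: v_def)
    have "int m - int s = int d * (int m + 1) + t * v"
      "int m - int (s + 2 * d) = int d * (int m - 1) + t * v"
    proof -
      have "t * v = int m * (2 * v)"
        by (simp add: tm)
      then have "t * v = - int m - int d * int m"
        unfolding v by (simp add: algebra_simps)
      moreover have "int s = 2 * int m - int d"
        using tm by (simp add: t_def)
      ultimately show "int m - int s = int d * (int m + 1) + t * v"
        "int m - int (s + 2 * d) = int d * (int m - 1) + t * v"
        by (simp_all add: algebra_simps)
    qed
    then have "int m - int s \<in> beads E \<longleftrightarrow> - 1 - int d < height E (int m + 1)"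
      "int m - int (s + 2 * d) \<in> beads E \<longleftrightarrow> - 1 - int d < height E (int m - 1)"
      using v by (simp_all only: mem_beads)
    moreover have "height E (int m + 1) = - 2 * int d - height E (int m - 1)"
      using height_reflect[OF central, of "int m - 1"] by (simp add: tm)
    ultimately show "int m - int s \<in> beads E \<and> int m - int (s + 2 * d) \<in> beads E \<longleftrightarrow>
        height E (int m - 1) = - int d"
      by auto
  qed
  finally show ?thesis
    using bij_betw_same_card[OF bij_betw_beads] by simp
qed

section \<open>Evaluation for the different parities\<close>

lemma card_good:
  assumes "\<And>E. good E \<longleftrightarrow> E \<in> lattice_paths (m - 1) (E m) \<and> E m \<in> A" "finite A"
  shows "card {E. good E \<and> Q E} = (\<Sum>e\<in>A. card {E \<in> lattice_paths (m - 1) e. Q E})"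
proof -
  have "good E \<and> Q E \<longleftrightarrow> (\<exists>e\<in>A. E \<in> lattice_paths (m - 1) e \<and> Q E)" for E
    using assms(1) lattice_paths_end by metis
  then have "{E. good E \<and> Q E} = (\<Union>e\<in>A. {E \<in> lattice_paths (m - 1) e. Q E})"
    by auto
  moreover have "card (\<Union>e\<in>A. {E \<in> lattice_paths (m - 1) e. Q E}) =
      (\<Sum>e\<in>A. card {E \<in> lattice_paths (m - 1) e. Q E})"
    using assms(2)
  proof (rule card_UN_disjoint)
    show "\<forall>e\<in>A. finite {E \<in> lattice_paths (m - 1) e. Q E}"
      by simp
    show "\<forall>e\<in>A. \<forall>e'\<in>A. e \<noteq> e' \<longrightarrow>
        {E \<in> lattice_paths (m - 1) e. Q E} \<inter> {E \<in> lattice_paths (m - 1) e'. Q E} = {}"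
      using lattice_paths_disjoint by blast
  qed
  ultimately show ?thesis
    by simp
qed

text \<open>All moduli are odd, so there are no exempt or forbidden points and the three conditions
  agree. The two ends \<open>(s - 1) / 2\<close> and \<open>(s - 3) / 2\<close> amount to one final
  step from 0 and 1.\<close>

lemma card_all_odd:
  assumes "odd s" "even d"
  shows "card (BC s (s + d) (s + 2 * d)) =
      shifted_path_number (m - 1) 1 ((s - 1) div 2)"
    "card (CS s (s + d) (s + 2 * d)) = card (BC s (s + d) (s + 2 * d))"
    "card (DD s (s + d) (s + 2 * d)) = card (BC s (s + d) (s + 2 * d))"
proof -
  have odd: "odd (int s)" "odd (int (s + d))" "odd (int (s + 2 * d))"
    using assms by simp_all
  have three: "2 * z \<noteq> 3 * k" if "odd k" for z k :: int
    using that by (metis dvd_triv_left even_mult_iff odd_numeral)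
  show "card (CS s (s + d) (s + 2 * d)) = card (BC s (s + d) (s + 2 * d))"
    unfolding card_CS[OF pos] card_BC[OF pos] using odd[THEN three] by simp
  show "card (DD s (s + d) (s + 2 * d)) = card (BC s (s + d) (s + 2 * d))"
    unfolding card_DD[OF pos] card_BC[OF pos] odd[THEN bar_closed_odd] ..
  have t: "odd t"
    using assms by (simp add: t_def)
  define \<sigma> where "\<sigma> = int ((s - 1) div 2)"
  have \<sigma>: "int s = 2 * \<sigma> + 1"
    using assms by (auto simp: \<sigma>_def elim!: oddE)
  have "good E \<longleftrightarrow> E \<in> lattice_paths (m - 1) (E m) \<and> E m \<in> {\<sigma>, \<sigma> - 1}" for E
    unfolding good_odd_iff[OF t] \<sigma> by auto
  from card_good[OF this, of "\<lambda>_. True"] show "card (BC s (s + d) (s + 2 * d)) =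
      shifted_path_number (m - 1) 1 ((s - 1) div 2)"
    unfolding shifted_path_number_1 card_BC_odd[OF t] by (simp add: \<sigma>_def)
qed

lemma good_even_s:
  assumes "even s" "odd d"
  shows "good E \<longleftrightarrow> E \<in> lattice_paths (m - 1) (E m) \<and>
    E m \<in> {int (s div 2), int (s div 2) - 1, int (s div 2) - 2}"
proof -
  have "odd t"
    using assms by (simp add: t_def)
  moreover have "int s = 2 * int (s div 2)"
    using assms(1) by (auto elim!: evenE)
  ultimately show ?thesis
    unfolding good_odd_iff[OF \<open>odd t\<close>] by auto
qed

lemma m_even_s:
  assumes "even s" "odd d"
  shows "s + d = 2 * m + 1" "m = s div 2 + (d - 1) div 2"
  using assms by (auto simp: m_def elim!: evenE oddE)

text \<open>The three ends are exactly the values from which one further step reaches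
  \<open>s div 2\<close>.\<close>

lemma card_BC_even_s:
  assumes "even s" "odd d"
  shows "card (BC s (s + d) (s + 2 * d)) = path_number m (s div 2)"
proof -
  have t: "odd t"
    using assms by (simp add: t_def)
  have "card {E. good E} = card (lattice_paths m (int (s div 2)))"
    using card_good[OF good_even_s[OF assms], of "\<lambda>_. True"]
      card_lattice_paths_Suc[of "m - 1" "int (s div 2)"] unfolding m_Suc by simp
  then show ?thesis
    unfolding card_BC_odd[OF t] card_lattice_paths_pos .
qed

lemma card_DD_even_s_formula:
  assumes "even s" "odd d"
  shows "card (DD s (s + d) (s + 2 * d)) = path_number (m - 1) ((s - 1) div 2)"
proof -
  define \<sigma> where "\<sigma> = int (s div 2)"
  have s: "int s = 2 * \<sigma>"
    using assms(1) by (auto simp: \<sigma>_def elim!: evenE)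
  have \<sigma>: "\<sigma> - 1 = int ((s - 1) div 2)"
    using assms(1) s_pos by (auto simp: \<sigma>_def elim!: evenE)
  have "card (DD s (s + d) (s + 2 * d)) =
      (\<Sum>e\<in>{\<sigma>, \<sigma> - 1, \<sigma> - 2}. card {E \<in> lattice_paths (m - 1) e. 2 * E m = int s - 2})"
    unfolding card_DD_even_s[OF assms] \<sigma>_def using good_even_s[OF assms] by (intro card_good) auto
  also have "\<dots> = (\<Sum>e\<in>{\<sigma>, \<sigma> - 1, \<sigma> - 2}. if e = \<sigma> - 1 then card (lattice_paths (m - 1) e) else 0)"
  proof (rule sum.cong)
    fix e
    have "{E \<in> lattice_paths (m - 1) e. 2 * E m = int s - 2} =
        (if e = \<sigma> - 1 then lattice_paths (m - 1) e else {})"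
    proof -
      have "2 * E m = int s - 2 \<longleftrightarrow> e = \<sigma> - 1" if "E \<in> lattice_paths (m - 1) e" for E
        using lattice_paths_end[OF that] s by auto
      then show ?thesis
        by auto
    qed
    then show "card {E \<in> lattice_paths (m - 1) e. 2 * E m = int s - 2} =
        (if e = \<sigma> - 1 then card (lattice_paths (m - 1) e) else 0)"
      by simp
  qed simp
  also have "\<dots> = path_number (m - 1) ((s - 1) div 2)"
    using \<sigma> by (simp add: card_lattice_paths)
  finally show ?thesis .
qed

lemma height_before_last: "2 \<le> m \<Longrightarrow> height E (int m - 1) = 2 * E (m - 1) - 2 * int m + 3"
  using height_lower[of "int m - 1" E] by (simp add: level_def nat_diff_distrib)

lemma card_CS_even_s_formula:
  assumes "even s" "odd d"
  shows "card (CS s (s + d) (s + 2 * d)) =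
    shifted_path_number (m - 1) 0 ((s - 2) div 2) + shifted_path_number (m - 2) 2 ((s - 2) div 2)"
proof (cases "2 \<le> m")
  case True
  define n where "n = m - 2"
  have n: "m = Suc (Suc n)"
    using True by (simp add: n_def)
  define \<sigma> where "\<sigma> = int (s div 2)"
  have s: "int s = 2 * \<sigma>"
    using assms(1) by (auto simp: \<sigma>_def elim!: evenE)
  have \<sigma>: "int ((s - 2) div 2) = \<sigma> - 1"
    using assms(1) s_pos by (auto simp: \<sigma>_def elim!: evenE)
  have "int s + int d = 2 * int m + 1"
    using m_even_s(1)[OF assms] by linarith
  then have bounds: "(- int d - 3 \<le> height E (int m - 1) \<and> height E (int m - 1) \<le> 3 - int d) \<longleftrightarrow>
      E (m - 1) \<in> {\<sigma> - 3, \<sigma> - 2, \<sigma> - 1}" for E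
    unfolding height_before_last[OF True] using s by auto
  have "card (CS s (s + d) (s + 2 * d)) = (\<Sum>e\<in>{\<sigma>, \<sigma> - 1, \<sigma> - 2}.
      card {E \<in> lattice_paths (m - 1) e. E (m - 1) \<in> {\<sigma> - 3, \<sigma> - 2, \<sigma> - 1}})"
    unfolding card_CS_even_s[OF assms] bounds \<sigma>_def
    using good_even_s[OF assms] by (intro card_good) auto
  also have "\<dots> = (\<Sum>e\<in>{\<sigma>, \<sigma> - 1, \<sigma> - 2}. \<Sum>v\<in>{e, e - 1, e - 2}.
      if v \<in> {\<sigma> - 3, \<sigma> - 2, \<sigma> - 1} then card (lattice_paths n v) else 0)"
    unfolding n diff_Suc_1 by (intro sum.cong refl card_lattice_paths_through)
  \<comment> \<open>The end \<open>\<sigma> - 1\<close> admits all three previous values and gives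
    the first term. The ends \<open>\<sigma>\<close> and \<open>\<sigma> - 2\<close> admit two each,
    so \<open>\<sigma> - 1\<close>, \<open>\<sigma> - 2\<close>, \<open>\<sigma> - 3\<close> occur
    with weights 1, 2, 1, as for two steps from 0 and 1.\<close>
  also have "\<dots> = card (lattice_paths (Suc n) (\<sigma> - 1)) + shifted_path_number n 2 ((s - 2) div 2)"
    unfolding shifted_path_number_2 \<sigma> by (simp add: card_lattice_paths_Suc)
  finally show ?thesis
    unfolding shifted_path_number_0 by (simp add: n \<sigma>[symmetric] card_lattice_paths_pos)
next
  \<comment> \<open>Only \<open>s = 2\<close>, \<open>d = 1\<close> remains. The column before the
    last is column 0, whose height satisfies the bounds, and both terms of the formula are
    1.\<close>
  case False
  then have m: "m = 1"
    using m_bounds by simp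
  then have "s + d = 3"
    using m_even_s(1)[OF assms] by simp
  then have sd: "s = 2" "d = 1"
    using assms s_pos d_pos by presburger+
  have "height E (int m - 1) = 0" for E
    by (simp add: m height_0)
  moreover have "odd t"
    using assms by (simp add: t_def)
  moreover have "int d = 1" "s div 2 = Suc 0" "(s - 2) div 2 = 0"
    using sd by simp_all
  ultimately have "card (CS s (s + d) (s + 2 * d)) = card {E. good E}"
    unfolding card_CS_even_s[OF assms] by simp
  also have "\<dots> = path_number 1 (Suc 0)"
    using card_BC_even_s[OF assms] card_BC_odd[OF \<open>odd t\<close>] \<open>s div 2 = Suc 0\<close> m by simp
  also have "\<dots> = 2"
    using path_number_Suc_1[of 0] by (simp add: path_number_0)
  finally show ?thesis
    unfolding m \<open>(s - 2) div 2 = 0\<close> by (simp add: shifted_path_number_def)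
qed

lemma both_odd:
  assumes "odd s" "odd d"
  shows "good E \<longleftrightarrow> E \<in> lattice_paths (m - 1) (E m) \<and> E m \<in> {int ((s - 1) div 2)}"
    "even t" "s + d = 2 * m" "m = (s - 1) div 2 + (d - 1) div 2 + 1"
proof -
  show t: "even t"
    using assms by (simp add: t_def)
  show "s + d = 2 * m" "m = (s - 1) div 2 + (d - 1) div 2 + 1"
    using assms by (auto simp: m_def elim!: oddE)
  have "int s = 2 * int ((s - 1) div 2) + 1"
    using assms by (auto elim!: oddE)
  then show "good E \<longleftrightarrow> E \<in> lattice_paths (m - 1) (E m) \<and> E m \<in> {int ((s - 1) div 2)}"
    unfolding good_even_iff[OF t] by auto
qed

lemma card_good_both_odd:
  assumes "odd s" "odd d"
  shows "card {E. good E} = path_number (m - 1) ((s - 1) div 2)"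
  using card_good[OF both_odd(1)[OF assms], of "\<lambda>_. True"] by (simp add: card_lattice_paths_pos)

text \<open>Heights \<open>- int d\<close> in the last two columns mean that the last step goes from
  \<open>E (m - 1)\<close>, one less than the end, to the end. For \<open>m = 1\<close> the column
  before is column 0 of height 0, so nothing is added; this is the case
  \<open>s = d = 1\<close>.\<close>

lemma card_bar_family_both_odd:
  assumes "odd s" "odd d"
  shows "card bar_family = path_number (m - 1) ((s - 1) div 2) +
    (if m = 1 then 0 else card (lattice_paths (m - 2) (int ((s - 1) div 2) - 1)))"
proof -
  define \<sigma> where "\<sigma> = int ((s - 1) div 2)"
  have "card {E. good E \<and> height E (int m - 1) = - int d} =
      (if m = 1 then 0 else card (lattice_paths (m - 2) (\<sigma> - 1)))"
  proof (cases "m = 1")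
    case True
    then show ?thesis
      using d_pos by (simp add: height_0)
  next
    case False
    then have m: "2 \<le> m"
      using m_bounds by simp
    define n where "n = m - 2"
    have n: "m = Suc (Suc n)"
      using m by (simp add: n_def)
    have "int s = 2 * \<sigma> + 1" "int s + int d = 2 * int m"
      using assms both_odd(3)[OF assms] by (auto simp: \<sigma>_def elim!: oddE)
    then have "height E (int m - 1) = - int d \<longleftrightarrow> E (m - 1) = \<sigma> - 1" for E
      unfolding height_before_last[OF m] by auto
    then have "card {E. good E \<and> height E (int m - 1) = - int d} =
        card {E \<in> lattice_paths (m - 1) \<sigma>. E (m - 1) = \<sigma> - 1}"
      using card_good[OF both_odd(1)[OF assms], of "\<lambda>E. E (m - 1) = \<sigma> - 1"] by (simp add: \<sigma>_def)
    also have "\<dots> = card (lattice_paths n (\<sigma> - 1))"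
      using card_lattice_paths_through[of n \<sigma> "\<lambda>v. v = \<sigma> - 1"] by (simp add: n)
    finally show ?thesis
      using False by (simp add: n)
  qed
  then show ?thesis
    unfolding card_bar_family_even[OF both_odd(2)[OF assms]] card_good_both_odd[OF assms] \<sigma>_def
    by simp
qed

end

section \<open>The four counting formulas\<close>

theorem theorem1p2:
  fixes s d :: nat
  assumes "0 < s" and "0 < d" and "coprime s d"
  shows
    "(odd s \<and> even d \<longrightarrow>
        card (BC s (s + d) (s + 2 * d)) = card (CS s (s + d) (s + 2 * d)) \<and>
        card (CS s (s + d) (s + 2 * d)) = card (DD s (s + d) (s + 2 * d)) \<and>
        card (DD s (s + d) (s + 2 * d)) =
          (\<Sum>i = 0..(s - 1) div 2.
             ((s + d - 3) div 2 choose (i div 2)) *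
             (((s + d - 1) div 2 - i div 2) choose ((s - 1) div 2 - i)))) \<and>
     (odd s \<and> odd d \<longrightarrow>
        card (BC s (s + d) (s + 2 * d)) = card (CS s (s + d) (s + 2 * d)) \<and>
        card (CS s (s + d) (s + 2 * d)) =
          (\<Sum>i = 0..(s - 1) div 2.
             (((d - 1) div 2 + i) choose (i div 2)) *
             (((s + d - 2) div 2 choose ((d - 1) div 2 + i)) +
              (if s + d < 4 then 0
               else (s + d - 4) div 2 choose ((d - 1) div 2 + i))))) \<and>
     (even s \<and> odd d \<longrightarrow>
        card (BC s (s + d) (s + 2 * d)) =
          (\<Sum>i = 0..s div 2.
             trinomial ((s + d - 1) div 2) (i div 2) ((d + i) div 2) (s div 2 - i)) \<and>
        card (CS s (s + d) (s + 2 * d)) =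
          (\<Sum>i = 0..(s - 2) div 2.
             ((s + d - 3) div 2 choose (i div 2)) *
             (((s + d - 3) div 2 - i div 2) choose ((s - 2) div 2 - i))) +
          (\<Sum>i = 0..(s - 2) div 2.
             ((s + d - 5) div 2 choose (i div 2)) *
             (((s + d - 1) div 2 - i div 2) choose ((s - 2) div 2 - i)))) \<and>
     (odd d \<longrightarrow>
        card (DD s (s + d) (s + 2 * d)) =
          (\<Sum>i = 0..(s - 1) div 2.
             trinomial ((s + d - 2) div 2) (i div 2) ((d + i) div 2) ((s - 1) div 2 - i)))"
proof -
  interpret abacus s d
    using assms by unfold_locales
  have A: "card (BC s (s + d) (s + 2 * d)) = card (CS s (s + d) (s + 2 * d)) \<and>
        card (CS s (s + d) (s + 2 * d)) = card (DD s (s + d) (s + 2 * d)) \<and>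
        card (DD s (s + d) (s + 2 * d)) =
          (\<Sum>i = 0..(s - 1) div 2.
             ((s + d - 3) div 2 choose (i div 2)) *
             (((s + d - 1) div 2 - i div 2) choose ((s - 1) div 2 - i)))"
    if "odd s" "even d"
  proof -
    have m: "s + d = 2 * m + 1"
      using that by (auto simp: m_def elim!: evenE oddE)
    have "(s + d - 3) div 2 = m - 1" "(s + d - 1) div 2 = m - 1 + 1"
      using m m_bounds by auto
    then show ?thesis
      using card_all_odd[OF that] by (simp add: shifted_path_number_def)
  qed
  have B: "card (BC s (s + d) (s + 2 * d)) = card (CS s (s + d) (s + 2 * d)) \<and>
        card (CS s (s + d) (s + 2 * d)) =
          (\<Sum>i = 0..(s - 1) div 2.
             (((d - 1) div 2 + i) choose (i div 2)) *
             (((s + d - 2) div 2 choose ((d - 1) div 2 + i)) +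
              (if s + d < 4 then 0
               else (s + d - 4) div 2 choose ((d - 1) div 2 + i))))"
    if "odd s" "odd d"
  proof -
    define M D where "M = (s - 1) div 2" and "D = (d - 1) div 2"
    have m: "s + d = 2 * m" "m = M + D + 1"
      using both_odd(3,4)[OF that] by (auto simp: M_def D_def)
    \<comment> \<open>As \<open>s + d\<close> is even, \<open>s + d < 4\<close> singles out
      \<open>m = 1\<close>, where the second binomial is set to 0.\<close>
    have idx: "(s + d - 2) div 2 = m - 1" "(s + d - 4) div 2 = m - 2" "s + d < 4 \<longleftrightarrow> m = 1"
      using m m_bounds by auto
    have 1: "(\<Sum>i = 0..M. ((D + i) choose (i div 2)) * ((m - 1) choose (D + i))) =
        path_number (m - 1) M"
      using m by (intro sum_binomial_product) simp
    have 2: "(\<Sum>i = 0..M. ((D + i) choose (i div 2)) * ((m - 2) choose (D + i))) =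
        card (lattice_paths (m - 2) (int M - 1))" if "m \<noteq> 1"
      using m that by (intro sum_binomial_product_top) auto
    have "(\<Sum>i = 0..M. ((D + i) choose (i div 2)) *
        (((m - 1) choose (D + i)) + (if m = 1 then 0 else (m - 2) choose (D + i)))) =
        path_number (m - 1) M + (if m = 1 then 0 else card (lattice_paths (m - 2) (int M - 1)))"
    proof (cases "m = 1")
      case True
      show ?thesis
        unfolding 1[symmetric] if_P[OF True] add_0_right ..
    next
      case False
      show ?thesis
        unfolding 1[symmetric] 2[OF False, symmetric] if_not_P[OF False]
        by (simp only: distrib_left sum.distrib)
    qed
    then show ?thesis
      unfolding idx M_def[symmetric] D_def[symmetric] card_BC_CS_even[OF both_odd(2)[OF that]]
        card_bar_family_both_odd[OF that, folded M_def] by simp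
  qed
  have C: "card (BC s (s + d) (s + 2 * d)) =
          (\<Sum>i = 0..s div 2.
             trinomial ((s + d - 1) div 2) (i div 2) ((d + i) div 2) (s div 2 - i)) \<and>
        card (CS s (s + d) (s + 2 * d)) =
          (\<Sum>i = 0..(s - 2) div 2.
             ((s + d - 3) div 2 choose (i div 2)) *
             (((s + d - 3) div 2 - i div 2) choose ((s - 2) div 2 - i))) +
          (\<Sum>i = 0..(s - 2) div 2.
             ((s + d - 5) div 2 choose (i div 2)) *
             (((s + d - 1) div 2 - i div 2) choose ((s - 2) div 2 - i)))"
    if "even s" "odd d"
  proof
    have m: "s + d = 2 * m + 1" "m = s div 2 + (d - 1) div 2"
      using that by (rule m_even_s)+
    have "(s + d - 1) div 2 = m"
      using m(1) by simp
    then show "card (BC s (s + d) (s + 2 * d)) = (\<Sum>i = 0..s div 2.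
        trinomial ((s + d - 1) div 2) (i div 2) ((d + i) div 2) (s div 2 - i))"
      using sum_trinomial[OF that(2) m(2)] card_BC_even_s[OF that] by simp
    show "card (CS s (s + d) (s + 2 * d)) =
          (\<Sum>i = 0..(s - 2) div 2.
             ((s + d - 3) div 2 choose (i div 2)) *
             (((s + d - 3) div 2 - i div 2) choose ((s - 2) div 2 - i))) +
          (\<Sum>i = 0..(s - 2) div 2.
             ((s + d - 5) div 2 choose (i div 2)) *
             (((s + d - 1) div 2 - i div 2) choose ((s - 2) div 2 - i)))"
    proof (cases "2 \<le> m")
      case True
      then have "(s + d - 3) div 2 = m - 1" "(s + d - 5) div 2 = m - 2" "(s + d - 1) div 2 = m - 2 + 2"
        using m(1) by auto
      then show ?thesis
        using card_CS_even_s_formula[OF that] by (simp add: shifted_path_number_def)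
    next
      case False
      then have "m = 1"
        using m_bounds by simp
      then have "s = 2" "d = 1"
        using m(1) that s_pos d_pos by presburger+
      \<comment> \<open>Here the truncated \<open>s + d - 5\<close> and \<open>m - 2\<close> are
        both 0, so the formula keeps its form.\<close>
      then show ?thesis
        using card_CS_even_s_formula[OF that] \<open>m = 1\<close> by (simp add: shifted_path_number_def)
    qed
  qed
  have D: "card (DD s (s + d) (s + 2 * d)) =
          (\<Sum>i = 0..(s - 1) div 2.
             trinomial ((s + d - 2) div 2) (i div 2) ((d + i) div 2) ((s - 1) div 2 - i))"
    if "odd d"
  proof -
    \<comment> \<open>For odd \<open>d\<close> both parities of \<open>s\<close> leave the single
      end \<open>(s - 1) div 2\<close> after \<open>m - 1\<close> steps, so (d) needs no case
      distinction.\<close>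
    have "card (DD s (s + d) (s + 2 * d)) = path_number (m - 1) ((s - 1) div 2)"
      using card_DD_even_s_formula[OF _ that] card_BC_CS_even(3)[OF both_odd(2)[OF _ that]]
        bij_betw_same_card[OF bij_betw_beads] card_good_both_odd[OF _ that]
      by (cases "even s") simp_all
    moreover have "(s + d - 2) div 2 = m - 1"
      by (simp add: m_def)
    moreover have "m - 1 = (s - 1) div 2 + (d - 1) div 2"
      using that s_pos by (cases "even s") (auto simp: m_def elim!: oddE evenE)
    ultimately show ?thesis
      using sum_trinomial[OF that] by simp
  qed
  show ?thesis
    using A B C D by blast
qed

end
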